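(* Let $D\ge 2$, let $\mathcal{B}$ be a bubble and $\Omega$ a pairing of $\mathcal{B}$, and let $\mathcal{M}(\mathcal{B},\Omega)$ be the ciliated edge-colored map constructed from $(\mathcal{B},\Omega)$ as described in the context. For every integer $p\ge 0$ there is a bijection between $\mathbb{G}_p(\mathcal{B})$ and $\mathbb{W}_p(\mathcal{M}(\mathcal{B},\Omega))$. Under this bijection, the bubbles (connected components isomorphic to $\mathcal{B}$ after deleting color-0 edges) of a graph are mapped to the submaps isomorphic to $\mathcal{M}(\mathcal{B},\Omega)$, the edges of color $0$ are mapped to the corners around black vertices, and the faces of each color $i\in[D]$ are mapped to the faces of color $i$ of the stuffed Walsh map which go along at least one black vertex.
   Context: Write $[D]=\{1,\dots,D\}$. A bubble is a finite connected bipartite graph (multiple edges allowed) whose edges carry colors in $[D]$, every vertex being incident to exactly one edge of each color. A pairing $\Omega$ of a bubble is a partition of its vertex set into pairs each consisting of one white and one black vertex. $\mathbb{G}_p(\mathcal{B})$: the set of connected bipartite graphs with edges colored in $\{0,1,\dots,D\}$ such that every vertex is incident to exactly one edge of each color $1,\dots,D$ and to at most one edge of color $0$, exactly $p$ white and $p$ black vertices have no incident edge of color $0$, and every connected component of the graph obtained by deleting the color-0 edges is isomorphic (as an edge-colored graph) to $\mathcal{B}$. A face of color $i\in[D]$ of such a graph is a closed cycle alternating edges of colors $0$ and $i$. Construction of $\mathcal{M}(\mathcal{B},\Omega)$: form the directed graph $\mathcal{B}_{\circlearrowleft,\Omega}$ with one vertex per pair of $\Omega$ and, for each edge of color $i$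 of $\mathcal{B}$ joining the white vertex of pair $x$ to the black vertex of pair $y$ with $x\neq y$, a directed edge of color $i$ from $x$ to $y$ (edges joining the two vertices of a same pair are discarded). Embed $\mathcal{B}_{\circlearrowleft,\Omega}$ as a map with one cilium at each vertex such that, going clockwise around each vertex starting from its cilium, one meets first all outgoing edges and then all incoming edges (the relative order of edges of different colors within each group is arbitrary); then forget orientations. The result is an edge-colored map (edges colored in $[D]$, coloring not necessarily proper) with one cilium per vertex, one vertex per pair of $\Omega$. Stuffed Walsh maps: for an edge-colored map $\mathcal{M}$ with cilia, $\mathbb{W}_p(\mathcal{M})$ is the set of connected maps with black and blue vertices such that: black vertices are adjacent only to blue vertices; deleting the black vertices and replacing each black–blue edge by a cilium at its blue endpoint (at the same position in the rotation) yields a disjoint union of ciliated edge-colored maps each isomorphic to $\mathcal{M}$; each black–blue edge carries as label the set of colors of $[D]$ incident to its blue endpoint in $\mathcal{M}$; and there are $p$ cilia placed in corners of black vertices, at most one per black vertex. For $i\in[D]$, the monochromatic submap $\mathcal{W}^{(i)}$ of such a map $\mathcal{W}$ is obtained by deleting every edge whose color (or color label) does not contain $i$, keeping all vertices; the faces of color $i$ of $\mathcal{W}$ are the faces (boundary walks) of $\mathcal{W}^{(i)}$.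
   Formalization: Literal claim fails, so: copies of B and M carry identifications; plain isomorphism classes are matched only if every automorphism of B is induced by one of M; for p>0, corners with a cilium and boundary walks through a cilium do not count as corners or faces. *)

theory Defs
  imports
    Main
    "HOL-Library.Disjoint_Sets"
    "HOL-Combinatorics.Orbits"
    "HOL-Combinatorics.Cycles"
begin

section \<open>Bipartite edge-colored graphs\<close>

text \<open>
  An edge is a triple (color, white end, black end).  Parallel edges are allowed as long as
  their colors differ; this is no restriction here, because every graph considered has at most
  one edge of a given color at each vertex.
\<close>

record 'v cgraph =
  white :: "'v set"
  black :: "'v set"
  cedges :: "(nat \<times> 'v \<times> 'v) set"

definition verts :: "'v cgraph \<Rightarrow> 'v set" where
  "verts G = white G \<union> black G"

definition bip_graph :: "nat set \<Rightarrow> 'v cgraph \<Rightarrow> bool" where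
  "bip_graph C G \<longleftrightarrow> finite (verts G) \<and> white G \<inter> black G = {} \<and>
     cedges G \<subseteq> C \<times> white G \<times> black G"

definition adj :: "'v cgraph \<Rightarrow> ('v \<times> 'v) set" where
  "adj G = {(u, v). \<exists>i. (i, u, v) \<in> cedges G \<or> (i, v, u) \<in> cedges G}"

definition graph_connected :: "'v cgraph \<Rightarrow> bool" where
  "graph_connected G \<longleftrightarrow> verts G \<noteq> {} \<and> (\<forall>u\<in>verts G. \<forall>v\<in>verts G. (u, v) \<in> (adj G)\<^sup>*)"

definition one_edge_per_color :: "nat \<Rightarrow> 'v cgraph \<Rightarrow> bool" where
  "one_edge_per_color D G \<longleftrightarrow> (\<forall>i\<in>{1..D}.
     (\<forall>w\<in>white G. \<exists>!b. (i, w, b) \<in> cedges G) \<and> (\<forall>b\<in>black G. \<exists>!w. (i, w, b) \<in> cedges G))"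

definition bubble :: "nat \<Rightarrow> 'v cgraph \<Rightarrow> bool" where
  "bubble D B \<longleftrightarrow> bip_graph {1..D} B \<and> graph_connected B \<and> one_edge_per_color D B"

definition pairing :: "'v cgraph \<Rightarrow> 'v set set \<Rightarrow> bool" where
  "pairing B \<Omega> \<longleftrightarrow> partition_on (verts B) \<Omega> \<and> (\<forall>x\<in>\<Omega>. \<exists>w\<in>white B. \<exists>b\<in>black B. x = {w, b})"

text \<open>Isomorphisms preserve the edge colors and the white/black bipartition.\<close>

definition graph_iso :: "('v \<Rightarrow> 'w) \<Rightarrow> 'v cgraph \<Rightarrow> 'w cgraph \<Rightarrow> bool" where
  "graph_iso f G H \<longleftrightarrow> bij_betw f (verts G) (verts H) \<and>
     f ` white G = white H \<and> f ` black G = black H \<and>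
     (\<forall>i. \<forall>w\<in>white G. \<forall>b\<in>black G. (i, w, b) \<in> cedges G \<longleftrightarrow> (i, f w, f b) \<in> cedges H)"

definition delete_color0 :: "'v cgraph \<Rightarrow> 'v cgraph" where
  "delete_color0 G = G\<lparr>cedges := {e \<in> cedges G. fst e \<noteq> 0}\<rparr>"

definition induced :: "'v cgraph \<Rightarrow> 'v set \<Rightarrow> 'v cgraph" where
  "induced G X = \<lparr>white = white G \<inter> X, black = black G \<inter> X,
     cedges = {(i, w, b) \<in> cedges G. w \<in> X \<and> b \<in> X}\<rparr>"

definition graph_components :: "'v cgraph \<Rightarrow> 'v cgraph set" where
  "graph_components G = {induced G {v \<in> verts G. (u, v) \<in> (adj G)\<^sup>*} | u. u \<in> verts G}"

definition bubbles_of :: "'v cgraph \<Rightarrow> 'v cgraph set" where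
  "bubbles_of G = graph_components (delete_color0 G)"

text \<open>The set \<open>\<bbbG>\<^sub>p(\<B>)\<close>.\<close>

definition bubble_graphs :: "nat \<Rightarrow> 'v cgraph \<Rightarrow> nat \<Rightarrow> 'a cgraph set" where
  "bubble_graphs D B p = {G.
     bip_graph {0..D} G \<and> graph_connected G \<and> one_edge_per_color D G \<and>
     (\<forall>w b b'. (0, w, b) \<in> cedges G \<and> (0, w, b') \<in> cedges G \<longrightarrow> b = b') \<and>
     (\<forall>w w' b. (0, w, b) \<in> cedges G \<and> (0, w', b) \<in> cedges G \<longrightarrow> w = w') \<and>
     card {w \<in> white G. \<not> (\<exists>b. (0, w, b) \<in> cedges G)} = p \<and>
     card {b \<in> black G. \<not> (\<exists>w. (0, w, b) \<in> cedges G)} = p \<and>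
     (\<forall>H\<in>bubbles_of G. \<exists>f. graph_iso f H B)}"

text \<open>
  A face of color \<open>i\<close> is the edge set of a closed cycle
  \<open>w 0, b 0, w 1, b 1, \<dots>, w (n - 1), b (n - 1), w 0\<close> in which each step from \<open>w k\<close> to \<open>b k\<close>
  has color \<open>i\<close> and each step from \<open>b k\<close> to the next white vertex has color 0.
\<close>

definition graph_faces :: "'v cgraph \<Rightarrow> nat \<Rightarrow> (nat \<times> 'v \<times> 'v) set set" where
  "graph_faces G i = {F. \<exists>n w b. 0 < n \<and> inj_on w {..<n} \<and> inj_on b {..<n} \<and>
     (\<forall>k<n. (i, w k, b k) \<in> cedges G \<and> (0, w (Suc k mod n), b k) \<in> cedges G) \<and>
     F = (\<Union>k<n. {(i, w k, b k), (0, w (Suc k mod n), b k)})}"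


section \<open>Combinatorial maps with cilia\<close>

text \<open>
  Maps are given by half-edges (darts): \<open>rot\<close> sends a dart to the next one clockwise around its
  vertex, so vertices are the orbits of \<open>rot\<close>, and \<open>opp\<close> exchanges the two halves of an edge.
  Fixed points of \<open>opp\<close> are cilia.  An edge of color \<open>i\<close> has label \<open>{i}\<close> on both darts.
  The dart \<open>d\<close> also names the corner between \<open>d\<close> and \<open>rot d\<close>.
\<close>

record 'd cmap =
  darts :: "'d set"
  rot :: "'d \<Rightarrow> 'd"
  opp :: "'d \<Rightarrow> 'd"
  lab :: "'d \<Rightarrow> nat set"

definition comb_map :: "('d, 'z) cmap_scheme \<Rightarrow> bool" where
  "comb_map M \<longleftrightarrow> finite (darts M) \<and> rot M permutes darts M \<and> opp M permutes darts M \<and>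
     (\<forall>d\<in>darts M. opp M (opp M d) = d \<and> lab M (opp M d) = lab M d)"

definition dart_step :: "('d, 'z) cmap_scheme \<Rightarrow> ('d \<times> 'd) set" where
  "dart_step M = {(d, e). d \<in> darts M \<and> (e = rot M d \<or> e = opp M d)}"

definition map_connected :: "('d, 'z) cmap_scheme \<Rightarrow> bool" where
  "map_connected M \<longleftrightarrow> darts M \<noteq> {} \<and> (\<forall>d\<in>darts M. \<forall>e\<in>darts M. (d, e) \<in> (dart_step M)\<^sup>*)"

definition map_iso :: "('d \<Rightarrow> 'e) \<Rightarrow> ('d, 'y) cmap_scheme \<Rightarrow> ('e, 'z) cmap_scheme \<Rightarrow> bool" where
  "map_iso f M N \<longleftrightarrow> bij_betw f (darts M) (darts N) \<and>
     (\<forall>d\<in>darts M. f (rot M d) = rot N (f d) \<and> f (opp M d) = opp N (f d) \<and> lab N (f d) = lab M d)"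

definition submap :: "('d, 'z) cmap_scheme \<Rightarrow> 'd set \<Rightarrow> 'd cmap" where
  "submap M X = \<lparr>darts = X, rot = perm_restrict (rot M) X, opp = perm_restrict (opp M) X,
     lab = lab M\<rparr>"

definition map_components :: "('d, 'z) cmap_scheme \<Rightarrow> 'd cmap set" where
  "map_components M = {submap M {e \<in> darts M. (d, e) \<in> (dart_step M)\<^sup>*} | d. d \<in> darts M}"

text \<open>
  A face is the set of corners met by a boundary walk: from the corner between \<open>d\<close> and \<open>rot d\<close>
  the walk follows \<open>rot d\<close> to its other end and enters the next corner there.  A dart fixed by
  \<open>opp\<close> is simply passed over.
\<close>

definition map_faces :: "('d, 'z) cmap_scheme \<Rightarrow> 'd set set" where
  "map_faces M = {orbit (opp M \<circ> rot M) d | d. d \<in> darts M}"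


section \<open>The map of a bubble with a pairing\<close>

text \<open>The arcs (color, source, target) of the directed graph on the pairs.\<close>

definition pair_arcs :: "'v cgraph \<Rightarrow> 'v set set \<Rightarrow> (nat \<times> 'v set \<times> 'v set) set" where
  "pair_arcs B \<Omega> = {(i, x, y). x \<in> \<Omega> \<and> y \<in> \<Omega> \<and> x \<noteq> y \<and>
     (\<exists>w\<in>x \<inter> white B. \<exists>b\<in>y \<inter> black B. (i, w, b) \<in> cedges B)}"

text \<open>
  The darts at the vertex \<open>x\<close>: its cilium, and the halves of the outgoing and of the incoming
  edge of color \<open>i\<close>.  Isomorphisms of maps do not see the constructors, so orientations
  are forgotten.
\<close>

datatype 'x hedge = Cil 'x | Out nat 'x | Inc nat 'x

text \<open>
  The embedding is determined by listing, for each pair, the colors of its outgoing edges and the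
  colors of its incoming edges in clockwise order.
\<close>

definition edge_orders ::
    "'v cgraph \<Rightarrow> 'v set set \<Rightarrow> ('v set \<Rightarrow> nat list) \<Rightarrow> ('v set \<Rightarrow> nat list) \<Rightarrow> bool" where
  "edge_orders B \<Omega> os is \<longleftrightarrow> (\<forall>x\<in>\<Omega>.
     distinct (os x) \<and> set (os x) = {i. \<exists>y. (i, x, y) \<in> pair_arcs B \<Omega>} \<and>
     distinct (is x) \<and> set (is x) = {i. \<exists>y. (i, y, x) \<in> pair_arcs B \<Omega>})"

definition around :: "('x \<Rightarrow> nat list) \<Rightarrow> ('x \<Rightarrow> nat list) \<Rightarrow> 'x \<Rightarrow> 'x hedge list" where
  "around os is x = Cil x # map (\<lambda>i. Out i x) (os x) @ map (\<lambda>i. Inc i x) (is x)"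

fun base :: "'x hedge \<Rightarrow> 'x" where
  "base (Cil x) = x"
| "base (Out i x) = x"
| "base (Inc i x) = x"

fun other_half :: "(nat \<times> 'x \<times> 'x) set \<Rightarrow> 'x hedge \<Rightarrow> 'x hedge" where
  "other_half A (Cil x) = Cil x"
| "other_half A (Out i x) = Inc i (THE y. (i, x, y) \<in> A)"
| "other_half A (Inc i x) = Out i (THE y. (i, y, x) \<in> A)"

fun hedge_label :: "'x hedge \<Rightarrow> nat set" where
  "hedge_label (Cil x) = {}"
| "hedge_label (Out i x) = {i}"
| "hedge_label (Inc i x) = {i}"

definition bubble_map ::
    "'v cgraph \<Rightarrow> 'v set set \<Rightarrow> ('v set \<Rightarrow> nat list) \<Rightarrow> ('v set \<Rightarrow> nat list) \<Rightarrow> 'v set hedge cmap" where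
  "bubble_map B \<Omega> os is = (let X = (\<Union>x\<in>\<Omega>. set (around os is x)) in
     \<lparr>darts = X,
      rot = perm_restrict (\<lambda>d. cycle_of_list (around os is (base d)) d) X,
      opp = perm_restrict (other_half (pair_arcs B \<Omega>)) X,
      lab = hedge_label\<rparr>)"


section \<open>Stuffed Walsh maps\<close>

text \<open>
  \<open>blk\<close> is the set of darts at black vertices; all other darts are at blue vertices.  \<open>cil\<close> is
  the set of corners of black vertices that carry a cilium.
\<close>

record 'd wmap = "'d cmap" +
  blk :: "'d set"
  cil :: "'d set"

text \<open>Deleting the black vertices, and replacing black-blue edges by cilia.\<close>

definition delete_black :: "'d wmap \<Rightarrow> 'd cmap" where
  "delete_black W = (let X = darts W - blk W in
     \<lparr>darts = X,
      rot = perm_restrict (rot W) X,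
      opp = perm_restrict (\<lambda>d. if opp W d \<in> blk W then d else opp W d) X,
      lab = (\<lambda>d. if opp W d \<in> blk W then {} else lab W d)\<rparr>)"

definition blue_submaps :: "'d wmap \<Rightarrow> 'd cmap set" where
  "blue_submaps W = map_components (delete_black W)"

text \<open>The set \<open>\<bbbW>\<^sub>p(\<M>)\<close>, for a connected map \<open>\<M>\<close>.\<close>

definition walsh_maps :: "'e cmap \<Rightarrow> nat \<Rightarrow> 'd wmap set" where
  "walsh_maps M p = {W.
     comb_map W \<and> (\<forall>d\<in>darts W. opp W d \<noteq> d) \<and> map_connected W \<and>
     blk W \<subseteq> darts W \<and> rot W ` blk W \<subseteq> blk W \<and>
     (\<forall>d\<in>blk W. opp W d \<notin> blk W) \<and>
     (\<forall>N\<in>blue_submaps W. \<exists>f. map_iso f N M) \<and>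
     (\<forall>d\<in>blk W. lab W d = (\<Union>e\<in>orbit (rot W) (opp W d). lab (delete_black W) e)) \<and>
     cil W \<subseteq> blk W \<and> card (cil W) = p \<and>
     (\<forall>c\<in>cil W. \<forall>c'\<in>cil W. c' \<in> orbit (rot W) c \<longrightarrow> c' = c)}"

text \<open>
  The monochromatic submap: the half-edges of a deleted edge are kept as inert darts fixed by
  \<open>opp\<close>, which boundary walks pass over.  In this way a vertex all of whose edges are deleted
  survives as an isolated vertex with exactly one face, and faces of the submap remain sets of
  corners of the full map.
\<close>

definition mono_submap :: "'d wmap \<Rightarrow> nat \<Rightarrow> 'd wmap" where
  "mono_submap W i = W\<lparr>opp := \<lambda>d. if i \<in> lab W d then opp W d else d\<rparr>"

text \<open>
  The faces of color \<open>i\<close> going along some black vertex.  As usual for maps with cilia, a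
  boundary walk reaching a ciliated corner is broken and is not a face.
\<close>

definition black_faces :: "'d wmap \<Rightarrow> nat \<Rightarrow> 'd set set" where
  "black_faces W i = {F \<in> map_faces (mono_submap W i). F \<inter> blk W \<noteq> {} \<and> F \<inter> cil W = {}}"


section \<open>Isomorphism classes and identifications\<close>

definition graph_iso_rel :: "'a cgraph set \<Rightarrow> 'a cgraph rel" where
  "graph_iso_rel S = {(G, G'). G \<in> S \<and> G' \<in> S \<and> (\<exists>f. graph_iso f G G')}"

definition walsh_iso :: "('d \<Rightarrow> 'e) \<Rightarrow> 'd wmap \<Rightarrow> 'e wmap \<Rightarrow> bool" where
  "walsh_iso f W W' \<longleftrightarrow> map_iso f W W' \<and> f ` blk W = blk W' \<and> f ` cil W = cil W'"

definition walsh_iso_rel :: "'d wmap set \<Rightarrow> 'd wmap rel" where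
  "walsh_iso_rel S = {(W, W'). W \<in> S \<and> W' \<in> S \<and> (\<exists>f. walsh_iso f W W')}"

text \<open>
  The pairing \<open>\<Omega>\<close> is transported to a bubble of a graph through an identification of that bubble
  with \<open>\<B>\<close>.  If \<open>\<B>\<close> has automorphisms that do not come from automorphisms of its map, different
  identifications yield different stuffed Walsh maps.  Therefore the copies of \<open>\<B>\<close> in a graph,
  and likewise the copies of \<open>\<M>\<close> in a map, carry an identification: a labelling \<open>\<theta>\<close> (or \<open>\<mu>\<close>)
  restricting to an isomorphism on each copy.
\<close>

definition id_graphs :: "nat \<Rightarrow> 'v cgraph \<Rightarrow> nat \<Rightarrow> ('a cgraph \<times> ('a \<Rightarrow> 'v)) set" where
  "id_graphs D B p = {(G, \<theta>). G \<in> bubble_graphs D B p \<and> (\<forall>H\<in>bubbles_of G. graph_iso \<theta> H B)}"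

definition id_graph_rel ::
    "('a cgraph \<times> ('a \<Rightarrow> 'v)) set \<Rightarrow> ('a cgraph \<times> ('a \<Rightarrow> 'v)) rel" where
  "id_graph_rel S = {((G, \<theta>), (G', \<theta>')). (G, \<theta>) \<in> S \<and> (G', \<theta>') \<in> S \<and>
     (\<exists>f. graph_iso f G G' \<and> (\<forall>v\<in>verts G. \<theta>' (f v) = \<theta> v))}"

definition id_walsh_maps :: "'e cmap \<Rightarrow> nat \<Rightarrow> ('d wmap \<times> ('d \<Rightarrow> 'e)) set" where
  "id_walsh_maps M p = {(W, \<mu>). W \<in> walsh_maps M p \<and> (\<forall>N\<in>blue_submaps W. map_iso \<mu> N M)}"

definition id_walsh_rel ::
    "('d wmap \<times> ('d \<Rightarrow> 'e)) set \<Rightarrow> ('d wmap \<times> ('d \<Rightarrow> 'e)) rel" where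
  "id_walsh_rel S = {((W, \<mu>), (W', \<mu>')). (W, \<mu>) \<in> S \<and> (W', \<mu>') \<in> S \<and>
     (\<exists>f. walsh_iso f W W' \<and> (\<forall>d\<in>darts W - blk W. \<mu>' (f d) = \<mu> d))}"


section \<open>The correspondence between the elements of a graph and of a map\<close>

text \<open>
  Given a map \<open>\<beta>\<close> from bubbles to blue submaps, \<open>d\<close> is the black half of the black-blue edge at
  the blue vertex which represents the pair containing the graph vertex \<open>v\<close>.
\<close>

definition black_dart_of ::
    "'v set set \<Rightarrow> 'a cgraph \<Rightarrow> ('a \<Rightarrow> 'v) \<Rightarrow> 'd wmap \<Rightarrow> ('d \<Rightarrow> 'v set hedge) \<Rightarrow>
      ('a cgraph \<Rightarrow> 'd cmap) \<Rightarrow> 'a \<Rightarrow> 'd \<Rightarrow> bool" where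
  "black_dart_of \<Omega> G \<theta> W \<mu> \<beta> v d \<longleftrightarrow> d \<in> blk W \<and>
     (\<exists>H\<in>bubbles_of G. v \<in> verts H \<and> opp W d \<in> darts (\<beta> H) \<and>
       (\<exists>x\<in>\<Omega>. \<theta> v \<in> x \<and> \<mu> (opp W d) = Cil x))"

text \<open>
  \<open>\<beta>\<close> maps bubbles to blue submaps, \<open>\<epsilon>\<close> maps edges of color 0 to (unciliated) corners of black
  vertices, and \<open>\<phi> i\<close> maps faces of color \<open>i\<close> to faces of color \<open>i\<close> along black vertices.
  The last two conditions say that these are compatible: the edge joining \<open>w\<close> and \<open>b\<close>
  becomes the corner that leads clockwise from the edge of the pair of \<open>b\<close> to the edge of the
  pair of \<open>w\<close>, and the image of a face passes through exactly the black corners that are images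
  of its edges of color 0.
\<close>

definition corresponds ::
    "nat \<Rightarrow> 'v set set \<Rightarrow> 'a cgraph \<times> ('a \<Rightarrow> 'v) \<Rightarrow> 'd wmap \<times> ('d \<Rightarrow> 'v set hedge) \<Rightarrow> bool" where
  "corresponds D \<Omega> = (\<lambda>(G, \<theta>) (W, \<mu>). \<exists>\<beta> \<epsilon> \<phi>.
     bij_betw \<beta> (bubbles_of G) (blue_submaps W) \<and>
     bij_betw \<epsilon> {e \<in> cedges G. fst e = 0} (blk W - cil W) \<and>
     (\<forall>i\<in>{1..D}. bij_betw (\<phi> i) (graph_faces G i) (black_faces W i)) \<and>
     (\<forall>w b. (0, w, b) \<in> cedges G \<longrightarrow>
        black_dart_of \<Omega> G \<theta> W \<mu> \<beta> b (\<epsilon> (0, w, b)) \<and>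
        black_dart_of \<Omega> G \<theta> W \<mu> \<beta> w (rot W (\<epsilon> (0, w, b)))) \<and>
     (\<forall>i\<in>{1..D}. \<forall>F\<in>graph_faces G i. \<phi> i F \<inter> blk W = \<epsilon> ` {e \<in> F. fst e = 0}))"

text \<open>Every automorphism of the bubble is induced by an automorphism of its map.\<close>

definition automorphisms_lift :: "'v cgraph \<Rightarrow> 'v set set \<Rightarrow> 'v set hedge cmap \<Rightarrow> bool" where
  "automorphisms_lift B \<Omega> M \<longleftrightarrow> (\<forall>a. graph_iso a B B \<longrightarrow>
     (\<exists>g. map_iso g M M \<and> (\<forall>x\<in>\<Omega>. g (Cil x) = Cil (a ` x))))"


section \<open>Identifications always exist\<close>

lemma graph_iso_cong:
  assumes "graph_iso f H B" "\<And>v. v \<in> verts H \<Longrightarrow> g v = f v"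
  shows "graph_iso g H B"
proof -
  have w: "\<And>v. v \<in> white H \<Longrightarrow> g v = f v" and b: "\<And>v. v \<in> black H \<Longrightarrow> g v = f v"
    using assms(2) by (auto simp: verts_def)
  have "bij_betw g (verts H) (verts B)"
    using assms bij_betw_cong[of "verts H" g f] by (auto simp: graph_iso_def)
  moreover have "g ` white H = white B" "g ` black H = black B"
    using assms(1) w b by (auto simp: graph_iso_def)
  ultimately show ?thesis
    using assms(1) w b by (simp add: graph_iso_def)
qed

lemma sym_adj: "sym (adj G)"
  by (auto simp: sym_def adj_def)

lemma verts_induced: "verts (induced G X) = verts G \<inter> X"
  by (auto simp: verts_def induced_def)

lemma graph_components_eq:
  assumes "H \<in> graph_components G" "v \<in> verts H"
  shows "H = induced G {x \<in> verts G. (v, x) \<in> (adj G)\<^sup>*}"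
proof -
  from assms(1) obtain u where H: "H = induced G {x \<in> verts G. (u, x) \<in> (adj G)\<^sup>*}"
    by (auto simp: graph_components_def)
  with assms(2) have uv: "(u, v) \<in> (adj G)\<^sup>*"
    by (auto simp: verts_induced)
  then have "(v, u) \<in> (adj G)\<^sup>*"
    using sym_rtrancl[OF sym_adj, of G] by (auto dest: symD)
  with uv have "(u, x) \<in> (adj G)\<^sup>* \<longleftrightarrow> (v, x) \<in> (adj G)\<^sup>*" for x
    by (meson rtrancl_trans)
  with H show ?thesis by simp
qed

lemma ex_id_graph:
  assumes "G \<in> bubble_graphs D B p"
  shows "\<exists>\<theta>. (G, \<theta>) \<in> id_graphs D B p"
proof -
  have "\<forall>H\<in>bubbles_of G. \<exists>f. graph_iso f H B"
    using assms by (simp add: bubble_graphs_def)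
  then obtain f where f: "\<And>H. H \<in> bubbles_of G \<Longrightarrow> graph_iso (f H) H B"
    by metis
  let ?G = "delete_color0 G"
  define \<theta> where "\<theta> v = f (induced ?G {x \<in> verts ?G. (v, x) \<in> (adj ?G)\<^sup>*}) v" for v
  have "graph_iso \<theta> H B" if "H \<in> bubbles_of G" for H
  proof (rule graph_iso_cong[OF f[OF that]])
    fix v assume "v \<in> verts H"
    with that show "\<theta> v = f H v"
      using graph_components_eq[of H ?G v] by (simp add: \<theta>_def bubbles_of_def)
  qed
  with assms show ?thesis by (auto simp: id_graphs_def)
qed

lemma map_iso_cong:
  assumes "map_iso f N M" "\<And>d. d \<in> darts N \<Longrightarrow> g d = f d"
    and "rot N ` darts N \<subseteq> darts N" "opp N ` darts N \<subseteq> darts N"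
  shows "map_iso g N M"
proof -
  have "bij_betw g (darts N) (darts M)"
    using assms(1,2) bij_betw_cong[of "darts N" g f] by (auto simp: map_iso_def)
  moreover have "rot N d \<in> darts N" "opp N d \<in> darts N" if "d \<in> darts N" for d
    using assms(3,4) that by auto
  ultimately show ?thesis
    using assms(1,2) by (simp add: map_iso_def)
qed

lemma permutes_rtrancl_back:
  assumes "f permutes X" "finite X" "d \<in> X" "\<And>e. e \<in> X \<Longrightarrow> (e, f e) \<in> R"
  shows "(f d, d) \<in> R\<^sup>*"
proof -
  have reach: "e \<in> X \<and> (f d, e) \<in> R\<^sup>*" if "e \<in> orbit f (f d)" for e
    using that
  proof induction
    case base
    have "f d \<in> X" using assms(1,3) by (simp add: permutes_in_image)
    then show ?case using assms(1,4) by (auto simp: permutes_in_image)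
  next
    case (step y)
    then show ?case using assms(1,4) by (auto simp: permutes_in_image intro: rtrancl_into_rtrancl)
  qed
  have "permutation f" using assms(1,2) permutation_permutes by blast
  then have "d \<in> orbit f d" by (rule permutation_self_in_orbit)
  moreover have "orbit f d \<subseteq> insert (f d) (orbit f (f d))"
  proof
    fix e assume "e \<in> orbit f d"
    then show "e \<in> insert (f d) (orbit f (f d))"
      by induction (auto intro: orbit.intros)
  qed
  ultimately show ?thesis using reach by auto
qed

lemma delete_black_closed:
  assumes "W \<in> walsh_maps M p"
  shows "rot (delete_black W) permutes darts (delete_black W)"
    and "d \<in> darts (delete_black W) \<Longrightarrow> opp (delete_black W) d \<in> darts (delete_black W)"
    and "d \<in> darts (delete_black W) \<Longrightarrow> opp (delete_black W) (opp (delete_black W) d) = d"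
proof -
  have W: "finite (darts W)" "rot W permutes darts W" "opp W permutes darts W"
    "\<And>d. d \<in> darts W \<Longrightarrow> opp W (opp W d) = d" "blk W \<subseteq> darts W" "rot W ` blk W \<subseteq> blk W"
    using assms by (auto simp: walsh_maps_def comb_map_def)
  have inj: "inj (rot W)" using W(2) by (rule permutes_inj)
  have "finite (blk W)" using W(1,5) finite_subset by blast
  then have "rot W ` blk W = blk W"
    using W(6) inj by (simp add: endo_inj_surj inj_on_subset)
  then have "rot W ` (darts W - blk W) = darts W - blk W"
    using image_set_diff[OF inj, of "darts W" "blk W"] permutes_image[OF W(2)] by simp
  then have "bij_betw (rot W) (darts W - blk W) (darts W - blk W)"
    using inj_on_subset[OF inj subset_UNIV] by (simp add: bij_betw_def)
  then have "bij_betw (perm_restrict (rot W) (darts W - blk W)) (darts W - blk W) (darts W - blk W)"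
    by (subst bij_betw_cong[where g = "rot W"]) (auto simp: perm_restrict_def)
  then show "rot (delete_black W) permutes darts (delete_black W)"
    by (intro bij_imp_permutes) (auto simp: delete_black_def Let_def perm_restrict_def)
  show "opp (delete_black W) d \<in> darts (delete_black W)" if "d \<in> darts (delete_black W)"
    using that W(3) by (auto simp: delete_black_def Let_def perm_restrict_def permutes_in_image)
  show "opp (delete_black W) (opp (delete_black W) d) = d" if "d \<in> darts (delete_black W)"
    using that W(3,4) by (auto simp: delete_black_def Let_def perm_restrict_def permutes_in_image)
qed

lemma ex_id_walsh_map:
  assumes "W \<in> walsh_maps M p"
  shows "\<exists>\<mu>. (W, \<mu>) \<in> id_walsh_maps M p"
proof -
  let ?N = "delete_black W"
  let ?C = "\<lambda>d. {e \<in> darts ?N. (d, e) \<in> (dart_step ?N)\<^sup>*}"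
  note cl = delete_black_closed[OF assms]
  have fin: "finite (darts ?N)"
    using assms by (auto simp: walsh_maps_def comb_map_def delete_black_def Let_def)
  have back1: "(e, d) \<in> (dart_step ?N)\<^sup>*" if "(d, e) \<in> dart_step ?N" for d e
  proof -
    have d: "d \<in> darts ?N" and "e = rot ?N d \<or> e = opp ?N d"
      using that by (auto simp: dart_step_def)
    then show ?thesis
    proof (elim disjE)
      assume "e = rot ?N d"
      then show ?thesis
        using permutes_rtrancl_back[OF cl(1) fin d, of "dart_step ?N"] by (auto simp: dart_step_def)
    next
      assume "e = opp ?N d"
      then have "(e, d) \<in> dart_step ?N" using cl(2,3) d by (simp add: dart_step_def)
      then show ?thesis by blast
    qed
  qed
  have rev: "(e, d) \<in> (dart_step ?N)\<^sup>*" if "(d, e) \<in> (dart_step ?N)\<^sup>*" for d e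
    using that by induction (auto intro: back1 rtrancl_trans)
  have comp: "K = submap ?N (?C d)" if K: "K \<in> blue_submaps W" "d \<in> darts K" for K d
  proof -
    from K obtain c where c: "K = submap ?N (?C c)" "(c, d) \<in> (dart_step ?N)\<^sup>*"
      by (auto simp: blue_submaps_def map_components_def submap_def)
    then have "?C c = ?C d" using rev by (auto intro: rtrancl_trans)
    with c show ?thesis by simp
  qed
  have closed: "rot K ` darts K \<subseteq> darts K \<and> opp K ` darts K \<subseteq> darts K"
    if K: "K \<in> blue_submaps W" for K
  proof -
    from K obtain c where c: "K = submap ?N (?C c)"
      by (auto simp: blue_submaps_def map_components_def)
    have "rot ?N d \<in> ?C c \<and> opp ?N d \<in> ?C c" if "d \<in> ?C c" for d
    proof -
      have "(d, rot ?N d) \<in> dart_step ?N" "(d, opp ?N d) \<in> dart_step ?N"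
        using that by (auto simp: dart_step_def)
      then show ?thesis
        using that cl(1,2) by (auto simp: permutes_in_image intro: rtrancl_into_rtrancl)
    qed
    then show ?thesis by (auto simp: c submap_def perm_restrict_def)
  qed
  have "\<forall>K\<in>blue_submaps W. \<exists>f. map_iso f K M"
    using assms by (simp add: walsh_maps_def)
  then obtain f where f: "\<And>K. K \<in> blue_submaps W \<Longrightarrow> map_iso (f K) K M"
    by metis
  define \<mu> where "\<mu> d = f (submap ?N (?C d)) d" for d
  have "map_iso \<mu> K M" if "K \<in> blue_submaps W" for K
    using map_iso_cong[OF f[OF that]] comp[OF that] closed[OF that] by (simp add: \<mu>_def)
  with assms show ?thesis by (auto simp: id_walsh_maps_def)
qed

end

theory Submission
  imports Defs
begin

text \<open>
  Both sides carry the same data.  Let \<open>K\<close> index the copies of \<open>\<B>\<close>, respectively of \<open>\<M>\<close>.  The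
  edges of color 0 of a graph form a partial injection \<open>\<tau>\<close> of \<open>K \<times> \<Omega>\<close>: an edge between \<open>w\<close> and \<open>b\<close>
  sends the pair of \<open>b\<close> to the pair of \<open>w\<close>.  On the side of maps, the black half-edges are in
  bijection with \<open>K \<times> \<Omega>\<close> through the cilia they replace, and the rotation at the black vertices,
  restricted to the corners without cilium, is again a partial injection of \<open>K \<times> \<Omega>\<close>.  The
  rotation at the ciliated corners is no further information: a partial injection \<open>\<tau>\<close> of a finite
  set extends to exactly one permutation all of whose cycles contain at most one point outside the
  domain of \<open>\<tau>\<close>, namely the one which closes every maximal path of \<open>\<tau>\<close> into a cycle.
  Isomorphisms preserving the identifications act on both sides by relabelling \<open>K\<close>.

  A face of color \<open>i\<close> alternates \<open>\<tau>\<close> with the permutation of \<open>\<Omega>\<close> that maps the pair of a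
  white vertex to the pair of its neighbor of color \<open>i\<close>.  In the map, the boundary walk of color \<open>i\<close>
  realizes this as its first return to the black corners: it enters a blue vertex at its cilium and,
  since outgoing edges precede incoming ones, first meets the outgoing edge of color \<open>i\<close>, which it
  follows; from there it meets only incoming edges of other colors before reaching the next cilium.

  Without identifications one also needs that automorphisms of \<open>\<B>\<close> and of \<open>\<M>\<close> induce each
  other.  From \<open>\<M>\<close> to \<open>\<B>\<close> this is automatic: every blue vertex has as many incoming as outgoing
  edges, so the rotation starting at the cilium determines the orientations.
\<close>

section \<open>Orbits and quotients\<close>

text \<open>The pair of \<open>K\<close> and \<tau> is called a code below. It is determined only up
  to renumbering the copies, so there is no canonical map from graphs to codes. Hence the bijection
  is not composed of functions: an identified graph and an identified map are related when they
  share some code, and such a relation descends to the quotients as soon as it is total on both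
  sides and compatible with isomorphism. The obstacle is that the rotation at ciliated corners
  belongs to the map but not to its code. Whatever depends on the full rotation therefore passes
  through the uniqueness of the closing permutation. The step that this permutation adds leads from
  the end of a maximal path, where the graph has a free black vertex, to its start, where it has a
  free white vertex. It creates no connection that the path does not already give, and a boundary
  walk using it crosses a ciliated corner, so it occurs in no face that is counted. Dropping the
  identifications replaces one code by others for the same object, which differ by automorphisms on
  each copy. All that matters then is how automorphisms of \<open>B\<close> and of \<open>M\<close>
  act on the pairs.\<close>

lemma bij_betw_quotients:
  assumes r: "equiv A r" and s: "equiv B s"
    and total_A: "\<And>a. a \<in> A \<Longrightarrow> \<exists>b\<in>B. R a b" and total_B: "\<And>b. b \<in> B \<Longrightarrow> \<exists>a\<in>A. R a b"
    and compat: "\<And>a b a' b'. \<lbrakk>a \<in> A; b \<in> B; a' \<in> A; b' \<in> B; R a b; R a' b'\<rbrakk> \<Longrightarrow> (a, a') \<in> r \<longleftrightarrow> (b, b') \<in> s"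
    and satur: "\<And>a b b'. \<lbrakk>a \<in> A; R a b; (b, b') \<in> s\<rbrakk> \<Longrightarrow> R a b'"
  shows "\<exists>\<Phi>. bij_betw \<Phi> (A // r) (B // s) \<and> (\<forall>a\<in>A. \<forall>b\<in>\<Phi> (r `` {a}). R a b)"
proof -
  \<comment> \<open>Collecting everything related to some member avoids a choice of representatives;
    \<open>compat\<close> puts all of it into one class and \<open>satur\<close> fills that
    class.\<close>
  define \<Phi> where "\<Phi> X = {b \<in> B. \<exists>a\<in>X. R a b}" for X
  have rA: "r \<subseteq> A \<times> A" and sB: "s \<subseteq> B \<times> B" using r s by (auto simp: equiv_def)
  have \<Phi>: "\<Phi> (r `` {a}) = s `` {b}" if "a \<in> A" "b \<in> B" "R a b" for a b
  proof
    show "\<Phi> (r `` {a}) \<subseteq> s `` {b}"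
    proof
      fix b' assume "b' \<in> \<Phi> (r `` {a})"
      then obtain a' where "b' \<in> B" "(a, a') \<in> r" "R a' b'" by (auto simp: \<Phi>_def)
      with compat[of a b a' b'] that rA show "b' \<in> s `` {b}" by blast
    qed
    have "(a, a) \<in> r" using r that by (meson equivE refl_onD)
    then show "s `` {b} \<subseteq> \<Phi> (r `` {a})" using satur[OF that(1,3)] sB by (auto simp: \<Phi>_def)
  qed
  have "bij_betw \<Phi> (A // r) (B // s)"
  proof (rule bij_betwI')
    fix X Y assume "X \<in> A // r" "Y \<in> A // r"
    then obtain a a' where X: "X = r `` {a}" "a \<in> A" and Y: "Y = r `` {a'}" "a' \<in> A"
      by (auto elim!: quotientE)
    obtain b b' where b: "b \<in> B" "R a b" "b' \<in> B" "R a' b'" using total_A X(2) Y(2) by metis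
    have "X = Y \<longleftrightarrow> (a, a') \<in> r" using eq_equiv_class_iff[OF r X(2) Y(2)] X Y by simp
    also have "\<dots> \<longleftrightarrow> (b, b') \<in> s" using compat b X Y by blast
    also have "\<dots> \<longleftrightarrow> \<Phi> X = \<Phi> Y" using eq_equiv_class_iff[OF s b(1,3)] X Y b \<Phi> by simp
    finally show "(\<Phi> X = \<Phi> Y) = (X = Y)" by simp
  next
    fix X assume "X \<in> A // r"
    then obtain a where X: "X = r `` {a}" "a \<in> A" by (auto elim!: quotientE)
    then obtain b where "b \<in> B" "R a b" using total_A by blast
    with X \<Phi> show "\<Phi> X \<in> B // s" by (auto intro: quotientI)
  next
    fix Y assume "Y \<in> B // s"
    then obtain b where Y: "Y = s `` {b}" "b \<in> B" by (auto elim!: quotientE)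
    then obtain a where "a \<in> A" "R a b" using total_B by blast
    with Y \<Phi> have "Y = \<Phi> (r `` {a})" "r `` {a} \<in> A // r" by (auto intro: quotientI)
    then show "\<exists>X\<in>A // r. Y = \<Phi> X" by blast
  qed
  moreover have "R a b" if "a \<in> A" "b \<in> \<Phi> (r `` {a})" for a b
  proof -
    obtain b0 where "b0 \<in> B" "R a b0" using total_A \<open>a \<in> A\<close> by blast
    with that \<Phi> satur show ?thesis by blast
  qed
  ultimately show ?thesis by blast
qed

text \<open>Coordinates turn the rotation and the boundary walk into permutations of
  \<open>M\<close> or of positions; this carries the orbits along. The commutation is asked only on
  a set closed under \<open>f\<close>.\<close>

lemma orbit_image_semiconj:
  assumes "a \<in> Y" "f ` Y \<subseteq> Y" "\<And>y. y \<in> Y \<Longrightarrow> h (f y) = g (h y)"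
  shows "h ` orbit f a = orbit g (h a)"
proof
  have *: "e \<in> Y \<and> h e \<in> orbit g (h a)" if "e \<in> orbit f a" for e
    using that
  proof induction
    case base
    show ?case using assms by (auto intro: orbit.base)
  next
    case (step y)
    then have "h (f y) = g (h y)" "f y \<in> Y" using assms by auto
    with step show ?case by (auto intro: orbit.step)
  qed
  then show "h ` orbit f a \<subseteq> orbit g (h a)" by blast
  have "e \<in> h ` orbit f a" if "e \<in> orbit g (h a)" for e
    using that
  proof induction
    case base
    show ?case using assms(1,3) by (metis image_eqI orbit.base)
  next
    case (step y)
    then obtain z where z: "z \<in> orbit f a" "y = h z" by blast
    then have "g y = h (f z)" using * assms(3) by simp
    with z show ?case by (auto intro: orbit.step)
  qed
  then show "orbit g (h a) \<subseteq> h ` orbit f a" by blast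
qed

text \<open>Meant for \<open>f\<close> the boundary walk, \<open>Y\<close> the black half-edges and
  \<open>r\<close> the step from one black corner of a face to the next. The orbit of
  \<open>f\<close> splits into excursions, and only the last point of an excursion lies in
  \<open>Y\<close>.\<close>

lemma orbit_first_return:
  assumes "r ` Y \<subseteq> Y" "a \<in> Y"
    and ret: "\<And>y. y \<in> Y \<Longrightarrow> \<exists>n. (f ^^ Suc n) y = r y \<and> (\<forall>j. 0 < j \<and> j \<le> n \<longrightarrow> (f ^^ j) y \<notin> Y)"
  shows "orbit f a \<inter> Y = orbit r a"
proof
  have rY: "y \<in> Y" if "y \<in> orbit r a" for y
    using that by induction (use assms(1,2) in auto)
  \<comment> \<open>Each point is step \<open>j\<close> of an excursion from some \<open>z\<close>
    to \<open>r z\<close>. The point \<open>a\<close> has to be added to \<open>orbit r a\<close>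
    because \<open>orbit\<close> begins with the first image.\<close>
  have inv: "\<exists>z\<in>insert a (orbit r a). \<exists>n j. e = (f ^^ j) z \<and> 0 < j \<and> j \<le> Suc n \<and> (f ^^ Suc n) z = r z \<and>
      (\<forall>j. 0 < j \<and> j \<le> n \<longrightarrow> (f ^^ j) z \<notin> Y)" if "e \<in> orbit f a" for e
    using that
  proof induction
    case base
    from ret[OF assms(2)] obtain n where
      "(f ^^ Suc n) a = r a" "\<forall>j. 0 < j \<and> j \<le> n \<longrightarrow> (f ^^ j) a \<notin> Y" by blast
    then show ?case by (intro bexI[of _ a] exI[of _ n] exI[of _ 1]) auto
  next
    case (step y)
    then obtain z n j where z: "z \<in> insert a (orbit r a)" "y = (f ^^ j) z" "0 < j" "j \<le> Suc n"
      "(f ^^ Suc n) z = r z" "\<forall>j. 0 < j \<and> j \<le> n \<longrightarrow> (f ^^ j) z \<notin> Y" by blast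
    show ?case
    proof (cases "j \<le> n")
      case True
      with z show ?thesis by (intro bexI[of _ z] exI[of _ n] exI[of _ "Suc j"]) auto
    next
      case False
      with z have "j = Suc n" by simp
      with z have y: "y = r z" by simp
      then have yo: "y \<in> orbit r a" using z(1) by (auto intro: orbit.intros)
      from ret[OF rY[OF yo]] obtain m where
        "(f ^^ Suc m) y = r y" "\<forall>j. 0 < j \<and> j \<le> m \<longrightarrow> (f ^^ j) y \<notin> Y" by blast
      with yo show ?thesis by (intro bexI[of _ y] exI[of _ m] exI[of _ 1]) auto
    qed
  qed
  show "orbit f a \<inter> Y \<subseteq> orbit r a"
  proof
    fix e assume e: "e \<in> orbit f a \<inter> Y"
    then obtain z n j where z: "z \<in> insert a (orbit r a)" "e = (f ^^ j) z" "0 < j" "j \<le> Suc n"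
      "(f ^^ Suc n) z = r z" "\<forall>j. 0 < j \<and> j \<le> n \<longrightarrow> (f ^^ j) z \<notin> Y" using inv by blast
    have "j = Suc n" using z e by (metis IntD2 le_Suc_eq)
    with z have "e = r z" by simp
    with z(1) show "e \<in> orbit r a" by (auto intro: orbit.intros)
  qed
  have pow: "(f ^^ Suc n) z \<in> orbit f z" for n z by (induction n) (auto intro: orbit.intros)
  have rf: "r z \<in> orbit f z" if "z \<in> Y" for z
    using ret[OF that] pow[of _ z] by metis
  have "e \<in> orbit f a \<inter> Y" if "e \<in> orbit r a" for e
    using that
  proof induction
    case base
    show ?case using rf assms by blast
  next
    case (step y)
    then show ?case using rf[of y] assms(1) orbit_trans[of "r y" f y a] by blast
  qed
  then show "orbit r a \<subseteq> orbit f a \<inter> Y" by blast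
qed

text \<open>Translates cycles listed by an index, such as faces of graphs and rotations at the
  vertices of \<open>M\<close>, into orbits.\<close>

lemma orbit_cyclic_sequence:
  assumes "0 < n" "\<And>k. k < n \<Longrightarrow> g (s k) = s (Suc k mod n)"
  shows "orbit g (s 0) = s ` {..<n}"
proof -
  have pow: "(g ^^ k) (s 0) = s (k mod n)" for k
  proof (induction k)
    case (Suc k)
    then show ?case using assms by (simp add: mod_Suc_eq)
  qed simp
  show ?thesis
  proof
    show "orbit g (s 0) \<subseteq> s ` {..<n}" using pow assms(1) by (auto simp: orbit_altdef)
    show "s ` {..<n} \<subseteq> orbit g (s 0)"
    proof
      fix y assume "y \<in> s ` {..<n}"
      then obtain k where "k < n" "y = s k" by blast
      \<comment> \<open>\<open>orbit\<close> consists of positive iterates, so a full turn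
        \<open>n\<close> is added in order to reach \<open>s 0\<close> too.\<close>
      then have "y = (g ^^ (k + n)) (s 0)" "0 < k + n" using pow assms(1) by auto
      then show "y \<in> orbit g (s 0)" by (auto simp: orbit_altdef)
    qed
  qed
qed

lemma rtrancl_bij_iff:
  assumes "bij_betw f A A'" "R \<subseteq> A \<times> A" "R' \<subseteq> A' \<times> A'"
    and iff: "\<And>a b. a \<in> A \<Longrightarrow> b \<in> A \<Longrightarrow> (a, b) \<in> R \<longleftrightarrow> (f a, f b) \<in> R'"
    and ab: "a \<in> A" "b \<in> A"
  shows "(a, b) \<in> R\<^sup>* \<longleftrightarrow> (f a, f b) \<in> R'\<^sup>*"
proof
  assume "(a, b) \<in> R\<^sup>*"
  then show "(f a, f b) \<in> R'\<^sup>*"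
    by induction (use assms(2) iff in \<open>auto intro: rtrancl_into_rtrancl\<close>)
next
  have "c' \<in> A' \<and> (\<forall>c\<in>A. f c = c' \<longrightarrow> (a, c) \<in> R\<^sup>*)" if "(f a, c') \<in> R'\<^sup>*" for c'
    using that
  proof induction
    case base
    then show ?case using assms(1) ab by (auto simp: bij_betw_def inj_on_def)
  next
    case (step y z)
    then obtain y0 where y0: "y0 \<in> A" "f y0 = y" using assms(1) by (auto simp: bij_betw_def)
    have "(a, c) \<in> R\<^sup>*" if "c \<in> A" "f c = z" for c
      using step y0 that iff[of y0 c] by (auto intro: rtrancl_into_rtrancl)
    with step assms(3) show ?case by blast
  qed
  then show "(f a, f b) \<in> R'\<^sup>* \<Longrightarrow> (a, b) \<in> R\<^sup>*" using ab by blast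
qed

lemma bij_betw_card_not_in:
  assumes "bij_betw f A S"
  shows "card {a \<in> A. f a \<notin> X} = card (S - X)"
proof -
  have "f ` {a \<in> A. f a \<notin> X} = S - X" using assms by (auto simp: bij_betw_def)
  moreover have "inj_on f {a \<in> A. f a \<notin> X}" using assms by (auto simp: bij_betw_def inj_on_def)
  ultimately show ?thesis by (metis card_image)
qed

lemma bij_betw_involution:
  assumes "\<And>d. d \<in> A \<Longrightarrow> f d \<in> A" "\<And>d. d \<in> A \<Longrightarrow> f (f d) = d"
  shows "bij_betw f A A"
  by (rule bij_betwI[where g = f]) (use assms in auto)

text \<open>Pieces of a boundary walk are easily concatenated as a relation, while the first return
  is stated with iterates. The relation restricts only the point reached by each step, so the
  starting point may lie in \<open>Y\<close>.\<close>

lemma funpow_of_rtrancl_avoiding: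
  assumes "(d, e) \<in> {(y, f y) | y. f y \<notin> Y}\<^sup>*"
  shows "\<exists>n. e = (f ^^ n) d \<and> (\<forall>j. 0 < j \<and> j \<le> n \<longrightarrow> (f ^^ j) d \<notin> Y)"
  using assms
proof induction
  case base
  show ?case by (rule exI[of _ 0]) simp
next
  case (step y z)
  then obtain n where n: "y = (f ^^ n) d" "\<forall>j. 0 < j \<and> j \<le> n \<longrightarrow> (f ^^ j) d \<notin> Y" by blast
  have z: "z = f y" "f y \<notin> Y" using step(2) by auto
  show ?case by (rule exI[of _ "Suc n"]) (use n z in \<open>auto simp: le_Suc_eq\<close>)
qed

section \<open>Closing a partial injection to a permutation\<close>

definition partial_inj :: "'s set \<Rightarrow> 's rel \<Rightarrow> bool" where
  "partial_inj S \<tau> \<longleftrightarrow> finite S \<and> \<tau> \<subseteq> S \<times> S \<and> single_valued \<tau> \<and> single_valued (\<tau>\<inverse>)"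

text \<open>The points outside \<open>Domain \<tau>\<close> stand for the ciliated corners, and the
  last clause is the condition of at most one cilium per black vertex.\<close>

definition closing :: "'s set \<Rightarrow> 's rel \<Rightarrow> ('s \<Rightarrow> 's) \<Rightarrow> bool" where
  "closing S \<tau> \<sigma> \<longleftrightarrow> \<sigma> permutes S \<and> (\<forall>(a, b)\<in>\<tau>. \<sigma> a = b) \<and>
     (\<forall>a\<in>S - Domain \<tau>. \<forall>a'\<in>S - Domain \<tau>. a' \<in> orbit \<sigma> a \<longrightarrow> a' = a)"

lemma partial_injD:
  assumes "partial_inj S \<tau>"
  shows "(a, b) \<in> \<tau> \<Longrightarrow> (a, b') \<in> \<tau> \<Longrightarrow> b = b'" "(a, b) \<in> \<tau> \<Longrightarrow> (a', b) \<in> \<tau> \<Longrightarrow> a = a'"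
    "(a, b) \<in> \<tau> \<Longrightarrow> a \<in> S \<and> b \<in> S"
  using assms by (auto simp: partial_inj_def dest: single_valuedD)

text \<open>This is why a graph has as many free white as free black vertices, and why the single
  number p also counts cilia.\<close>

lemma partial_inj_card:
  assumes "partial_inj S \<tau>"
  shows "card (S - Range \<tau>) = card (S - Domain \<tau>)"
proof -
  have "inj_on fst \<tau>" "inj_on snd \<tau>"
    using partial_injD(1,2)[OF assms] by (auto intro!: inj_onI)
  then have "card (Domain \<tau>) = card (Range \<tau>)" by (simp add: Domain_fst Range_snd card_image)
  moreover have "Domain \<tau> \<subseteq> S" "Range \<tau> \<subseteq> S" "finite S" using assms by (auto simp: partial_inj_def)
  ultimately show ?thesis by (simp add: card_Diff_subset finite_subset)
qed

text \<open>Successors being unique, two paths from the same point agree as long as both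
  last.\<close>

lemma single_valued_rtrancl_linear:
  assumes "single_valued \<tau>" "(a, b) \<in> \<tau>\<^sup>*" "(a, c) \<in> \<tau>\<^sup>*"
  shows "(b, c) \<in> \<tau>\<^sup>* \<or> (c, b) \<in> \<tau>\<^sup>*"
  using assms(2)
proof induction
  case base
  then show ?case using assms(3) by simp
next
  case (step y z)
  from step.IH show ?case
  proof
    assume "(y, c) \<in> \<tau>\<^sup>*"
    then show ?thesis
    proof (cases rule: converse_rtranclE)
      case base
      then show ?thesis using step by auto
    next
      case (step u)
      then show ?thesis using \<open>(y, z) \<in> \<tau>\<close> assms(1) by (auto dest: single_valuedD)
    qed
  next
    assume "(c, y) \<in> \<tau>\<^sup>*"
    with step show ?thesis by (meson rtrancl_into_rtrancl)
  qed
qed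

text \<open>Linearity for the converse relation: of two ancestors of a point one is an ancestor of
  the other, and a point without predecessor has no ancestor but itself.\<close>

lemma path_start_unique:
  assumes "partial_inj S \<tau>" "(s, a) \<in> \<tau>\<^sup>*" "(s', a) \<in> \<tau>\<^sup>*" "s \<notin> Range \<tau>" "s' \<notin> Range \<tau>"
  shows "s = s'"
proof -
  have "(a, s) \<in> (\<tau>\<inverse>)\<^sup>*" "(a, s') \<in> (\<tau>\<inverse>)\<^sup>*" using assms(2,3) by (simp_all add: rtrancl_converse)
  then have "(s, s') \<in> (\<tau>\<inverse>)\<^sup>* \<or> (s', s) \<in> (\<tau>\<inverse>)\<^sup>*"
    using assms(1) by (intro single_valued_rtrancl_linear) (auto simp: partial_inj_def)
  then show ?thesis
  proof
    assume "(s, s') \<in> (\<tau>\<inverse>)\<^sup>*"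
    then show ?thesis using assms(4) by (cases rule: converse_rtranclE) auto
  next
    assume "(s', s) \<in> (\<tau>\<inverse>)\<^sup>*"
    then show ?thesis using assms(5) by (cases rule: converse_rtranclE) auto
  qed
qed

lemma path_end_unique:
  assumes "partial_inj S \<tau>" "(s, a) \<in> \<tau>\<^sup>*" "(s, a') \<in> \<tau>\<^sup>*" "a \<notin> Domain \<tau>" "a' \<notin> Domain \<tau>"
  shows "a = a'"
proof -
  have "(a, a') \<in> \<tau>\<^sup>* \<or> (a', a) \<in> \<tau>\<^sup>*"
    using assms by (intro single_valued_rtrancl_linear) (auto simp: partial_inj_def)
  then show ?thesis
  proof
    assume "(a, a') \<in> \<tau>\<^sup>*"
    then show ?thesis using assms(4) by (cases rule: converse_rtranclE) auto
  next
    assume "(a', a) \<in> \<tau>\<^sup>*"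
    then show ?thesis using assms(5) by (cases rule: converse_rtranclE) auto
  qed
qed

text \<open>If walking backwards from \<open>a\<close> never stopped, taking predecessors would be
  an injection of the finite set of ancestors of \<open>a\<close> into itself, hence onto; then
  \<open>a\<close> would be a predecessor and have a successor.\<close>

lemma path_start_ex:
  assumes "partial_inj S \<tau>" "a \<in> S" "a \<notin> Domain \<tau>"
  shows "\<exists>s\<in>S. (s, a) \<in> \<tau>\<^sup>* \<and> s \<notin> Range \<tau>"
proof (rule ccontr)
  assume no: "\<not> ?thesis"
  define X where "X = {s \<in> S. (s, a) \<in> \<tau>\<^sup>*}"
  have fin: "finite X" using assms(1) by (simp add: X_def partial_inj_def)
  have "\<forall>s\<in>X. \<exists>t. (t, s) \<in> \<tau>" using no by (auto simp: X_def)
  then obtain prev where prev: "\<And>s. s \<in> X \<Longrightarrow> (prev s, s) \<in> \<tau>" by metis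
  have "prev ` X \<subseteq> X"
    using prev assms(1) by (auto simp: X_def partial_inj_def intro: converse_rtrancl_into_rtrancl)
  moreover have "inj_on prev X"
    using prev assms(1) by (auto simp: inj_on_def partial_inj_def single_valued_def) metis
  ultimately have "prev ` X = X" using fin by (simp add: endo_inj_surj)
  moreover have "a \<in> X" using assms(2) by (simp add: X_def)
  ultimately show False using prev assms(3) by (metis Domain.DomainI imageE)
qed

lemma closing_ex:
  assumes pi: "partial_inj S \<tau>"
  shows "\<exists>\<sigma>. closing S \<tau> \<sigma>"
proof -
  have sv: "\<And>a b c. (a, b) \<in> \<tau> \<Longrightarrow> (a, c) \<in> \<tau> \<Longrightarrow> b = c" "\<And>a b c. (a, c) \<in> \<tau> \<Longrightarrow> (b, c) \<in> \<tau> \<Longrightarrow> a = b"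
    and fin: "finite S" and sub: "\<tau> \<subseteq> S \<times> S"
    using pi by (auto simp: partial_inj_def single_valued_def)
  obtain st where st: "\<And>a. a \<in> S - Domain \<tau> \<Longrightarrow> st a \<in> S \<and> (st a, a) \<in> \<tau>\<^sup>* \<and> st a \<notin> Range \<tau>"
    using path_start_ex[OF pi] by (metis Diff_iff)
  \<comment> \<open>Follow \<tau> where possible, otherwise jump back to the start of the path that
    ends here. Off \<open>S\<close> the value is \<open>a\<close> itself, as \<open>permutes\<close>
    demands.\<close>
  define \<sigma> where "\<sigma> a = (if a \<in> Domain \<tau> then (THE b. (a, b) \<in> \<tau>) else if a \<in> S then st a else a)" for a
  have \<sigma>\<tau>: "\<sigma> a = b" if "(a, b) \<in> \<tau>" for a b
    using that sv(1) by (auto simp: \<sigma>_def Domain.DomainI intro!: the_equality)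
  have \<sigma>st: "\<sigma> a = st a" if "a \<in> S - Domain \<tau>" for a
    using that by (simp add: \<sigma>_def)
  have "inj_on \<sigma> S"
  proof (rule inj_onI)
    fix a b assume ab: "a \<in> S" "b \<in> S" "\<sigma> a = \<sigma> b"
    consider "a \<in> Domain \<tau>" "b \<in> Domain \<tau>" | "a \<in> Domain \<tau>" "b \<notin> Domain \<tau>"
      | "a \<notin> Domain \<tau>" "b \<in> Domain \<tau>" | "a \<notin> Domain \<tau>" "b \<notin> Domain \<tau>" by blast
    then show "a = b"
    proof cases
      case 1
      then show ?thesis using ab \<sigma>\<tau> sv(2) by (metis DomainE)
    next
      case 2
      then show ?thesis using ab \<sigma>\<tau> \<sigma>st[of b] st[of b] by (metis DiffI DomainE Range.RangeI)
    next
      case 3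
      then show ?thesis using ab \<sigma>\<tau> \<sigma>st[of a] st[of a] by (metis DiffI DomainE Range.RangeI)
    next
      case 4
      then have "(\<sigma> a, a) \<in> \<tau>\<^sup>*" "(\<sigma> a, b) \<in> \<tau>\<^sup>*" using ab \<sigma>st st by force+
      then show ?thesis using path_end_unique[OF pi] 4 by blast
    qed
  qed
  moreover have im: "\<sigma> ` S \<subseteq> S"
  proof
    fix b assume "b \<in> \<sigma> ` S"
    then obtain a where a: "a \<in> S" "b = \<sigma> a" by blast
    show "b \<in> S"
    proof (cases "a \<in> Domain \<tau>")
      case True
      then show ?thesis using a \<sigma>\<tau> sub by blast
    next
      case False
      then show ?thesis using a \<sigma>st st by simp
    qed
  qed
  ultimately have "bij_betw \<sigma> S S" using fin by (simp add: bij_betw_def endo_inj_surj)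
  moreover have "\<sigma> a = a" if "a \<notin> S" for a using that sub by (auto simp: \<sigma>_def)
  ultimately have "\<sigma> permutes S" by (rule bij_imp_permutes)
  moreover have "a' = a" if a: "a \<in> S - Domain \<tau>" and a': "a' \<in> S - Domain \<tau>" "a' \<in> orbit \<sigma> a" for a a'
  proof -
    \<comment> \<open>The orbit of an end \<open>a\<close> jumps to the start of its path and then
      runs along this path, so it never leaves it. Any other end on the path would have a
      successor.\<close>
    have "(e, a) \<in> \<tau>\<^sup>*" if "e \<in> orbit \<sigma> a" for e
      using that
    proof induction
      case base
      then show ?case using a \<sigma>st st by simp
    next
      case (step y)
      from step.IH show ?case
      proof (cases rule: converse_rtranclE)
        case base
        then show ?thesis using a \<sigma>st st by simp
      next
        case (step u)
        then show ?thesis using \<sigma>\<tau> by simp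
      qed
    qed
    then have "(a', a) \<in> \<tau>\<^sup>*" using a' by blast
    then show ?thesis using a' by (cases rule: converse_rtranclE) auto
  qed
  ultimately have "closing S \<tau> \<sigma>" using \<sigma>\<tau> by (auto simp: closing_def)
  then show ?thesis by blast
qed

text \<open>The uniqueness behind the closing. The orbit of the end \<open>a\<close> contains no
  other end, so from \<open>\<sigma> a\<close> on it moves along \<tau> until it comes back to
  \<open>a\<close>. A predecessor of \<open>\<sigma> a\<close> under \<tau> would have the same
  image as \<open>a\<close> and hence equal \<open>a\<close>, which has no successor.\<close>

lemma closing_start:
  assumes cl: "closing S \<tau> \<sigma>" and pi: "partial_inj S \<tau>" and a: "a \<in> S" "a \<notin> Domain \<tau>"
  shows "(\<sigma> a, a) \<in> \<tau>\<^sup>*" "\<sigma> a \<notin> Range \<tau>"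
proof -
  have perm: "\<sigma> permutes S" and \<sigma>\<tau>: "\<And>a b. (a, b) \<in> \<tau> \<Longrightarrow> \<sigma> a = b"
    and one: "\<And>a'. a' \<in> S \<Longrightarrow> a' \<notin> Domain \<tau> \<Longrightarrow> a' \<in> orbit \<sigma> a \<Longrightarrow> a' = a"
    using cl a by (auto simp: closing_def)
  have fin: "finite S" using pi by (simp add: partial_inj_def)
  have "(\<sigma> a, e) \<in> \<tau>\<^sup>* \<and> e \<in> S" if "e \<in> orbit \<sigma> a" for e
    using that
  proof induction
    case base
    show ?case using perm a by (simp add: permutes_in_image)
  next
    case (step y)
    have "\<sigma> y \<in> S" using step perm by (simp add: permutes_in_image)
    moreover have "(\<sigma> a, \<sigma> y) \<in> \<tau>\<^sup>*"
    proof (cases "y \<in> Domain \<tau>")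
      case True
      then show ?thesis using step \<sigma>\<tau> by (metis DomainE rtrancl.rtrancl_into_rtrancl)
    next
      case False
      then show ?thesis using one[of y] step by simp
    qed
    ultimately show ?case by simp
  qed
  moreover have "a \<in> orbit \<sigma> a"
    using perm fin by (auto intro!: permutation_self_in_orbit simp: permutation_permutes)
  ultimately show "(\<sigma> a, a) \<in> \<tau>\<^sup>*" by blast
  show "\<sigma> a \<notin> Range \<tau>"
  proof
    assume "\<sigma> a \<in> Range \<tau>"
    then obtain y where y: "(y, \<sigma> a) \<in> \<tau>" by blast
    then have "\<sigma> y = \<sigma> a" by (rule \<sigma>\<tau>)
    then have "y = a" using perm by (metis permutes_def)
    with y a show False by blast
  qed
qed

text \<open>A bijection that matches the partial injections takes maximal paths to maximal paths,
  hence ends and starts to ends and starts. This gives uniqueness of the closing together with its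
  invariance under relabelling.\<close>

lemma closing_intertwine:
  assumes cl: "closing S \<tau> \<sigma>" and pi: "partial_inj S \<tau>"
    and cl': "closing S' \<tau>' \<sigma>'" and pi': "partial_inj S' \<tau>'"
    and f: "bij_betw f S S'" and iff: "\<And>a b. a \<in> S \<Longrightarrow> b \<in> S \<Longrightarrow> (a, b) \<in> \<tau> \<longleftrightarrow> (f a, f b) \<in> \<tau>'"
    and a: "a \<in> S"
  shows "f (\<sigma> a) = \<sigma>' (f a)"
proof -
  have sub: "\<tau> \<subseteq> S \<times> S" "\<tau>' \<subseteq> S' \<times> S'" using pi pi' by (auto simp: partial_inj_def)
  have perm: "\<sigma> permutes S" and \<sigma>\<tau>: "\<And>a b. (a, b) \<in> \<tau> \<Longrightarrow> \<sigma> a = b"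
    and \<sigma>\<tau>': "\<And>a b. (a, b) \<in> \<tau>' \<Longrightarrow> \<sigma>' a = b" using cl cl' by (auto simp: closing_def)
  have fS: "\<And>a. a \<in> S \<Longrightarrow> f a \<in> S'" "\<And>b. b \<in> S' \<Longrightarrow> \<exists>a\<in>S. b = f a"
    using f by (auto simp: bij_betw_def)
  have \<sigma>S: "\<sigma> a \<in> S" using perm a by (simp add: permutes_in_image)
  show ?thesis
  proof (cases "a \<in> Domain \<tau>")
    case True
    then obtain b where b: "(a, b) \<in> \<tau>" by blast
    then have "(f a, f b) \<in> \<tau>'" using iff sub by blast
    with b \<sigma>\<tau> \<sigma>\<tau>' show ?thesis by simp
  next
    case False
    have "f a \<notin> Domain \<tau>'"
    proof
      assume "f a \<in> Domain \<tau>'"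
      then obtain b' where b': "(f a, b') \<in> \<tau>'" by blast
      then obtain b where "b \<in> S" "b' = f b" using fS(2) sub by blast
      with b' iff a False show False by blast
    qed
    note st' = closing_start[OF cl' pi' fS(1)[OF a] this]
    note st = closing_start[OF cl pi a False]
    have "(f (\<sigma> a), f a) \<in> \<tau>'\<^sup>*"
      using rtrancl_bij_iff[OF f sub iff \<sigma>S a] st(1) by blast
    moreover have "f (\<sigma> a) \<notin> Range \<tau>'"
    proof
      assume "f (\<sigma> a) \<in> Range \<tau>'"
      then obtain b' where b': "(b', f (\<sigma> a)) \<in> \<tau>'" by blast
      then obtain b where "b \<in> S" "b' = f b" using fS(2) sub by blast
      with b' iff \<sigma>S st(2) show False by blast
    qed
    ultimately show ?thesis using path_start_unique[OF pi'] st' by blast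
  qed
qed

section \<open>Isomorphisms\<close>

lemma graph_iso_comp:
  assumes "graph_iso f G H" "graph_iso g H K"
  shows "graph_iso (g \<circ> f) G K"
proof -
  have "bij_betw (g \<circ> f) (verts G) (verts K)"
    using assms by (auto simp: graph_iso_def intro: bij_betw_trans)
  moreover have "(g \<circ> f) ` white G = white K" "(g \<circ> f) ` black G = black K"
    unfolding image_comp[symmetric] using assms by (simp_all add: graph_iso_def)
  moreover have "f w \<in> white H" "f b \<in> black H" if "w \<in> white G" "b \<in> black G" for w b
    using assms(1) that by (auto simp: graph_iso_def)
  ultimately show ?thesis using assms by (simp add: graph_iso_def)
qed

lemma graph_iso_inv:
  assumes "graph_iso f G H"
  shows "graph_iso (inv_into (verts G) f) H G"
proof -
  have bij: "bij_betw f (verts G) (verts H)" using assms by (simp add: graph_iso_def)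
  let ?g = "inv_into (verts G) f"
  have gf: "?g (f v) = v" if "v \<in> verts G" for v
    using bij that by (simp add: bij_betw_inv_into_left)
  have w: "f ` white G = white H" and b: "f ` black G = black H"
    using assms by (auto simp: graph_iso_def)
  have w': "?g ` white H = white G" and b': "?g ` black H = black G"
    using gf by (auto simp: w[symmetric] b[symmetric] verts_def image_image)
  have "(i, w, b) \<in> cedges H \<longleftrightarrow> (i, ?g w, ?g b) \<in> cedges G" if wb: "w \<in> white H" "b \<in> black H" for i w b
  proof -
    obtain w0 b0 where "w = f w0" "b = f b0" "w0 \<in> white G" "b0 \<in> black G"
      using wb unfolding w[symmetric] b[symmetric] by blast
    then show ?thesis using assms gf by (simp add: graph_iso_def verts_def)
  qed
  then show ?thesis using bij_betw_inv_into[OF bij] w' b' by (simp add: graph_iso_def)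
qed

lemma map_iso_comp:
  assumes "map_iso f M N" "map_iso g N P"
  shows "map_iso (g \<circ> f) M P"
proof -
  have "bij_betw (g \<circ> f) (darts M) (darts P)"
    using assms by (auto simp: map_iso_def intro: bij_betw_trans)
  moreover have "f d \<in> darts N" if "d \<in> darts M" for d
    using assms(1) that by (auto simp: map_iso_def bij_betw_def)
  ultimately show ?thesis using assms by (simp add: map_iso_def)
qed

lemma map_iso_inv:
  assumes "map_iso f M N" "\<And>d. d \<in> darts M \<Longrightarrow> rot M d \<in> darts M \<and> opp M d \<in> darts M"
  shows "map_iso (inv_into (darts M) f) N M"
proof -
  have bij: "bij_betw f (darts M) (darts N)" using assms by (simp add: map_iso_def)
  let ?g = "inv_into (darts M) f"
  have gf: "?g (f d) = d" if "d \<in> darts M" for d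
    using bij that by (simp add: bij_betw_inv_into_left)
  have "?g (rot N d) = rot M (?g d) \<and> ?g (opp N d) = opp M (?g d) \<and> lab M (?g d) = lab N d"
    if d: "d \<in> darts N" for d
  proof -
    obtain d0 where d0: "d = f d0" "d0 \<in> darts M" using d bij by (auto simp: bij_betw_def)
    then have "rot N d = f (rot M d0)" "opp N d = f (opp M d0)" "lab N d = lab M d0"
      using assms(1) by (auto simp: map_iso_def)
    then show ?thesis using d0 gf assms(2) by simp
  qed
  then show ?thesis using bij_betw_inv_into[OF bij] by (simp add: map_iso_def)
qed

lemma walsh_iso_comp:
  assumes "walsh_iso f V W" "walsh_iso g W X"
  shows "walsh_iso (g \<circ> f) V X"
  using assms map_iso_comp[of f V W g X] unfolding walsh_iso_def image_comp[symmetric] by simp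

lemma walsh_iso_inv:
  assumes "walsh_iso f V W" "\<And>d. d \<in> darts V \<Longrightarrow> rot V d \<in> darts V \<and> opp V d \<in> darts V"
    "blk V \<subseteq> darts V" "cil V \<subseteq> blk V"
  shows "walsh_iso (inv_into (darts V) f) W V"
proof -
  have bij: "bij_betw f (darts V) (darts W)" using assms by (simp add: walsh_iso_def map_iso_def)
  have "inv_into (darts V) f ` f ` X = X" if "X \<subseteq> darts V" for X
    using bij that by (simp add: bij_betw_def inv_into_image_cancel)
  then have "inv_into (darts V) f ` f ` blk V = blk V" "inv_into (darts V) f ` f ` cil V = cil V"
    using assms(3,4) by auto
  then show ?thesis using map_iso_inv[OF _ assms(2)] assms(1) by (auto simp: walsh_iso_def)
qed

lemma graph_iso_ident: "graph_iso (\<lambda>v. v) G G"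
  by (simp add: graph_iso_def bij_betw_def)

lemma map_iso_ident: "map_iso (\<lambda>d. d) N N"
  by (simp add: map_iso_def bij_betw_def)

lemma walsh_iso_blue:
  assumes "walsh_iso f W' W" "blk W' \<subseteq> darts W'" "d \<in> darts W' - blk W'"
  shows "f d \<in> darts W - blk W"
proof -
  have bij: "bij_betw f (darts W') (darts W)" and im: "f ` blk W' = blk W"
    using assms(1) by (auto simp: walsh_iso_def map_iso_def)
  have "f d \<notin> f ` blk W'" using bij assms(2,3) by (auto simp: bij_betw_def dest: inj_onD)
  then show ?thesis using im bij_betwE[OF bij] assms(3) by auto
qed

text \<open>The isomorphism classes are taken among graphs on natural numbers, while the standard
  graph of a code lives on another type.\<close>

lemma ex_nat_graph_iso:
  fixes H :: "'b cgraph"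
  assumes "bip_graph C H"
  shows "\<exists>(G :: nat cgraph) c. bip_graph C G \<and> graph_iso c G H"
proof -
  have fin: "finite (verts H)" and dis: "white H \<inter> black H = {}" and sub: "cedges H \<subseteq> C \<times> white H \<times> black H"
    using assms by (auto simp: bip_graph_def)
  obtain f :: "'b \<Rightarrow> nat" where f: "inj_on f (verts H)"
    using finite_imp_inj_to_nat_seg[OF fin] by auto
  define G where "G = \<lparr>white = f ` white H, black = f ` black H,
    cedges = (\<lambda>(i, w, b). (i, f w, f b)) ` cedges H\<rparr>"
  have vG: "verts G = f ` verts H" by (auto simp: G_def verts_def)
  have "f u = f v \<longleftrightarrow> u = v" if "u \<in> verts H" "v \<in> verts H" for u v
    using f that by (auto dest: inj_onD)
  then have f_eq: "f u = f v \<longleftrightarrow> u = v" if "u \<in> white H \<union> black H" "v \<in> white H \<union> black H" for u v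
    using that by (simp add: verts_def)
  have "bip_graph C G"
    using fin dis sub f_eq by (auto simp: bip_graph_def vG) (auto simp: G_def)
  moreover have "graph_iso f H G"
  proof -
    have "(i, w, b) \<in> cedges H \<longleftrightarrow> (i, f w, f b) \<in> cedges G" if "w \<in> white H" "b \<in> black H" for i w b
      using that f_eq sub by (force simp: G_def)
    then show ?thesis using f by (simp add: graph_iso_def vG bij_betw_def) (simp add: G_def)
  qed
  ultimately show ?thesis using graph_iso_inv by blast
qed

text \<open>Besides changing the type, the copy extends rotation and involution by the identity off
  the darts. The standard map does not do this, so here its permutations are described by
  \<open>bij_betw\<close> and those of the copy by \<open>permutes\<close>.\<close>

lemma ex_nat_walsh_iso:
  fixes S :: "'b wmap"
  assumes fin: "finite (darts S)" and rot: "bij_betw (rot S) (darts S) (darts S)"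
    and opp: "bij_betw (opp S) (darts S) (darts S)" and blk: "blk S \<subseteq> darts S" and cil: "cil S \<subseteq> blk S"
  shows "\<exists>(W :: nat wmap) c. rot W permutes darts W \<and> opp W permutes darts W \<and> blk W \<subseteq> darts W \<and>
    cil W \<subseteq> blk W \<and> walsh_iso c W S"
proof -
  obtain f :: "'b \<Rightarrow> nat" where f: "inj_on f (darts S)" using finite_imp_inj_to_nat_seg[OF fin] by auto
  define g where "g = inv_into (darts S) f"
  have gf: "g (f d) = d" if "d \<in> darts S" for d using f that by (simp add: g_def)
  define X where "X = f ` darts S"
  have gX: "bij_betw g X (darts S)" and fX: "bij_betw f (darts S) X"
    using f bij_betw_inv_into[of f "darts S" X] by (auto simp: X_def g_def bij_betw_def)
  have perm: "(\<lambda>n. if n \<in> X then f (p (g n)) else n) permutes X" if p: "bij_betw p (darts S) (darts S)" for p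
  proof (rule bij_imp_permutes)
    have "bij_betw (f \<circ> p \<circ> g) X X" using gX p fX by (meson bij_betw_trans)
    then show "bij_betw (\<lambda>n. if n \<in> X then f (p (g n)) else n) X X"
      by (subst bij_betw_cong[where g = "f \<circ> p \<circ> g"]) auto
  qed simp
  define W where "W = \<lparr>darts = X, rot = (\<lambda>n. if n \<in> X then f (rot S (g n)) else n),
    opp = (\<lambda>n. if n \<in> X then f (opp S (g n)) else n), lab = (\<lambda>n. lab S (g n)),
    blk = f ` blk S, cil = f ` cil S\<rparr>"
  have gim: "g ` f ` Y = Y" if "Y \<subseteq> darts S" for Y using that gf by (force simp: image_image)
  have "rot S d \<in> darts S" "opp S d \<in> darts S" if "d \<in> darts S" for d
    using that rot opp bij_betwE by blast+
  then have "map_iso g W S" using gX gf bij_betwE[OF gX] by (auto simp: map_iso_def W_def)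
  then have "walsh_iso g W S" using gim blk cil by (simp add: walsh_iso_def) (auto simp: W_def)
  moreover have "rot W permutes darts W" "opp W permutes darts W"
    using perm[OF rot] perm[OF opp] by (simp_all add: W_def)
  moreover have "blk W \<subseteq> darts W" "cil W \<subseteq> blk W" using blk cil by (auto simp: W_def X_def)
  ultimately show ?thesis by blast
qed

text \<open>Steps along the rotation are directed, but on a finite set the rotation can be undone by
  repeating it; the other steps are involutive.\<close>

lemma dart_step_rtrancl_sym:
  assumes "finite (darts N)" "rot N permutes darts N"
    and "\<And>d. d \<in> darts N \<Longrightarrow> opp N d \<in> darts N \<and> opp N (opp N d) = d"
    and de: "(d, e) \<in> (dart_step N)\<^sup>*"
  shows "(e, d) \<in> (dart_step N)\<^sup>*"
proof -
  have back1: "(z, y) \<in> (dart_step N)\<^sup>*" if yz: "(y, z) \<in> dart_step N" for y z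
  proof -
    have y: "y \<in> darts N" and "z = rot N y \<or> z = opp N y" using yz by (auto simp: dart_step_def)
    then show ?thesis
    proof (elim disjE)
      assume "z = rot N y"
      then show ?thesis
        using permutes_rtrancl_back[OF assms(2,1) y, of "dart_step N"] by (auto simp: dart_step_def)
    next
      assume "z = opp N y"
      then have "(z, y) \<in> dart_step N" using assms(3) y by (simp add: dart_step_def)
      then show ?thesis by blast
    qed
  qed
  show ?thesis using de by induction (auto intro: back1 rtrancl_trans)
qed

lemma graph_iso_inv_apply:
  assumes "graph_iso f G G'" "v \<in> verts G'"
  shows "inv_into (verts G) f v \<in> verts G" "f (inv_into (verts G) f v) = v"
proof -
  have "v \<in> f ` verts G" using assms by (simp add: graph_iso_def bij_betw_def)
  then show "inv_into (verts G) f v \<in> verts G" "f (inv_into (verts G) f v) = v"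
    by (simp_all add: inv_into_into f_inv_into_f)
qed

section \<open>The isomorphism relations as equivalences\<close>

lemma equiv_id_graph_rel: "equiv S (id_graph_rel S)"
proof (rule equivI)
  show "id_graph_rel S \<subseteq> S \<times> S" by (auto simp: id_graph_rel_def)
  show "refl_on S (id_graph_rel S)"
    by (rule refl_onI) (use graph_iso_ident in \<open>auto simp: id_graph_rel_def intro!: exI[of _ "\<lambda>v. v"]\<close>)
  show "sym (id_graph_rel S)"
  proof (rule symI)
    fix g g' assume "(g, g') \<in> id_graph_rel S"
    then obtain G \<theta> G' \<theta>' f where g: "g = (G, \<theta>)" "g' = (G', \<theta>')" "g \<in> S" "g' \<in> S"
      and f: "graph_iso f G G'" "\<forall>v\<in>verts G. \<theta>' (f v) = \<theta> v" by (auto simp: id_graph_rel_def)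
    have "\<forall>v\<in>verts G'. \<theta> (inv_into (verts G) f v) = \<theta>' v"
      using f graph_iso_inv_apply[OF f(1)] by metis
    then show "(g', g) \<in> id_graph_rel S" using g graph_iso_inv[OF f(1)] by (auto simp: id_graph_rel_def)
  qed
  show "trans (id_graph_rel S)"
  proof (rule transI)
    fix g g' g'' assume "(g, g') \<in> id_graph_rel S" "(g', g'') \<in> id_graph_rel S"
    then obtain G \<theta> G' \<theta>' G'' \<theta>'' f f' where g: "g = (G, \<theta>)" "g' = (G', \<theta>')" "g'' = (G'', \<theta>'')" "g \<in> S" "g'' \<in> S"
      and f: "graph_iso f G G'" "\<forall>v\<in>verts G. \<theta>' (f v) = \<theta> v" "graph_iso f' G' G''" "\<forall>v\<in>verts G'. \<theta>'' (f' v) = \<theta>' v"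
      by (auto simp: id_graph_rel_def)
    have "f v \<in> verts G'" if "v \<in> verts G" for v using f(1) that by (auto simp: graph_iso_def bij_betw_def)
    then have "\<forall>v\<in>verts G. \<theta>'' ((f' \<circ> f) v) = \<theta> v" using f by simp
    then show "(g, g'') \<in> id_graph_rel S" using g graph_iso_comp[OF f(1,3)] unfolding id_graph_rel_def by blast
  qed
qed

lemma equiv_graph_iso_rel: "equiv S (graph_iso_rel S)"
proof (rule equivI)
  show "graph_iso_rel S \<subseteq> S \<times> S" by (auto simp: graph_iso_rel_def)
  have "graph_iso (\<lambda>v. v) G G" for G :: "'a cgraph" by (simp add: graph_iso_def bij_betw_def)
  then show "refl_on S (graph_iso_rel S)" by (intro refl_onI) (auto simp: graph_iso_rel_def)
  show "sym (graph_iso_rel S)" using graph_iso_inv by (fastforce simp: sym_def graph_iso_rel_def)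
  show "trans (graph_iso_rel S)" using graph_iso_comp by (fastforce simp: trans_def graph_iso_rel_def)
qed

lemma walsh_maps_closed:
  assumes "W \<in> walsh_maps M p"
  shows "d \<in> darts W \<Longrightarrow> rot W d \<in> darts W \<and> opp W d \<in> darts W" "blk W \<subseteq> darts W" "cil W \<subseteq> blk W"
  using assms by (auto simp: walsh_maps_def comb_map_def permutes_in_image)

lemma walsh_iso_ident: "walsh_iso (\<lambda>d. d) W W"
  by (simp add: walsh_iso_def map_iso_def bij_betw_def)

lemma walsh_iso_sym:
  assumes "W \<in> walsh_maps M p" "walsh_iso f W W'"
  shows "walsh_iso (inv_into (darts W) f) W' W"
  using walsh_iso_inv[OF assms(2)] walsh_maps_closed[OF assms(1)] by blast

text \<open>Stated for stuffed Walsh maps because the inverse of an isomorphism is one when rotation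
  and involution preserve the darts.\<close>

lemma equiv_walsh_iso_rel: "equiv (walsh_maps M p) (walsh_iso_rel (walsh_maps M p))" (is "equiv ?S ?r")
proof (rule equivI)
  show "?r \<subseteq> ?S \<times> ?S" by (auto simp: walsh_iso_rel_def)
  show "refl_on ?S ?r" using walsh_iso_ident by (intro refl_onI) (auto simp: walsh_iso_rel_def)
  show "sym ?r" using walsh_iso_sym by (fastforce simp: sym_def walsh_iso_rel_def)
  show "trans ?r" using walsh_iso_comp by (fastforce simp: trans_def walsh_iso_rel_def)
qed

lemma walsh_iso_inv_apply:
  assumes "walsh_iso f W W'" "d \<in> darts W'"
  shows "inv_into (darts W) f d \<in> darts W" "f (inv_into (darts W) f d) = d"
proof -
  have "d \<in> f ` darts W" using assms by (simp add: walsh_iso_def map_iso_def bij_betw_def)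
  then show "inv_into (darts W) f d \<in> darts W" "f (inv_into (darts W) f d) = d"
    by (simp_all add: inv_into_into f_inv_into_f)
qed

lemma equiv_id_walsh_rel: "equiv (id_walsh_maps M p) (id_walsh_rel (id_walsh_maps M p))" (is "equiv ?S ?r")
proof (rule equivI)
  show "?r \<subseteq> ?S \<times> ?S" by (auto simp: id_walsh_rel_def)
  show "refl_on ?S ?r"
    using walsh_iso_ident by (intro refl_onI) (auto simp: id_walsh_rel_def intro!: exI[of _ "\<lambda>d. d"])
  show "sym ?r"
  proof (rule symI)
    fix w w' assume "(w, w') \<in> ?r"
    then obtain W \<mu> W' \<mu>' f where w: "w = (W, \<mu>)" "w' = (W', \<mu>')" "w \<in> ?S" "w' \<in> ?S"
      and f: "walsh_iso f W W'" "\<forall>d\<in>darts W - blk W. \<mu>' (f d) = \<mu> d" by (auto simp: id_walsh_rel_def)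
    have W: "W \<in> walsh_maps M p" "W' \<in> walsh_maps M p" using w by (auto simp: id_walsh_maps_def)
    note i = walsh_iso_sym[OF W(1) f(1)]
    have "\<mu> (inv_into (darts W) f d) = \<mu>' d" if d: "d \<in> darts W' - blk W'" for d
      using f(2) walsh_iso_inv_apply[OF f(1)] walsh_iso_blue[OF i walsh_maps_closed(2)[OF W(2)] d] d by (metis DiffD1)
    then show "(w', w) \<in> ?r" using w i unfolding id_walsh_rel_def by blast
  qed
  show "trans ?r"
  proof (rule transI)
    fix w w' w'' assume "(w, w') \<in> ?r" "(w', w'') \<in> ?r"
    then obtain W \<mu> W' \<mu>' W'' \<mu>'' f f' where w: "w = (W, \<mu>)" "w' = (W', \<mu>')" "w'' = (W'', \<mu>'')" "w \<in> ?S" "w'' \<in> ?S"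
      and f: "walsh_iso f W W'" "\<forall>d\<in>darts W - blk W. \<mu>' (f d) = \<mu> d"
        "walsh_iso f' W' W''" "\<forall>d\<in>darts W' - blk W'. \<mu>'' (f' d) = \<mu>' d"
      by (auto simp: id_walsh_rel_def)
    have "W \<in> walsh_maps M p" using w by (auto simp: id_walsh_maps_def)
    then have "f d \<in> darts W' - blk W'" if "d \<in> darts W - blk W" for d
      using walsh_iso_blue[OF f(1) walsh_maps_closed(2) that] by blast
    then have "\<forall>d\<in>darts W - blk W. \<mu>'' ((f' \<circ> f) d) = \<mu> d" using f(2,4) by simp
    then show "(w, w'') \<in> ?r" using w walsh_iso_comp[OF f(1,3)] unfolding id_walsh_rel_def by blast
  qed
qed

section \<open>The map of a bubble\<close>

locale paired_bubble =
  fixes D :: nat and B :: "'v cgraph" and \<Omega> :: "'v set set"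
    and os "is" :: "'v set \<Rightarrow> nat list" and M :: "'v set hedge cmap"
  assumes bubble: "bubble D B" and pairing: "pairing B \<Omega>" and orders: "edge_orders B \<Omega> os is"
    and M_eq: "M = bubble_map B \<Omega> os is"
begin

text \<open>A vertex of \<open>B\<close> amounts to its color class and its pair: \<open>pr\<close>
  is inverse to \<open>wh\<close> on white and to \<open>bl\<close> on black vertices. This lets
  \<open>B\<close> be described by permutations of \<Omega>.\<close>

definition wh :: "'v set \<Rightarrow> 'v" where "wh x = (THE w. w \<in> x \<and> w \<in> white B)"
definition bl :: "'v set \<Rightarrow> 'v" where "bl x = (THE b. b \<in> x \<and> b \<in> black B)"
definition pr :: "'v \<Rightarrow> 'v set" where "pr v = (THE x. x \<in> \<Omega> \<and> v \<in> x)"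

lemma B_bip: "finite (verts B)" "white B \<inter> black B = {}" "cedges B \<subseteq> {1..D} \<times> white B \<times> black B"
  using bubble by (auto simp: bubble_def bip_graph_def)

lemma pair_eq:
  assumes "x \<in> \<Omega>"
  shows "wh x \<in> white B" "bl x \<in> black B" "x = {wh x, bl x}"
proof -
  obtain w b where wb: "w \<in> white B" "b \<in> black B" "x = {w, b}"
    using pairing assms by (auto simp: pairing_def)
  then have "wh x = w" "bl x = b" using B_bip(2) by (auto simp: wh_def bl_def)
  with wb show "wh x \<in> white B" "bl x \<in> black B" "x = {wh x, bl x}" by simp_all
qed

lemma pair_mem: "x \<in> \<Omega> \<Longrightarrow> v \<in> x \<longleftrightarrow> v = wh x \<or> v = bl x"
  using pair_eq(3) by blast

lemma pr_eqI:
  assumes "x \<in> \<Omega>" "v \<in> x"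
  shows "pr v = x"
  unfolding pr_def
proof (rule the_equality)
  fix y assume "y \<in> \<Omega> \<and> v \<in> y"
  then show "y = x"
    using assms pairing partition_onD2[of "verts B" \<Omega>] by (auto simp: pairing_def disjoint_def)
qed (use assms in blast)

lemma pr_in:
  assumes "v \<in> verts B"
  shows "pr v \<in> \<Omega>" "v \<in> pr v"
proof -
  have "v \<in> \<Union>\<Omega>" using pairing assms partition_onD1[of "verts B" \<Omega>] by (simp add: pairing_def)
  then obtain x where "x \<in> \<Omega>" "v \<in> x" by blast
  with pr_eqI show "pr v \<in> \<Omega>" "v \<in> pr v" by auto
qed

lemma verts_cases: "v \<in> verts B \<longleftrightarrow> v \<in> white B \<or> v \<in> black B"
  by (auto simp: verts_def)

lemma pr_wh_bl [simp]: "x \<in> \<Omega> \<Longrightarrow> pr (wh x) = x" "x \<in> \<Omega> \<Longrightarrow> pr (bl x) = x"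
  using pair_mem pr_eqI by blast+

lemma wh_pr [simp]: "w \<in> white B \<Longrightarrow> wh (pr w) = w"
  using pr_in[of w] pair_mem[of "pr w" w] pair_eq(2)[of "pr w"] B_bip(2) by (auto simp: verts_cases)

lemma bl_pr [simp]: "b \<in> black B \<Longrightarrow> bl (pr b) = b"
  using pr_in[of b] pair_mem[of "pr b" b] pair_eq(1)[of "pr b"] B_bip(2) by (auto simp: verts_cases)

lemma finite_Omega: "finite \<Omega>"
  using pairing B_bip(1) by (auto simp: pairing_def intro: finite_elements)

lemma Omega_nonempty: "\<Omega> \<noteq> {}"
  using bubble pr_in by (auto simp: bubble_def graph_connected_def)

text \<open>A permutation of the pairs; its fixed points are the pairs whose edge of color \<open>i\<close> is
  discarded.\<close>

definition nb :: "nat \<Rightarrow> 'v set \<Rightarrow> 'v set" where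
  "nb i x = (if x \<in> \<Omega> \<and> i \<in> {1..D} then pr (THE b. (i, wh x, b) \<in> cedges B) else x)"

text \<open>These colors are at once those leaving \<open>x\<close>, those entering
  \<open>x\<close>, and the label of the black-blue edge at \<open>x\<close>.\<close>

definition cols :: "'v set \<Rightarrow> nat set" where
  "cols x = {i \<in> {1..D}. nb i x \<noteq> x}"

text \<open>Turns adjacency into an equation between pairs, the form in which edges of a graph are
  compared with its code.\<close>

lemma cedges_B_iff:
  "(i, w, b) \<in> cedges B \<longleftrightarrow> i \<in> {1..D} \<and> w \<in> white B \<and> b \<in> black B \<and> pr b = nb i (pr w)"
proof -
  have "(i, w, b) \<in> cedges B \<longleftrightarrow> pr b = nb i (pr w)" if "i \<in> {1..D}" "w \<in> white B" "b \<in> black B"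
  proof -
    have ex: "\<exists>!b. (i, w, b) \<in> cedges B" using bubble that by (simp add: bubble_def one_edge_per_color_def)
    then have the: "(i, w, THE b. (i, w, b) \<in> cedges B) \<in> cedges B" by (rule theI')
    have "nb i (pr w) = pr (THE b. (i, w, b) \<in> cedges B)"
      using that pr_in[of w] by (simp add: nb_def verts_cases)
    moreover have "(THE b. (i, w, b) \<in> cedges B) \<in> black B" using the B_bip by auto
    ultimately show ?thesis using the ex that by (metis bl_pr)
  qed
  then show ?thesis using B_bip by auto
qed

lemma nb_in: assumes "x \<in> \<Omega>" shows "nb i x \<in> \<Omega>"
proof (cases "i \<in> {1..D}")
  case True
  have "\<exists>!b. (i, wh x, b) \<in> cedges B"
    using bubble True pair_eq(1)[OF assms] by (simp add: bubble_def one_edge_per_color_def)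
  then obtain b where "(i, wh x, b) \<in> cedges B" by blast
  then have "b \<in> black B" "pr b = nb i x" using assms by (auto simp: cedges_B_iff)
  then show ?thesis using pr_in[of b] by (simp add: verts_cases)
qed (use assms in \<open>auto simp: nb_def\<close>)

lemma nb_inj:
  assumes "x \<in> \<Omega>" "y \<in> \<Omega>" "nb i x = nb i y"
  shows "x = y"
proof (cases "i \<in> {1..D}")
  case True
  let ?b = "bl (nb i x)"
  have b: "?b \<in> black B" using nb_in pair_eq(2) assms(1) by blast
  have "(i, wh x, ?b) \<in> cedges B" "(i, wh y, ?b) \<in> cedges B"
    using assms True nb_in pair_eq(1,2) by (auto simp: cedges_B_iff)
  moreover have "\<exists>!w. (i, w, ?b) \<in> cedges B"
    using bubble True b by (simp add: bubble_def one_edge_per_color_def)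
  ultimately have "wh x = wh y" by blast
  then show ?thesis using assms by (metis pr_wh_bl(1))
qed (use assms in \<open>auto simp: nb_def\<close>)

lemma nb_permutes: "nb i permutes \<Omega>"
proof (rule bij_imp_permutes)
  have "inj_on (nb i) \<Omega>" using nb_inj by (auto simp: inj_on_def)
  moreover have "nb i ` \<Omega> \<subseteq> \<Omega>" using nb_in by auto
  ultimately show "bij_betw (nb i) \<Omega> \<Omega>" using finite_Omega by (simp add: bij_betw_def endo_inj_surj)
qed (simp add: nb_def)

lemma nb_surj: assumes "x \<in> \<Omega>" shows "\<exists>y\<in>\<Omega>. nb i y = x"
  using nb_permutes[of i] assms by (metis permutes_def permutes_in_image)

lemma pair_arcs_iff: "(i, x, y) \<in> pair_arcs B \<Omega> \<longleftrightarrow> x \<in> \<Omega> \<and> i \<in> cols x \<and> y = nb i x"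
proof
  assume "(i, x, y) \<in> pair_arcs B \<Omega>"
  then obtain w b where "x \<in> \<Omega>" "y \<in> \<Omega>" "x \<noteq> y" "w \<in> x" "b \<in> y" "(i, w, b) \<in> cedges B"
    by (auto simp: pair_arcs_def)
  then show "x \<in> \<Omega> \<and> i \<in> cols x \<and> y = nb i x" using pr_eqI by (auto simp: cedges_B_iff cols_def)
next
  assume *: "x \<in> \<Omega> \<and> i \<in> cols x \<and> y = nb i x"
  then have y: "y \<in> \<Omega>" "x \<noteq> y" using nb_in by (auto simp: cols_def)
  moreover have "(i, wh x, bl y) \<in> cedges B"
    using * y pair_eq(1,2) by (auto simp: cedges_B_iff cols_def)
  moreover have "wh x \<in> x \<inter> white B" "bl y \<in> y \<inter> black B" using * y pair_eq(1,2) pair_mem by auto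
  ultimately show "(i, x, y) \<in> pair_arcs B \<Omega>" using * unfolding pair_arcs_def by blast
qed

text \<open>A permutation moves a point exactly when it moves the preimage of that point.
  Consequently every vertex of \<open>M\<close> has the same colors, and equally many edges, in its
  outgoing and in its incoming group.\<close>

lemma cols_in_iff: assumes "x \<in> \<Omega>" shows "i \<in> cols x \<longleftrightarrow> (\<exists>y\<in>\<Omega>. i \<in> cols y \<and> nb i y = x)"
proof
  assume "i \<in> cols x"
  moreover obtain y where "y \<in> \<Omega>" "nb i y = x" using nb_surj assms by blast
  ultimately have "i \<in> cols y" by (cases "nb i y = y") (auto simp: cols_def)
  with \<open>y \<in> \<Omega>\<close> \<open>nb i y = x\<close> show "\<exists>y\<in>\<Omega>. i \<in> cols y \<and> nb i y = x" by blast
next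
  assume "\<exists>y\<in>\<Omega>. i \<in> cols y \<and> nb i y = x"
  then obtain y where "y \<in> \<Omega>" "i \<in> {1..D}" "nb i y \<noteq> y" "nb i y = x" by (auto simp: cols_def)
  then show "i \<in> cols x" using nb_inj[of x y i] assms by (auto simp: cols_def)
qed

lemma cols_nb: "x \<in> \<Omega> \<Longrightarrow> i \<in> cols x \<Longrightarrow> i \<in> cols (nb i x)"
  using cols_in_iff nb_in by blast

lemma orders_cols:
  assumes "x \<in> \<Omega>"
  shows "distinct (os x)" "set (os x) = cols x" "distinct (is x)" "set (is x) = cols x"
proof -
  have "{i. \<exists>y. (i, x, y) \<in> pair_arcs B \<Omega>} = cols x" using assms by (auto simp: pair_arcs_iff)
  moreover have "{i. \<exists>y. (i, y, x) \<in> pair_arcs B \<Omega>} = cols x"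
    using cols_in_iff[OF assms] by (auto simp: pair_arcs_iff)
  ultimately show "distinct (os x)" "set (os x) = cols x" "distinct (is x)" "set (is x) = cols x"
    using orders assms by (auto simp: edge_orders_def)
qed

lemma set_around:
  "x \<in> \<Omega> \<Longrightarrow> set (around os is x) = insert (Cil x) ((\<lambda>i. Out i x) ` cols x \<union> (\<lambda>i. Inc i x) ` cols x)"
  using orders_cols[of x] by (auto simp: around_def)

lemma distinct_around: "x \<in> \<Omega> \<Longrightarrow> distinct (around os is x)"
  using orders_cols[of x] by (auto simp: around_def distinct_map inj_on_def)

section \<open>Darts, rotation and connectedness of the bubble map\<close>

lemma base_around: "d \<in> set (around os is x) \<Longrightarrow> base d = x"
  by (auto simp: around_def)

lemma darts_M: "darts M = (\<Union>x\<in>\<Omega>. set (around os is x))"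
  by (simp add: M_eq bubble_map_def Let_def)

lemma darts_M_iff [simp]:
  "Cil x \<in> darts M \<longleftrightarrow> x \<in> \<Omega>" "Out i x \<in> darts M \<longleftrightarrow> x \<in> \<Omega> \<and> i \<in> cols x"
  "Inc i x \<in> darts M \<longleftrightarrow> x \<in> \<Omega> \<and> i \<in> cols x"
  by (auto simp: darts_M set_around)

text \<open>Incoming halves are written through the source of their edge, so that the involution can
  be evaluated in each case without a definite description.\<close>

lemma darts_M_cases:
  assumes "d \<in> darts M"
  obtains x where "d = Cil x" "x \<in> \<Omega>" | i x where "d = Out i x" "x \<in> \<Omega>" "i \<in> cols x"
    | i x where "d = Inc i (nb i x)" "x \<in> \<Omega>" "i \<in> cols x"
proof (cases d)
  case (Inc i y)
  with assms have "y \<in> \<Omega>" "i \<in> cols y" by auto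
  then obtain x where "x \<in> \<Omega>" "i \<in> cols x" "nb i x = y" using cols_in_iff by blast
  with Inc that show ?thesis by blast
qed (use assms that in auto)

lemma base_darts: "d \<in> darts M \<Longrightarrow> base d \<in> \<Omega> \<and> d \<in> set (around os is (base d))"
  using base_around by (auto simp: darts_M)

lemma lab_M [simp]: "lab M = hedge_label"
  by (simp add: M_eq bubble_map_def Let_def)

lemma opp_M [simp]:
  "x \<in> \<Omega> \<Longrightarrow> opp M (Cil x) = Cil x"
  "x \<in> \<Omega> \<Longrightarrow> i \<in> cols x \<Longrightarrow> opp M (Out i x) = Inc i (nb i x)"
  "x \<in> \<Omega> \<Longrightarrow> i \<in> cols x \<Longrightarrow> opp M (Inc i (nb i x)) = Out i x"
proof -
  have o: "opp M d = other_half (pair_arcs B \<Omega>) d" if "d \<in> darts M" for d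
    using that by (simp add: M_eq bubble_map_def Let_def perm_restrict_def)
  show "opp M (Cil x) = Cil x" if "x \<in> \<Omega>" using that by (simp add: o)
  show "opp M (Out i x) = Inc i (nb i x)" if "x \<in> \<Omega>" "i \<in> cols x"
    using that by (simp add: o pair_arcs_iff)
  show "opp M (Inc i (nb i x)) = Out i x" if x: "x \<in> \<Omega>" "i \<in> cols x"
  proof -
    have "i \<in> cols (nb i x)" using x cols_nb by blast
    then have "Inc i (nb i x) \<in> darts M" using x nb_in by simp
    moreover have "(THE y. (i, y, nb i x) \<in> pair_arcs B \<Omega>) = x"
      using x nb_inj by (intro the_equality) (auto simp: pair_arcs_iff)
    ultimately show ?thesis by (simp add: o)
  qed
qed

lemma opp_M_in: assumes "d \<in> darts M" shows "opp M d \<in> darts M"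
  using assms
proof (cases rule: darts_M_cases)
  case (2 i x)
  then show ?thesis using nb_in cols_nb by auto
qed auto

text \<open>Isomorphisms do not see the constructors of half-edges; this is how they nevertheless
  recognize cilia.\<close>

lemma opp_M_fix: assumes "d \<in> darts M" shows "opp M d = d \<longleftrightarrow> (\<exists>x. d = Cil x)"
  using assms by (cases rule: darts_M_cases) auto

lemma lab_opp_M: assumes "d \<in> darts M" shows "hedge_label (opp M d) = hedge_label d"
  using assms by (cases rule: darts_M_cases) auto

lemma opp_opp_M: assumes "d \<in> darts M" shows "opp M (opp M d) = d"
  using assms by (cases rule: darts_M_cases) auto

lemma rot_M_eq: "d \<in> darts M \<Longrightarrow> rot M d = cycle_of_list (around os is (base d)) d"
  by (simp add: M_eq bubble_map_def Let_def perm_restrict_def)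

lemma rot_M_in:
  assumes "x \<in> \<Omega>" "d \<in> set (around os is x)"
  shows "rot M d \<in> set (around os is x)"
proof -
  have "d \<in> darts M" using assms darts_M by auto
  then have "rot M d = cycle_of_list (around os is x) d" using rot_M_eq base_around assms by metis
  then show ?thesis using cycle_permutes[of "around os is x"] assms(2) by (simp add: permutes_in_image)
qed

lemma rot_M_darts: "d \<in> darts M \<Longrightarrow> rot M d \<in> darts M \<and> base (rot M d) = base d"
  using rot_M_in base_darts base_around by (metis UN_iff darts_M)

text \<open>Later arguments follow the rotation by index in \<open>around\<close>, where 0 is the
  cilium and the remainder closes the turn.\<close>

lemma rot_M_nth:
  assumes "x \<in> \<Omega>" "j < length (around os is x)"
  shows "rot M (around os is x ! j) = around os is x ! (Suc j mod length (around os is x))"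
proof -
  let ?xs = "around os is x"
  have "map (cycle_of_list ?xs) ?xs = rotate 1 ?xs"
    using cyclic_rotation[OF distinct_around[OF assms(1)], of 1] by simp
  then have "cycle_of_list ?xs (?xs ! j) = rotate 1 ?xs ! j" using assms(2) by (metis nth_map)
  also have "\<dots> = ?xs ! (Suc j mod length ?xs)" using assms(2) by (simp add: nth_rotate1)
  finally show ?thesis using assms rot_M_eq base_around by (metis UN_iff darts_M nth_mem)
qed

lemma finite_darts_M: "finite (darts M)"
  using finite_Omega by (simp add: darts_M)

lemma around_0: "around os is x ! 0 = Cil x" "0 < length (around os is x)"
  by (simp_all add: around_def)

lemma length_around: assumes "x \<in> \<Omega>" shows "length (around os is x) = Suc (2 * card (cols x))"
  and "length (os x) = card (cols x)" "length (is x) = card (cols x)"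
  using orders_cols[OF assms] distinct_card[of "os x"] distinct_card[of "is x"] by (simp_all add: around_def)

lemma rot_M_orbit: assumes "x \<in> \<Omega>" shows "orbit (rot M) (Cil x) = set (around os is x)"
proof -
  let ?xs = "around os is x"
  have "orbit (rot M) (?xs ! 0) = (!) ?xs ` {..<length ?xs}"
    using rot_M_nth[OF assms] around_0(2) by (intro orbit_cyclic_sequence) auto
  also have "\<dots> = set ?xs" by (auto simp: in_set_conv_nth)
  finally show ?thesis by (simp add: around_0)
qed

lemma rot_M_permutes: "rot M permutes darts M"
proof (rule bij_imp_permutes)
  have "darts M \<subseteq> rot M ` darts M"
  proof
    fix d assume d: "d \<in> darts M"
    let ?x = "base d"
    let ?n = "length (around os is ?x)"
    have x: "?x \<in> \<Omega>" "d \<in> set (around os is ?x)" using base_darts d by auto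
    then obtain j where j: "j < ?n" "d = around os is ?x ! j" by (auto simp: in_set_conv_nth)
    \<comment> \<open>The index before \<open>j\<close>, which for the cilium at index 0 is the last
      one.\<close>
    obtain l where l: "l < ?n" "Suc l mod ?n = j"
    proof (cases j)
      case 0
      then have "Suc (?n - 1) mod ?n = j" using j by simp
      then show ?thesis using that[of "?n - 1"] j by auto
    next
      case (Suc l)
      then show ?thesis using that[of l] j by simp
    qed
    then have "rot M (around os is ?x ! l) = d" using rot_M_nth x j by simp
    moreover have "around os is ?x ! l \<in> darts M" using x(1) nth_mem[OF l(1)] by (auto simp: darts_M)
    ultimately show "d \<in> rot M ` darts M" by (metis image_eqI)
  qed
  moreover have "rot M ` darts M \<subseteq> darts M" using rot_M_darts by auto
  ultimately have "rot M ` darts M = darts M" by blast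
  then show "bij_betw (rot M) (darts M) (darts M)"
    using finite_darts_M by (simp add: bij_betw_def eq_card_imp_inj_on)
qed (simp add: M_eq bubble_map_def Let_def perm_restrict_def)

lemma Union_labels: "x \<in> \<Omega> \<Longrightarrow> (\<Union>d\<in>set (around os is x). hedge_label d) = cols x"
  by (auto simp: set_around)

lemma dart_step_M_rot: "(d, e) \<in> (dart_step M)\<^sup>*" if "x \<in> \<Omega>" "d \<in> set (around os is x)" "e \<in> set (around os is x)" for x d e
proof -
  have one: "(Cil x, e) \<in> (dart_step M)\<^sup>*" if e: "e \<in> set (around os is x)" for e
  proof -
    have "e \<in> orbit (rot M) (Cil x)" using e rot_M_orbit \<open>x \<in> \<Omega>\<close> by simp
    then show ?thesis
    proof induction
      case base
      then show ?case using \<open>x \<in> \<Omega>\<close> by (auto simp: dart_step_def)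
    next
      case (step y)
      then have "y \<in> darts M" using rot_M_orbit[OF \<open>x \<in> \<Omega>\<close>] darts_M \<open>x \<in> \<Omega>\<close> by auto
      then have "(y, rot M y) \<in> dart_step M" by (simp add: dart_step_def)
      with step show ?case by simp
    qed
  qed
  have dM: "d \<in> darts M" using that darts_M by auto
  have rot_back: "(rot M y, y) \<in> (dart_step M)\<^sup>*" if "y \<in> darts M" for y
    using permutes_rtrancl_back[OF rot_M_permutes finite_darts_M that] by (auto simp: dart_step_def)
  have "(e, Cil x) \<in> (dart_step M)\<^sup>*" if "e \<in> orbit (rot M) (Cil x)" for e
    using that
  proof induction
    case base
    then show ?case using rot_back \<open>x \<in> \<Omega>\<close> by simp
  next
    case (step y)
    then have "y \<in> darts M" using rot_M_orbit[OF \<open>x \<in> \<Omega>\<close>] darts_M \<open>x \<in> \<Omega>\<close> by auto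
    with step rot_back show ?case by (meson rtrancl_trans)
  qed
  then have "(d, Cil x) \<in> (dart_step M)\<^sup>*" using that rot_M_orbit by simp
  with one[OF that(3)] show ?thesis by simp
qed

text \<open>A path of \<open>B\<close> projects to \<Omega>. Each of its edges either becomes an
  edge of \<open>M\<close> or joins the two vertices of one pair, in which case the projection stays
  put.\<close>

lemma M_connected: "d \<in> darts M \<Longrightarrow> e \<in> darts M \<Longrightarrow> (d, e) \<in> (dart_step M)\<^sup>*"
proof -
  have arc: "(Cil x, Cil (nb i x)) \<in> (dart_step M)\<^sup>*" "(Cil (nb i x), Cil x) \<in> (dart_step M)\<^sup>*" if x: "x \<in> \<Omega>" for x i
  proof -
    have "(Cil x, Cil (nb i x)) \<in> (dart_step M)\<^sup>* \<and> (Cil (nb i x), Cil x) \<in> (dart_step M)\<^sup>*"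
    proof (cases "i \<in> cols x")
      case True
      then have y: "nb i x \<in> \<Omega>" "i \<in> cols (nb i x)" using x nb_in cols_nb by auto
      have st: "(Out i x, Inc i (nb i x)) \<in> dart_step M" "(Inc i (nb i x), Out i x) \<in> dart_step M"
        using x y True by (auto simp: dart_step_def)
      have "(Cil x, Out i x) \<in> (dart_step M)\<^sup>*" "(Out i x, Cil x) \<in> (dart_step M)\<^sup>*"
        using x True by (auto intro!: dart_step_M_rot[of x] simp: set_around)
      moreover have "(Cil (nb i x), Inc i (nb i x)) \<in> (dart_step M)\<^sup>*" "(Inc i (nb i x), Cil (nb i x)) \<in> (dart_step M)\<^sup>*"
        using y by (auto intro!: dart_step_M_rot[of "nb i x"] simp: set_around)
      ultimately show ?thesis using st by (meson rtrancl_trans r_into_rtrancl)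
    next
      case False
      then have "nb i x = x" using x by (auto simp: cols_def nb_def)
      then show ?thesis by simp
    qed
    then show "(Cil x, Cil (nb i x)) \<in> (dart_step M)\<^sup>*" "(Cil (nb i x), Cil x) \<in> (dart_step M)\<^sup>*" by auto
  qed
  have path: "(Cil (pr u), Cil (pr v)) \<in> (dart_step M)\<^sup>*" if "(u, v) \<in> (adj B)\<^sup>*" for u v
    using that
  proof induction
    case (step y z)
    then obtain i where "(i, y, z) \<in> cedges B \<or> (i, z, y) \<in> cedges B" by (auto simp: adj_def)
    then have "(Cil (pr y), Cil (pr z)) \<in> (dart_step M)\<^sup>*"
      using arc pr_in by (auto simp: cedges_B_iff verts_cases)
    with step show ?case by (meson rtrancl_trans)
  qed simp
  assume d: "d \<in> darts M" and e: "e \<in> darts M"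
  let ?x = "base d" and ?y = "base e"
  have xy: "?x \<in> \<Omega>" "?y \<in> \<Omega>" "d \<in> set (around os is ?x)" "e \<in> set (around os is ?y)"
    using base_darts d e by auto
  have "(wh ?x, wh ?y) \<in> (adj B)\<^sup>*"
    using bubble pair_eq(1) xy by (simp add: bubble_def graph_connected_def verts_cases)
  then have "(Cil ?x, Cil ?y) \<in> (dart_step M)\<^sup>*" using path xy by force
  moreover have "(d, Cil ?x) \<in> (dart_step M)\<^sup>*" "(Cil ?y, e) \<in> (dart_step M)\<^sup>*"
    using dart_step_M_rot[OF xy(1,3), of "Cil ?x"] dart_step_M_rot[OF xy(2) _ xy(4), of "Cil ?y"] xy(1,2)
    by (simp_all add: set_around)
  ultimately show "(d, e) \<in> (dart_step M)\<^sup>*" by (meson rtrancl_trans)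
qed

lemma B_connected: "u \<in> verts B \<Longrightarrow> v \<in> verts B \<Longrightarrow> (u, v) \<in> (adj B)\<^sup>*"
  using bubble by (simp add: bubble_def graph_connected_def)

section \<open>Coordinates on graphs\<close>

text \<open>The two kinds of edges do not interfere, because the colors of \<open>B\<close> start at
  1.\<close>

definition std_graph :: "nat set \<Rightarrow> (nat \<times> 'v set) rel \<Rightarrow> (nat \<times> 'v) cgraph" where
  "std_graph K \<tau> = \<lparr>white = K \<times> white B, black = K \<times> black B,
     cedges = {(i, (k, w), (l, b)) | i k w l b. k \<in> K \<and> l = k \<and> (i, w, b) \<in> cedges B \<or>
       i = 0 \<and> w \<in> white B \<and> b \<in> black B \<and> ((l, pr b), (k, pr w)) \<in> \<tau>}\<rparr>"

definition code_adj :: "(nat \<times> 'v set) rel \<Rightarrow> nat rel" where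
  "code_adj \<tau> = {(k, l). \<exists>x y. ((k, x), (l, y)) \<in> \<tau> \<or> ((l, y), (k, x)) \<in> \<tau>}"

text \<open>What membership in either set says about the code; it is shared by graphs and maps, and
  so carries membership across.\<close>

definition valid_code :: "nat \<Rightarrow> nat set \<Rightarrow> (nat \<times> 'v set) rel \<Rightarrow> bool" where
  "valid_code p K \<tau> \<longleftrightarrow> K \<noteq> {} \<and> (\<forall>k\<in>K. \<forall>l\<in>K. (k, l) \<in> (code_adj \<tau>)\<^sup>*) \<and> card (K \<times> \<Omega> - Domain \<tau>) = p"

text \<open>An isomorphism compares edges only between white and black vertices of \<open>G\<close>;
  \<open>bip_graph\<close> excludes stray edges and colors beyond D.\<close>

definition coded_graph ::
    "'a cgraph \<Rightarrow> ('a \<Rightarrow> 'v) \<Rightarrow> nat set \<Rightarrow> (nat \<times> 'v set) rel \<Rightarrow> ('a \<Rightarrow> nat \<times> 'v) \<Rightarrow> bool" where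
  "coded_graph G \<theta> K \<tau> c \<longleftrightarrow> partial_inj (K \<times> \<Omega>) \<tau> \<and> bip_graph {0..D} G \<and>
     graph_iso c G (std_graph K \<tau>) \<and> (\<forall>v\<in>verts G. snd (c v) = \<theta> v)"

text \<open>Copy number and pair of a vertex. Each position is held by exactly one white and one
  black vertex, and \<tau> relates positions.\<close>

definition gpos :: "('a \<Rightarrow> nat \<times> 'v) \<Rightarrow> 'a \<Rightarrow> nat \<times> 'v set" where
  "gpos c v = (fst (c v), pr (snd (c v)))"

definition gcopy :: "'a cgraph \<Rightarrow> ('a \<Rightarrow> nat \<times> 'v) \<Rightarrow> nat \<Rightarrow> 'a cgraph" where
  "gcopy G c k = induced (delete_color0 G) {v \<in> verts G. fst (c v) = k}"

lemma verts_std_graph: "verts (std_graph K \<tau>) = K \<times> verts B"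
  by (auto simp: verts_def std_graph_def)

lemma white_std_graph [simp]: "white (std_graph K \<tau>) = K \<times> white B"
  and black_std_graph [simp]: "black (std_graph K \<tau>) = K \<times> black B"
  by (simp_all add: std_graph_def)

lemma cedges_std_graph_0: "(0, (k, w), (l, b)) \<in> cedges (std_graph K \<tau>) \<longleftrightarrow>
    w \<in> white B \<and> b \<in> black B \<and> ((l, pr b), (k, pr w)) \<in> \<tau>"
  by (auto simp: std_graph_def cedges_B_iff)

lemma cedges_std_graph_pos: "i \<noteq> 0 \<Longrightarrow> (i, (k, w), (l, b)) \<in> cedges (std_graph K \<tau>) \<longleftrightarrow>
    k \<in> K \<and> l = k \<and> (i, w, b) \<in> cedges B"
  by (auto simp: std_graph_def)

lemma code_finite: assumes "partial_inj (K \<times> \<Omega>) \<tau>" shows "finite K"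
proof -
  have "finite (K \<times> \<Omega>)" using assms by (simp add: partial_inj_def)
  then show ?thesis using Omega_nonempty by (rule finite_cartesian_productD1)
qed

lemma sym_code_adj: "sym (code_adj \<tau>)"
  by (auto simp: sym_def code_adj_def)

context
  fixes G :: "'a cgraph" and \<theta> K \<tau> c
  assumes cg: "coded_graph G \<theta> K \<tau> c"
begin

lemma cg_simps:
  shows cg_partial_inj: "partial_inj (K \<times> \<Omega>) \<tau>" and cg_tau: "\<tau> \<subseteq> (K \<times> \<Omega>) \<times> (K \<times> \<Omega>)"
    and cg_bip: "finite (verts G)" "white G \<inter> black G = {}" "cedges G \<subseteq> {0..D} \<times> white G \<times> black G"
    and cg_bij: "bij_betw c (verts G) (K \<times> verts B)"
    and cg_white: "c ` white G = K \<times> white B" and cg_black: "c ` black G = K \<times> black B"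
    and cg_snd: "v \<in> verts G \<Longrightarrow> snd (c v) = \<theta> v"
  using cg by (auto simp: coded_graph_def graph_iso_def verts_std_graph bip_graph_def partial_inj_def)

lemma cg_c: "v \<in> verts G \<Longrightarrow> c v = (fst (c v), \<theta> v)"
  using cg_snd by (metis prod.collapse)

lemma cg_in:
  "v \<in> white G \<Longrightarrow> v \<in> verts G \<and> fst (c v) \<in> K \<and> \<theta> v \<in> white B"
  "v \<in> black G \<Longrightarrow> v \<in> verts G \<and> fst (c v) \<in> K \<and> \<theta> v \<in> black B"
  "v \<in> verts G \<Longrightarrow> fst (c v) \<in> K \<and> \<theta> v \<in> verts B"
proof -
  have *: "v \<in> verts G" if "v \<in> white G \<or> v \<in> black G" for v using that by (auto simp: verts_def)
  have "c v \<in> K \<times> white B" if "v \<in> white G" using that cg_white by blast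
  then show "v \<in> white G \<Longrightarrow> v \<in> verts G \<and> fst (c v) \<in> K \<and> \<theta> v \<in> white B"
    using * cg_snd by (auto simp: mem_Times_iff)
  have "c v \<in> K \<times> black B" if "v \<in> black G" using that cg_black by blast
  then show "v \<in> black G \<Longrightarrow> v \<in> verts G \<and> fst (c v) \<in> K \<and> \<theta> v \<in> black B"
    using * cg_snd by (auto simp: mem_Times_iff)
  have "c v \<in> K \<times> verts B" if "v \<in> verts G" using that cg_bij by (auto simp: bij_betw_def)
  then show "v \<in> verts G \<Longrightarrow> fst (c v) \<in> K \<and> \<theta> v \<in> verts B"
    using cg_snd by (auto simp: mem_Times_iff)
qed

lemma cg_gpos: "v \<in> verts G \<Longrightarrow> gpos c v = (fst (c v), pr (\<theta> v))"
  using cg_snd by (simp add: gpos_def)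

lemma cg_inj: "u \<in> verts G \<Longrightarrow> v \<in> verts G \<Longrightarrow> fst (c u) = fst (c v) \<Longrightarrow> \<theta> u = \<theta> v \<Longrightarrow> u = v"
  using cg_bij cg_c by (metis bij_betw_inv_into_left)

lemma cg_white_ex: "k \<in> K \<Longrightarrow> x \<in> \<Omega> \<Longrightarrow> \<exists>w\<in>white G. fst (c w) = k \<and> \<theta> w = wh x \<and> gpos c w = (k, x)"
proof -
  assume "k \<in> K" "x \<in> \<Omega>"
  then have "(k, wh x) \<in> c ` white G" using cg_white pair_eq(1) by blast
  then obtain w where "w \<in> white G" "c w = (k, wh x)" by force
  moreover have "gpos c w = (k, x)" using \<open>x \<in> \<Omega>\<close> calculation(2) by (simp add: gpos_def)
  moreover have "\<theta> w = wh x" using calculation cg_snd[of w] cg_in(1)[of w] by simp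
  ultimately show ?thesis by force
qed

lemma cg_black_ex: "k \<in> K \<Longrightarrow> x \<in> \<Omega> \<Longrightarrow> \<exists>b\<in>black G. fst (c b) = k \<and> \<theta> b = bl x \<and> gpos c b = (k, x)"
proof -
  assume "k \<in> K" "x \<in> \<Omega>"
  then have "(k, bl x) \<in> c ` black G" using cg_black pair_eq(2) by blast
  then obtain b where "b \<in> black G" "c b = (k, bl x)" by force
  moreover have "gpos c b = (k, x)" using \<open>x \<in> \<Omega>\<close> calculation(2) by (simp add: gpos_def)
  moreover have "\<theta> b = bl x" using calculation cg_snd[of b] cg_in(2)[of b] by simp
  ultimately show ?thesis by force
qed

lemma cg_gpos_white: "bij_betw (gpos c) (white G) (K \<times> \<Omega>)"
proof (rule bij_betwI')
  fix u v assume uv: "u \<in> white G" "v \<in> white G"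
  show "(gpos c u = gpos c v) = (u = v)"
    using cg_in(1)[OF uv(1)] cg_in(1)[OF uv(2)] cg_inj[of u v] by (metis cg_gpos prod.inject wh_pr)
next
  fix u assume "u \<in> white G"
  then show "gpos c u \<in> K \<times> \<Omega>" using cg_in(1) cg_gpos pr_in by (auto simp: verts_cases)
next
  fix a assume "a \<in> K \<times> \<Omega>"
  then show "\<exists>u\<in>white G. a = gpos c u" using cg_white_ex by force
qed

lemma cg_gpos_black: "bij_betw (gpos c) (black G) (K \<times> \<Omega>)"
proof (rule bij_betwI')
  fix u v assume uv: "u \<in> black G" "v \<in> black G"
  show "(gpos c u = gpos c v) = (u = v)"
    using cg_in(2)[OF uv(1)] cg_in(2)[OF uv(2)] cg_inj[of u v] by (metis cg_gpos prod.inject bl_pr)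
next
  fix u assume "u \<in> black G"
  then show "gpos c u \<in> K \<times> \<Omega>" using cg_in(2) cg_gpos pr_in by (auto simp: verts_cases)
next
  fix a assume "a \<in> K \<times> \<Omega>"
  then show "\<exists>u\<in>black G. a = gpos c u" using cg_black_ex by force
qed

lemma cg_gpos_in: "v \<in> white G \<Longrightarrow> gpos c v \<in> K \<times> \<Omega>" "v \<in> black G \<Longrightarrow> gpos c v \<in> K \<times> \<Omega>"
  using cg_gpos_white cg_gpos_black by (auto simp: bij_betw_def)

lemma cg_gpos_inj:
  "u \<in> white G \<Longrightarrow> v \<in> white G \<Longrightarrow> gpos c u = gpos c v \<Longrightarrow> u = v"
  "u \<in> black G \<Longrightarrow> v \<in> black G \<Longrightarrow> gpos c u = gpos c v \<Longrightarrow> u = v"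
  using cg_gpos_white cg_gpos_black by (auto simp: bij_betw_def dest: inj_onD)

lemma cg_gpos_surj:
  "a \<in> K \<times> \<Omega> \<Longrightarrow> \<exists>w\<in>white G. a = gpos c w" "a \<in> K \<times> \<Omega> \<Longrightarrow> \<exists>b\<in>black G. a = gpos c b"
  using cg_gpos_white cg_gpos_black by (auto simp: bij_betw_def)

lemma cg_cedges: "(i, w, b) \<in> cedges G \<longleftrightarrow> w \<in> white G \<and> b \<in> black G \<and>
    (i, c w, c b) \<in> cedges (std_graph K \<tau>)"
proof -
  have "w \<in> white G \<and> b \<in> black G" if "(i, w, b) \<in> cedges G" using that cg_bip(3) by auto
  then show ?thesis using cg by (auto simp: coded_graph_def graph_iso_def)
qed

lemma cg_edge0: "(0, w, b) \<in> cedges G \<longleftrightarrow> w \<in> white G \<and> b \<in> black G \<and> (gpos c b, gpos c w) \<in> \<tau>"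
  using cg_cedges[of 0 w b] cg_in(1)[of w] cg_in(2)[of b] cg_c[of w] cg_c[of b]
  by (metis cedges_std_graph_0 cg_gpos)

lemma cg_edge: "i \<noteq> 0 \<Longrightarrow> (i, w, b) \<in> cedges G \<longleftrightarrow> w \<in> white G \<and> b \<in> black G \<and>
    fst (c b) = fst (c w) \<and> (i, \<theta> w, \<theta> b) \<in> cedges B"
  using cg_cedges[of i w b] cg_in(1)[of w] cg_in(2)[of b] cg_c[of w] cg_c[of b]
  by (metis cedges_std_graph_pos)

lemma cg_edge_nb: "i \<noteq> 0 \<Longrightarrow> (i, w, b) \<in> cedges G \<longleftrightarrow> i \<in> {1..D} \<and> w \<in> white G \<and> b \<in> black G \<and>
    gpos c b = (fst (gpos c w), nb i (snd (gpos c w)))"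
  using cg_edge[of i w b] cg_in(1)[of w] cg_in(2)[of b] cg_gpos[of w] cg_gpos[of b]
  by (auto simp: cedges_B_iff)

section \<open>The bubbles of a coded graph are its copies\<close>

lemma cg_verts0: "verts (delete_color0 G) = verts G"
  by (simp add: verts_def delete_color0_def)

lemma cg_adj0: "(u, v) \<in> adj (delete_color0 G) \<longleftrightarrow> u \<in> verts G \<and> v \<in> verts G \<and>
    fst (c u) = fst (c v) \<and> (\<theta> u, \<theta> v) \<in> adj B"
proof
  assume "(u, v) \<in> adj (delete_color0 G)"
  then obtain i where "i \<noteq> 0" "(i, u, v) \<in> cedges G \<or> (i, v, u) \<in> cedges G"
    by (auto simp: adj_def delete_color0_def)
  then show "u \<in> verts G \<and> v \<in> verts G \<and> fst (c u) = fst (c v) \<and> (\<theta> u, \<theta> v) \<in> adj B"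
    using cg_edge by (auto simp: verts_def adj_def)
next
  assume *: "u \<in> verts G \<and> v \<in> verts G \<and> fst (c u) = fst (c v) \<and> (\<theta> u, \<theta> v) \<in> adj B"
  then obtain i where i: "(i, \<theta> u, \<theta> v) \<in> cedges B \<or> (i, \<theta> v, \<theta> u) \<in> cedges B" by (auto simp: adj_def)
  then have i0: "i \<noteq> 0" using B_bip by auto
  have col: "u' \<in> white G \<longleftrightarrow> \<theta> u' \<in> white B" "u' \<in> black G \<longleftrightarrow> \<theta> u' \<in> black B" if "u' \<in> verts G" for u'
    using cg_in[of u'] that B_bip(2) by (auto simp: verts_def)
  have "(i, u, v) \<in> cedges G \<or> (i, v, u) \<in> cedges G"
    using i * i0 col cg_edge[OF i0] by (auto simp: cedges_B_iff)
  then show "(u, v) \<in> adj (delete_color0 G)" using i0 by (auto simp: adj_def delete_color0_def)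
qed

text \<open>Edges of nonzero color stay within a copy. Conversely a path of the connected graph
  \<open>B\<close> lifts, vertex by vertex, to the copy of its starting point.\<close>

lemma cg_component:
  assumes "u \<in> verts G" "v \<in> verts G"
  shows "(u, v) \<in> (adj (delete_color0 G))\<^sup>* \<longleftrightarrow> fst (c u) = fst (c v)"
proof
  show "(u, v) \<in> (adj (delete_color0 G))\<^sup>* \<Longrightarrow> fst (c u) = fst (c v)"
    by (induction rule: rtrancl_induct) (auto simp: cg_adj0)
next
  assume eq: "fst (c u) = fst (c v)"
  have "\<exists>v\<in>verts G. fst (c v) = fst (c u) \<and> \<theta> v = y \<and> (u, v) \<in> (adj (delete_color0 G))\<^sup>*"
    if "(\<theta> u, y) \<in> (adj B)\<^sup>*" for y
    using that
  proof induction
    case base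
    then show ?case using assms(1) by auto
  next
    case (step y z)
    then obtain v where v: "v \<in> verts G" "fst (c v) = fst (c u)" "\<theta> v = y"
      "(u, v) \<in> (adj (delete_color0 G))\<^sup>*" by blast
    have "z \<in> verts B" using step(2) B_bip by (auto simp: adj_def verts_def)
    then have "(fst (c u), z) \<in> c ` verts G" using cg_bij cg_in(3) assms(1) by (auto simp: bij_betw_def)
    then obtain v' where v': "v' \<in> verts G" "c v' = (fst (c u), z)" by force
    then have "\<theta> v' = z" using cg_snd by force
    moreover have "(v, v') \<in> adj (delete_color0 G)" using v v' step(2) \<open>\<theta> v' = z\<close> by (auto simp: cg_adj0)
    ultimately show ?case using v v' by (auto intro!: bexI[of _ v'] intro: rtrancl_into_rtrancl)
  qed
  moreover have "(\<theta> u, \<theta> v) \<in> (adj B)\<^sup>*" using B_connected cg_in(3) assms by simp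
  ultimately obtain v' where "v' \<in> verts G" "fst (c v') = fst (c u)" "\<theta> v' = \<theta> v"
    "(u, v') \<in> (adj (delete_color0 G))\<^sup>*" by blast
  then show "(u, v) \<in> (adj (delete_color0 G))\<^sup>*" using cg_inj[of v' v] eq assms by simp
qed

lemma cg_gcopy_ex: assumes "k \<in> K" shows "\<exists>v\<in>verts G. fst (c v) = k"
proof -
  obtain x where "x \<in> \<Omega>" using Omega_nonempty by blast
  then show ?thesis using cg_white_ex[OF assms] cg_in(1) by blast
qed

lemma verts_gcopy: "verts (gcopy G c k) = {v \<in> verts G. fst (c v) = k}"
  by (auto simp: gcopy_def verts_induced cg_verts0)

lemma cg_bubbles: "bubbles_of G = gcopy G c ` K"
proof -
  have eq: "induced (delete_color0 G) {v \<in> verts (delete_color0 G). (u, v) \<in> (adj (delete_color0 G))\<^sup>*} =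
      gcopy G c (fst (c u))" if "u \<in> verts G" for u
    using cg_component[OF that] by (auto simp: gcopy_def cg_verts0 intro!: arg_cong[where f = "induced _"])
  show ?thesis
  proof
    show "bubbles_of G \<subseteq> gcopy G c ` K"
      using eq cg_in(3) by (auto simp: bubbles_of_def graph_components_def cg_verts0)
    show "gcopy G c ` K \<subseteq> bubbles_of G"
    proof
      fix H assume "H \<in> gcopy G c ` K"
      then obtain k where "k \<in> K" "H = gcopy G c k" by blast
      with eq cg_gcopy_ex show "H \<in> bubbles_of G"
        by (auto simp: bubbles_of_def graph_components_def cg_verts0) metis
    qed
  qed
qed

lemma gcopy_inj: "inj_on (gcopy G c) K"
proof (rule inj_onI)
  fix k l assume "k \<in> K" "l \<in> K" "gcopy G c k = gcopy G c l"
  then show "k = l" using verts_gcopy cg_gcopy_ex[of k] by (metis (mono_tags, lifting) mem_Collect_eq)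
qed

lemma cg_gcopy_iso: assumes "k \<in> K" shows "graph_iso \<theta> (gcopy G c k) B"
proof -
  have w: "white (gcopy G c k) = {v \<in> white G. fst (c v) = k}"
    and b: "black (gcopy G c k) = {v \<in> black G. fst (c v) = k}"
    and e: "(i, w, b) \<in> cedges (gcopy G c k) \<longleftrightarrow> i \<noteq> 0 \<and> (i, w, b) \<in> cedges G \<and> fst (c w) = k \<and> fst (c b) = k"
    for i w b
    using cg_bip(3) by (auto simp: gcopy_def induced_def delete_color0_def verts_def)
  have onto: "\<exists>v\<in>X. fst (c v) = k \<and> \<theta> v = y"
    if "c ` X = K \<times> Y" "X \<subseteq> verts G" "y \<in> Y" for X Y y
  proof -
    have "(k, y) \<in> c ` X" using that assms by simp
    then obtain v where "v \<in> X" "c v = (k, y)" by force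
    then show ?thesis using cg_snd[of v] that(2) by (intro bexI[of _ v]) auto
  qed
  have sub: "white G \<subseteq> verts G" "black G \<subseteq> verts G" by (auto simp: verts_def)
  have "bij_betw \<theta> (verts (gcopy G c k)) (verts B)"
  proof (rule bij_betwI')
    fix y assume "y \<in> verts B"
    then show "\<exists>x\<in>verts (gcopy G c k). y = \<theta> x"
      using onto[of "verts G" "verts B" y] cg_bij by (auto simp: verts_gcopy bij_betw_def)
  qed (use cg_inj cg_in(3) in \<open>auto simp: verts_gcopy\<close>)
  moreover have "\<theta> ` white (gcopy G c k) = white B"
  proof
    show "white B \<subseteq> \<theta> ` white (gcopy G c k)"
      using onto[OF cg_white sub(1)] by (auto simp: w)
  qed (use cg_in(1) in \<open>auto simp: w\<close>)
  moreover have "\<theta> ` black (gcopy G c k) = black B"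
  proof
    show "black B \<subseteq> \<theta> ` black (gcopy G c k)"
      using onto[OF cg_black sub(2)] by (auto simp: b)
  qed (use cg_in(2) in \<open>auto simp: b\<close>)
  moreover have "(i, w', b') \<in> cedges (gcopy G c k) \<longleftrightarrow> (i, \<theta> w', \<theta> b') \<in> cedges B"
    if "w' \<in> white (gcopy G c k)" "b' \<in> black (gcopy G c k)" for i w' b'
  proof (cases "i = 0")
    case True
    then show ?thesis by (auto simp: e cedges_B_iff)
  next
    case False
    then show ?thesis using that cg_edge[OF False] by (auto simp: e w b)
  qed
  ultimately show ?thesis by (simp add: graph_iso_def)
qed

section \<open>Connectedness, free vertices and membership for coded graphs\<close>

lemma cg_adj_rtrancl:
  assumes "u \<in> verts G" "v \<in> verts G"
  shows "(u, v) \<in> (adj G)\<^sup>* \<longleftrightarrow> (fst (c u), fst (c v)) \<in> (code_adj \<tau>)\<^sup>*"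
proof
  have step: "(fst (c y), fst (c z)) \<in> (code_adj \<tau>)\<^sup>*" if yz: "(y, z) \<in> adj G" for y z
  proof -
    obtain i where i: "(i, y, z) \<in> cedges G \<or> (i, z, y) \<in> cedges G" using yz by (auto simp: adj_def)
    show ?thesis
    proof (cases "i = 0")
      case True
      then have "(gpos c z, gpos c y) \<in> \<tau> \<or> (gpos c y, gpos c z) \<in> \<tau>"
        using i cg_edge0 by blast
      then have "(fst (c y), fst (c z)) \<in> code_adj \<tau>" by (auto simp: code_adj_def gpos_def)
      then show ?thesis by simp
    next
      case False
      then show ?thesis using i cg_edge[OF False] by auto
    qed
  qed
  show "(u, v) \<in> (adj G)\<^sup>* \<Longrightarrow> (fst (c u), fst (c v)) \<in> (code_adj \<tau>)\<^sup>*"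
    by (induction rule: rtrancl_induct) (use step in \<open>auto intro: rtrancl_trans\<close>)
next
  have sub: "(adj (delete_color0 G))\<^sup>* \<subseteq> (adj G)\<^sup>*"
    by (rule rtrancl_mono) (auto simp: adj_def delete_color0_def)
  \<comment> \<open>The induction runs over copies instead of vertices: once one vertex of a copy is
    reached, all of them are, since bubbles are connected. A step between copies is then realized by
    one edge of color 0, in either direction.\<close>
  have "\<forall>v\<in>verts G. fst (c v) = l \<longrightarrow> (u, v) \<in> (adj G)\<^sup>*" if "(fst (c u), l) \<in> (code_adj \<tau>)\<^sup>*" for l
    using that
  proof induction
    case base
    then show ?case using cg_component[OF assms(1)] sub by auto
  next
    case (step l l')
    obtain x y where xy: "((l, x), (l', y)) \<in> \<tau> \<or> ((l', y), (l, x)) \<in> \<tau>"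
      using step(2) by (auto simp: code_adj_def)
    then have in_K: "l \<in> K" "x \<in> \<Omega>" "l' \<in> K" "y \<in> \<Omega>" using cg_tau by auto
    obtain s t where st: "s \<in> verts G" "t \<in> verts G" "fst (c s) = l" "fst (c t) = l'" "(s, t) \<in> adj G"
      using xy
    proof
      assume *: "((l, x), (l', y)) \<in> \<tau>"
      obtain b w where "b \<in> black G" "gpos c b = (l, x)" "w \<in> white G" "gpos c w = (l', y)"
        using cg_black_ex[OF in_K(1,2)] cg_white_ex[OF in_K(3,4)] by blast
      then show ?thesis using * cg_edge0[of w b] that[of b w] by (auto simp: verts_def adj_def gpos_def)
    next
      assume *: "((l', y), (l, x)) \<in> \<tau>"
      obtain b w where "b \<in> black G" "gpos c b = (l', y)" "w \<in> white G" "gpos c w = (l, x)"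
        using cg_black_ex[OF in_K(3,4)] cg_white_ex[OF in_K(1,2)] by blast
      then show ?thesis using * cg_edge0[of w b] that[of w b] by (auto simp: verts_def adj_def gpos_def)
    qed
    have "(u, v) \<in> (adj G)\<^sup>*" if "v \<in> verts G" "fst (c v) = l'" for v
    proof -
      have "(u, s) \<in> (adj G)\<^sup>*" using step st by blast
      moreover have "(t, v) \<in> (adj G)\<^sup>*" using cg_component[of t v] st that sub by auto
      ultimately show ?thesis using st(5) by (meson rtrancl_trans r_into_rtrancl)
    qed
    then show ?case by blast
  qed
  then show "(fst (c u), fst (c v)) \<in> (code_adj \<tau>)\<^sup>* \<Longrightarrow> (u, v) \<in> (adj G)\<^sup>*" using assms by blast
qed

lemma cg_connected: "graph_connected G \<longleftrightarrow> K \<noteq> {} \<and> (\<forall>k\<in>K. \<forall>l\<in>K. (k, l) \<in> (code_adj \<tau>)\<^sup>*)"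
proof
  assume G: "graph_connected G"
  then have "K \<noteq> {}" using cg_in(3) by (auto simp: graph_connected_def)
  moreover have "(k, l) \<in> (code_adj \<tau>)\<^sup>*" if "k \<in> K" "l \<in> K" for k l
    using G cg_gcopy_ex[OF that(1)] cg_gcopy_ex[OF that(2)] cg_adj_rtrancl
    by (auto simp: graph_connected_def)
  ultimately show "K \<noteq> {} \<and> (\<forall>k\<in>K. \<forall>l\<in>K. (k, l) \<in> (code_adj \<tau>)\<^sup>*)" by blast
next
  assume *: "K \<noteq> {} \<and> (\<forall>k\<in>K. \<forall>l\<in>K. (k, l) \<in> (code_adj \<tau>)\<^sup>*)"
  then have "verts G \<noteq> {}" using cg_gcopy_ex by blast
  moreover have "(u, v) \<in> (adj G)\<^sup>*" if "u \<in> verts G" "v \<in> verts G" for u v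
    using * cg_adj_rtrancl[OF that] cg_in(3) that by simp
  ultimately show "graph_connected G" by (simp add: graph_connected_def)
qed

text \<open>Free white vertices are the positions outside the range of \<tau>, free black ones those
  outside its domain; \<open>partial_inj_card\<close> expresses both counts through the
  domain.\<close>

lemma cg_free_white: "card {w \<in> white G. \<not> (\<exists>b. (0, w, b) \<in> cedges G)} = card (K \<times> \<Omega> - Domain \<tau>)"
proof -
  have iff: "(\<exists>b. (0, w, b) \<in> cedges G) \<longleftrightarrow> gpos c w \<in> Range \<tau>" if "w \<in> white G" for w
  proof
    assume "gpos c w \<in> Range \<tau>"
    then obtain a where a: "(a, gpos c w) \<in> \<tau>" by blast
    then obtain b where "b \<in> black G" "a = gpos c b" using cg_tau cg_gpos_surj(2) by blast
    then show "\<exists>b. (0, w, b) \<in> cedges G" using a that by (auto simp: cg_edge0)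
  qed (auto simp: cg_edge0)
  then have "{w \<in> white G. \<not> (\<exists>b. (0, w, b) \<in> cedges G)} = {w \<in> white G. gpos c w \<notin> Range \<tau>}" by blast
  then show ?thesis
    using bij_betw_card_not_in[OF cg_gpos_white] partial_inj_card[OF cg_partial_inj] by simp
qed

lemma cg_free_black: "card {b \<in> black G. \<not> (\<exists>w. (0, w, b) \<in> cedges G)} = card (K \<times> \<Omega> - Domain \<tau>)"
proof -
  have iff: "(\<exists>w. (0, w, b) \<in> cedges G) \<longleftrightarrow> gpos c b \<in> Domain \<tau>" if "b \<in> black G" for b
  proof
    assume "gpos c b \<in> Domain \<tau>"
    then obtain a where a: "(gpos c b, a) \<in> \<tau>" by blast
    then obtain w where "w \<in> white G" "a = gpos c w" using cg_tau cg_gpos_surj(1) by blast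
    then show "\<exists>w. (0, w, b) \<in> cedges G" using a that by (auto simp: cg_edge0)
  qed (auto simp: cg_edge0)
  then have "{b \<in> black G. \<not> (\<exists>w. (0, w, b) \<in> cedges G)} = {b \<in> black G. gpos c b \<notin> Domain \<tau>}" by blast
  then show ?thesis using bij_betw_card_not_in[OF cg_gpos_black] by simp
qed

lemma cg_edge_white_ex1: assumes "i \<in> {1..D}" "b \<in> black G" shows "\<exists>!w. (i, w, b) \<in> cedges G"
proof -
  have pos: "fst (gpos c b) \<in> K" "snd (gpos c b) \<in> \<Omega>" using cg_gpos_in(2)[OF assms(2)] by (auto simp: mem_Times_iff)
  obtain y where y: "y \<in> \<Omega>" "nb i y = snd (gpos c b)" using nb_surj[OF pos(2)] by blast
  then obtain w where w: "w \<in> white G" "gpos c w = (fst (gpos c b), y)" using cg_white_ex pos(1) by blast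
  have i0: "i \<noteq> 0" using assms(1) by simp
  show ?thesis
  proof (rule ex1I[of _ w])
    show "(i, w, b) \<in> cedges G" using w y assms by (simp add: cg_edge_nb[OF i0])
    fix w' assume "(i, w', b) \<in> cedges G"
    then have w': "w' \<in> white G" "gpos c b = (fst (gpos c w'), nb i (snd (gpos c w')))"
      by (simp_all add: cg_edge_nb[OF i0])
    moreover have "snd (gpos c w') \<in> \<Omega>" using cg_gpos_in(1)[OF w'(1)] by (auto simp: mem_Times_iff)
    ultimately have "gpos c w' = gpos c w" using w y nb_inj[of y "snd (gpos c w')" i] by (metis fst_conv prod.collapse snd_conv)
    then show "w' = w" using cg_gpos_inj(1) w w' by blast
  qed
qed

lemma cg_edge_black_ex1: assumes "i \<in> {1..D}" "w \<in> white G" shows "\<exists>!b. (i, w, b) \<in> cedges G"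
proof -
  have pos: "fst (gpos c w) \<in> K" "snd (gpos c w) \<in> \<Omega>" using cg_gpos_in(1)[OF assms(2)] by (auto simp: mem_Times_iff)
  obtain b where b: "b \<in> black G" "gpos c b = (fst (gpos c w), nb i (snd (gpos c w)))"
    using cg_black_ex[OF pos(1) nb_in[OF pos(2)]] by blast
  have i0: "i \<noteq> 0" using assms(1) by simp
  show ?thesis
  proof (rule ex1I[of _ b])
    show "(i, w, b) \<in> cedges G" using b assms by (simp add: cg_edge_nb[OF i0])
    fix b' assume "(i, w, b') \<in> cedges G"
    then have "b' \<in> black G" "gpos c b' = gpos c b" using b by (simp_all add: cg_edge_nb[OF i0])
    then show "b' = b" using cg_gpos_inj(2) b by blast
  qed
qed

lemma cg_edge0_unique:
  "(0, w, b) \<in> cedges G \<Longrightarrow> (0, w, b') \<in> cedges G \<Longrightarrow> b = b'"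
  "(0, w, b) \<in> cedges G \<Longrightarrow> (0, w', b) \<in> cedges G \<Longrightarrow> w = w'"
proof -
  note sv = partial_injD[OF cg_partial_inj]
  show "(0, w, b) \<in> cedges G \<Longrightarrow> (0, w, b') \<in> cedges G \<Longrightarrow> b = b'"
    using sv(2) cg_gpos_inj(2) cg_edge0 by meson
  show "(0, w, b) \<in> cedges G \<Longrightarrow> (0, w', b) \<in> cedges G \<Longrightarrow> w = w'"
    using sv(1) cg_gpos_inj(1) cg_edge0 by meson
qed

text \<open>Once \<tau> is a partial injection, the remaining conditions hold in coordinates for
  every code; only connectedness and the number p are left to \<open>valid_code\<close>.\<close>

lemma coded_graph_in_id_graphs: "(G, \<theta>) \<in> id_graphs D B p \<longleftrightarrow> valid_code p K \<tau>"
proof -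
  have "bip_graph {0..D} G" using cg by (simp add: coded_graph_def)
  moreover have "one_edge_per_color D G"
    using cg_edge_white_ex1 cg_edge_black_ex1 by (simp add: one_edge_per_color_def)
  moreover have "\<forall>H\<in>bubbles_of G. graph_iso \<theta> H B" using cg_gcopy_iso by (auto simp: cg_bubbles)
  moreover have "(\<forall>w b b'. (0, w, b) \<in> cedges G \<and> (0, w, b') \<in> cedges G \<longrightarrow> b = b')"
    "(\<forall>w w' b. (0, w, b) \<in> cedges G \<and> (0, w', b) \<in> cedges G \<longrightarrow> w = w')"
    using cg_edge0_unique by blast+
  ultimately show ?thesis
    unfolding id_graphs_def bubble_graphs_def valid_code_def mem_Collect_eq case_prod_conv
      cg_connected cg_free_white cg_free_black by blast
qed

end

section \<open>Uniqueness and existence of the code of a graph\<close>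

lemma coded_graph_unique:
  assumes G: "coded_graph G \<theta> K \<tau> c" and G': "coded_graph G \<theta> K' \<tau>' c'"
  obtains h where "bij_betw h K K'"
    "\<And>k l x y. \<lbrakk>k \<in> K; l \<in> K; x \<in> \<Omega>; y \<in> \<Omega>\<rbrakk> \<Longrightarrow> ((k, x), (l, y)) \<in> \<tau> \<longleftrightarrow> ((h k, x), (h l, y)) \<in> \<tau>'"
proof -
  \<comment> \<open>Equality of copy numbers means lying in one bubble, which does not depend on
    coordinates; hence the renumbering \<open>h\<close>. Pairs are untouched because both
    coordinates restrict to the same \<theta>.\<close>
  have iff: "fst (c u) = fst (c v) \<longleftrightarrow> fst (c' u) = fst (c' v)" if "u \<in> verts G" "v \<in> verts G" for u v
    using cg_component[OF G that] cg_component[OF G' that] by simp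
  define h where "h k = fst (c' (SOME v. v \<in> verts G \<and> fst (c v) = k))" for k
  have h: "h (fst (c v)) = fst (c' v)" if "v \<in> verts G" for v
  proof -
    let ?u = "SOME u. u \<in> verts G \<and> fst (c u) = fst (c v)"
    have "?u \<in> verts G \<and> fst (c ?u) = fst (c v)" by (rule someI[of _ v]) (use that in simp)
    then show ?thesis using iff[of ?u v] that by (simp add: h_def)
  qed
  have "bij_betw h K K'"
  proof (rule bij_betwI')
    fix k l assume "k \<in> K" "l \<in> K"
    then obtain u v where "u \<in> verts G" "fst (c u) = k" "v \<in> verts G" "fst (c v) = l"
      using cg_gcopy_ex[OF G] by metis
    then show "(h k = h l) = (k = l)" using h iff by metis
  next
    fix k assume "k \<in> K"
    then obtain u where "u \<in> verts G" "fst (c u) = k" using cg_gcopy_ex[OF G] by metis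
    then show "h k \<in> K'" using h cg_in(3)[OF G'] by metis
  next
    fix k' assume "k' \<in> K'"
    then obtain u where "u \<in> verts G" "fst (c' u) = k'" using cg_gcopy_ex[OF G'] by metis
    then show "\<exists>k\<in>K. k' = h k" using h cg_in(3)[OF G] by metis
  qed
  moreover have "((k, x), (l, y)) \<in> \<tau> \<longleftrightarrow> ((h k, x), (h l, y)) \<in> \<tau>'"
    if kl: "k \<in> K" "l \<in> K" "x \<in> \<Omega>" "y \<in> \<Omega>" for k l x y
  proof -
    obtain b w where b: "b \<in> black G" "fst (c b) = k" "gpos c b = (k, x)" "\<theta> b = bl x"
      and w: "w \<in> white G" "fst (c w) = l" "gpos c w = (l, y)" "\<theta> w = wh y"
      using cg_black_ex[OF G kl(1,3)] cg_white_ex[OF G kl(2,4)] by blast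
    have "b \<in> verts G" "w \<in> verts G" using b w by (auto simp: verts_def)
    then have "gpos c' b = (h k, x)" "gpos c' w = (h l, y)"
      using h b w kl cg_gpos[OF G'] by (metis pr_wh_bl(2), metis pr_wh_bl(1))
    then show ?thesis using cg_edge0[OF G, of w b] cg_edge0[OF G', of w b] b w by simp
  qed
  ultimately show ?thesis using that by blast
qed

text \<open>The coordinates of a vertex are an arbitrary number given to its bubble, and its image
  under \<theta>; the code is then read off the edges of color 0.\<close>

lemma ex_coded_graph_of_id_graph:
  fixes G :: "'a cgraph"
  assumes "(G, \<theta>) \<in> id_graphs D B p"
  shows "\<exists>K \<tau> c. coded_graph G \<theta> K \<tau> c"
proof -
  let ?G = "delete_color0 G"
  define C where "C v = {x \<in> verts G. (v, x) \<in> (adj ?G)\<^sup>*}" for v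
  have bip: "bip_graph {0..D} G" "finite (verts G)" "white G \<inter> black G = {}"
      "cedges G \<subseteq> {0..D} \<times> white G \<times> black G"
    and iso: "\<And>H. H \<in> bubbles_of G \<Longrightarrow> graph_iso \<theta> H B"
    using assms by (auto simp: id_graphs_def bubble_graphs_def bip_graph_def)
  have u1: "\<And>w b b'. (0, w, b) \<in> cedges G \<Longrightarrow> (0, w, b') \<in> cedges G \<Longrightarrow> b = b'"
    and u2: "\<And>w w' b. (0, w, b) \<in> cedges G \<Longrightarrow> (0, w', b) \<in> cedges G \<Longrightarrow> w = w'"
    using assms unfolding id_graphs_def bubble_graphs_def by blast+
  have [simp]: "verts ?G = verts G" "white ?G = white G" "black ?G = black G"
    by (simp_all add: verts_def delete_color0_def)
  have Ciso: "graph_iso \<theta> (induced ?G (C v)) B" if "v \<in> verts G" for v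
    using iso that by (auto simp: bubbles_of_def graph_components_def C_def)
  have sub: "white G \<subseteq> verts G" "black G \<subseteq> verts G" by (auto simp: verts_def)
  have sym: "(v, u) \<in> (adj ?G)\<^sup>*" if "(u, v) \<in> (adj ?G)\<^sup>*" for u v
    using that sym_rtrancl[OF sym_adj, of ?G] by (auto dest: symD)
  have C_eq: "C u = C v \<longleftrightarrow> (u, v) \<in> (adj ?G)\<^sup>*" if "u \<in> verts G" "v \<in> verts G" for u v
  proof
    assume "C u = C v"
    moreover have "v \<in> C v" using that by (simp add: C_def)
    ultimately show "(u, v) \<in> (adj ?G)\<^sup>*" by (auto simp: C_def)
  next
    assume "(u, v) \<in> (adj ?G)\<^sup>*"
    then show "C u = C v" using sym by (auto simp: C_def intro: rtrancl_trans)
  qed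
  have C_self: "v \<in> C v" if "v \<in> verts G" for v using that by (simp add: C_def)
  have C_mem: "C v = C u" if "v \<in> C u" "u \<in> verts G" for u v
    using that C_eq by (auto simp: C_def)
  obtain \<iota> :: "'a set \<Rightarrow> nat" where \<iota>: "inj_on \<iota> (C ` verts G)"
    using finite_imp_inj_to_nat_seg[of "C ` verts G"] bip(2) by auto
  define \<kappa> where "\<kappa> v = \<iota> (C v)" for v
  define K where "K = \<kappa> ` verts G"
  define c where "c v = (\<kappa> v, \<theta> v)" for v
  have \<kappa>_eq: "\<kappa> u = \<kappa> v \<longleftrightarrow> C u = C v" if "u \<in> verts G" "v \<in> verts G" for u v
    using that \<iota> by (auto simp: \<kappa>_def inj_on_def)
  \<comment> \<open>The number fixes the bubble, and on one bubble \<theta> is injective.\<close>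
  have inj: "u = v" if "u \<in> verts G" "v \<in> verts G" "\<kappa> u = \<kappa> v" "\<theta> u = \<theta> v" for u v
  proof -
    have "u \<in> C v" using that \<kappa>_eq C_self by blast
    moreover have "inj_on \<theta> (C v)" using Ciso[OF that(2)] that(2)
      by (auto simp: graph_iso_def bij_betw_def verts_induced C_def inj_on_def)
    ultimately show ?thesis using that C_self by (auto dest: inj_onD)
  qed
  have C_verts: "verts (induced ?G (C v)) = C v" "white (induced ?G (C v)) = white G \<inter> C v"
    "black (induced ?G (C v)) = black G \<inter> C v" for v
    by (auto simp: verts_induced C_def) (auto simp: induced_def)
  have onto: "\<exists>v\<in>X. \<kappa> v = k \<and> \<theta> v = y" if ass: "k \<in> K" "y \<in> Y" "X \<subseteq> verts G"
    "\<And>u. u \<in> verts G \<Longrightarrow> \<theta> ` (X \<inter> C u) = Y" for k y X Y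
  proof -
    obtain u where u: "u \<in> verts G" "k = \<kappa> u" using \<open>k \<in> K\<close> by (auto simp: K_def)
    then obtain v where "v \<in> X" "v \<in> C u" "y = \<theta> v" using ass(2,4) by blast
    moreover have "\<kappa> v = \<kappa> u" using calculation C_mem u ass(3) by (simp add: \<kappa>_def)
    ultimately show ?thesis using u by blast
  qed
  have Cw: "\<theta> ` (white G \<inter> C u) = white B" and Cb: "\<theta> ` (black G \<inter> C u) = black B"
    and Cv: "\<theta> ` (verts G \<inter> C u) = verts B" if "u \<in> verts G" for u
  proof -
    have "verts G \<inter> C u = C u" by (auto simp: C_def)
    then show "\<theta> ` (white G \<inter> C u) = white B" "\<theta> ` (black G \<inter> C u) = black B" "\<theta> ` (verts G \<inter> C u) = verts B"
      using Ciso[OF that] by (simp_all add: graph_iso_def C_verts bij_betw_def)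
  qed
  have \<theta>_mem: "\<theta> v \<in> Y" if "v \<in> X" "v \<in> verts G" "\<theta> ` (X \<inter> C v) = Y" for v X Y
    using that C_self[of v] by blast
  have \<theta>_in: "v \<in> white G \<Longrightarrow> \<theta> v \<in> white B" "v \<in> black G \<Longrightarrow> \<theta> v \<in> black B" "v \<in> verts G \<Longrightarrow> \<theta> v \<in> verts B" for v
    using \<theta>_mem[OF _ _ Cw] \<theta>_mem[OF _ _ Cb] \<theta>_mem[OF _ _ Cv] sub by auto
  have c_onto: "K \<times> Y \<subseteq> c ` X" if XY: "X \<subseteq> verts G" "\<And>u. u \<in> verts G \<Longrightarrow> \<theta> ` (X \<inter> C u) = Y" for X Y
  proof clarify
    fix k y assume "k \<in> K" "y \<in> Y"
    then obtain v where "v \<in> X" "\<kappa> v = k" "\<theta> v = y" using onto[OF _ _ XY] by metis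
    then show "(k, y) \<in> c ` X" by (auto simp: c_def)
  qed
  have \<kappa>K: "\<kappa> v \<in> K" if "v \<in> verts G" for v using that by (simp add: K_def)
  define \<tau> where "\<tau> = {(gpos c b, gpos c w) | w b. (0, w, b) \<in> cedges G}"
  have gpos_c: "gpos c v = (\<kappa> v, pr (\<theta> v))" for v by (simp add: gpos_def c_def)
  have winj: "u = v" if "u \<in> white G" "v \<in> white G" "gpos c u = gpos c v" for u v
    using that inj[of u v] \<theta>_in sub by (metis gpos_c prod.inject subsetD wh_pr)
  have binj: "u = v" if "u \<in> black G" "v \<in> black G" "gpos c u = gpos c v" for u v
    using that inj[of u v] \<theta>_in sub by (metis gpos_c prod.inject subsetD bl_pr)
  have gpos_in: "gpos c v \<in> K \<times> \<Omega>" if "v \<in> verts G" for v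
    using that \<kappa>K \<theta>_in pr_in by (auto simp: gpos_c)
  have e0: "w \<in> white G \<and> b \<in> black G \<and> w \<in> verts G \<and> b \<in> verts G" if "(i, w, b) \<in> cedges G" for i w b
    using that bip(4) sub by auto
  have "partial_inj (K \<times> \<Omega>) \<tau>"
  proof -
    have "finite (K \<times> \<Omega>)" using bip(2) finite_Omega by (simp add: K_def)
    moreover have "\<tau> \<subseteq> (K \<times> \<Omega>) \<times> (K \<times> \<Omega>)" unfolding \<tau>_def using gpos_in e0 by blast
    moreover have "single_valued \<tau>"
    proof (rule single_valuedI)
      fix a d d' assume "(a, d) \<in> \<tau>" "(a, d') \<in> \<tau>"
      then obtain w b w' b' where *: "a = gpos c b" "d = gpos c w" "(0, w, b) \<in> cedges G"
        "a = gpos c b'" "d' = gpos c w'" "(0, w', b') \<in> cedges G" unfolding \<tau>_def by blast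
      then have "b = b'" using e0 binj by metis
      then show "d = d'" using * u2 by metis
    qed
    moreover have "single_valued (\<tau>\<inverse>)"
    proof (rule single_valuedI)
      fix a d d' assume "(a, d) \<in> \<tau>\<inverse>" "(a, d') \<in> \<tau>\<inverse>"
      then obtain w b w' b' where *: "d = gpos c b" "a = gpos c w" "(0, w, b) \<in> cedges G"
        "d' = gpos c b'" "a = gpos c w'" "(0, w', b') \<in> cedges G" unfolding \<tau>_def by blast
      then have "w = w'" using e0 winj by metis
      then show "d = d'" using * u1 by metis
    qed
    ultimately show ?thesis by (simp add: partial_inj_def)
  qed
  moreover have "graph_iso c G (std_graph K \<tau>)"
  proof -
    have "bij_betw c (verts G) (K \<times> verts B)"
    proof -
      have "inj_on c (verts G)" using inj by (auto simp: inj_on_def c_def)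
      moreover have "c ` verts G \<subseteq> K \<times> verts B" using \<kappa>K \<theta>_in by (auto simp: c_def)
      ultimately show ?thesis using c_onto[OF order_refl Cv] by (simp add: bij_betw_def subset_antisym)
    qed
    moreover have "c ` white G = K \<times> white B"
      using c_onto[OF sub(1) Cw] \<kappa>K \<theta>_in sub by (auto simp: c_def)
    moreover have "c ` black G = K \<times> black B"
      using c_onto[OF sub(2) Cb] \<kappa>K \<theta>_in sub by (auto simp: c_def)
    moreover have "(i, w, b) \<in> cedges G \<longleftrightarrow> (i, c w, c b) \<in> cedges (std_graph K \<tau>)"
      if wb: "w \<in> white G" "b \<in> black G" for i w b
    proof (cases "i = 0")
      case True
      have "(0, w, b) \<in> cedges G \<longleftrightarrow> (gpos c b, gpos c w) \<in> \<tau>"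
      proof
        assume "(gpos c b, gpos c w) \<in> \<tau>"
        then obtain w' b' where *: "gpos c b = gpos c b'" "gpos c w = gpos c w'" "(0, w', b') \<in> cedges G"
          unfolding \<tau>_def by blast
        then show "(0, w, b) \<in> cedges G" using e0 winj binj wb by metis
      qed (auto simp: \<tau>_def)
      then show ?thesis using True wb \<theta>_in by (simp add: c_def cedges_std_graph_0 gpos_c)
    next
      case False
      have wC: "w \<in> verts G" "b \<in> verts G" using wb sub by auto
      \<comment> \<open>Inside one bubble the isomorphism \<theta> decides; between different
        bubbles no edge of nonzero color exists.\<close>
      have "(i, w, b) \<in> cedges G \<longleftrightarrow> \<kappa> w = \<kappa> b \<and> (i, \<theta> w, \<theta> b) \<in> cedges B"
      proof (cases "C w = C b")
        case True
        then have "w \<in> C w" "b \<in> C w" using wC C_self by auto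
        then have "(i, w, b) \<in> cedges (induced ?G (C w)) \<longleftrightarrow> (i, \<theta> w, \<theta> b) \<in> cedges B"
          using Ciso[OF wC(1)] wb by (simp add: graph_iso_def C_verts)
        then show ?thesis using True False wC \<kappa>_eq \<open>w \<in> C w\<close> \<open>b \<in> C w\<close>
          by (simp add: induced_def delete_color0_def)
      next
        case diff: False
        have "(i, w, b) \<notin> cedges G"
        proof
          assume "(i, w, b) \<in> cedges G"
          then have "(w, b) \<in> adj ?G" using False by (auto simp: adj_def delete_color0_def)
          then show False using diff C_eq wC by blast
        qed
        then show ?thesis using diff \<kappa>_eq wC by simp
      qed
      then show ?thesis using False \<kappa>K wC by (auto simp: c_def cedges_std_graph_pos)
    qed
    ultimately show ?thesis by (simp add: graph_iso_def verts_std_graph)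
  qed
  ultimately have "coded_graph G \<theta> K \<tau> c" using bip(1) by (simp add: coded_graph_def c_def)
  then show ?thesis by blast
qed

lemma ex_coded_graph:
  assumes "partial_inj (K \<times> \<Omega>) \<tau>"
  shows "\<exists>(G :: nat cgraph) \<theta> c. coded_graph G \<theta> K \<tau> c"
proof -
  have "bip_graph {0..D} (std_graph K \<tau>)"
  proof -
    have "finite (verts (std_graph K \<tau>))" using code_finite[OF assms] B_bip(1) by (simp add: verts_std_graph)
    moreover have "white (std_graph K \<tau>) \<inter> black (std_graph K \<tau>) = {}" using B_bip(2) by auto
    moreover have "cedges (std_graph K \<tau>) \<subseteq> {0..D} \<times> white (std_graph K \<tau>) \<times> black (std_graph K \<tau>)"
      using assms by (auto simp: std_graph_def cedges_B_iff dest: partial_injD(3))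
    ultimately show ?thesis by (simp add: bip_graph_def)
  qed
  then obtain G :: "nat cgraph" and c where "bip_graph {0..D} G" "graph_iso c G (std_graph K \<tau>)"
    using ex_nat_graph_iso by blast
  then have "coded_graph G (snd \<circ> c) K \<tau> c" using assms by (simp add: coded_graph_def)
  then show ?thesis by blast
qed

text \<open>Serves two opposite purposes: renumbering copies, with every \<open>a k\<close> the
  identity, and changing identifications, with \<open>h\<close> the identity.\<close>

lemma std_graph_iso:
  assumes h: "bij_betw h K K'" and \<tau>': "\<tau>' \<subseteq> (K' \<times> \<Omega>) \<times> (K' \<times> \<Omega>)" and \<tau>: "\<tau> \<subseteq> (K \<times> \<Omega>) \<times> (K \<times> \<Omega>)"
    and a: "\<And>k. k \<in> K \<Longrightarrow> graph_iso (a k) B B" and a\<Omega>: "\<And>k x. k \<in> K \<Longrightarrow> x \<in> \<Omega> \<Longrightarrow> a k ` x \<in> \<Omega>"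
    and iff: "\<And>k l x y. \<lbrakk>k \<in> K; l \<in> K; x \<in> \<Omega>; y \<in> \<Omega>\<rbrakk> \<Longrightarrow>
      ((k, x), (l, y)) \<in> \<tau> \<longleftrightarrow> ((h k, a k ` x), (h l, a l ` y)) \<in> \<tau>'"
  shows "graph_iso (\<lambda>(k, v). (h k, a k v)) (std_graph K \<tau>) (std_graph K' \<tau>')"
proof -
  let ?f = "\<lambda>(k, v). (h k, a k v)"
  have hK: "h ` K = K'" "\<And>k l. k \<in> K \<Longrightarrow> l \<in> K \<Longrightarrow> h k = h l \<longleftrightarrow> k = l"
    using h by (auto simp: bij_betw_def dest: inj_onD)
  have img: "?f ` (K \<times> X) = K' \<times> X" if aX: "\<And>k. k \<in> K \<Longrightarrow> a k ` X = X" for X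
  proof
    show "?f ` (K \<times> X) \<subseteq> K' \<times> X"
    proof clarify
      fix k v assume "k \<in> K" "v \<in> X"
      then show "h k \<in> K' \<and> a k v \<in> X" using aX[of k] hK(1) by blast
    qed
    show "K' \<times> X \<subseteq> ?f ` (K \<times> X)"
    proof clarify
      fix k' y assume "k' \<in> K'" "y \<in> X"
      then obtain k where k: "k \<in> K" "k' = h k" using hK(1) by blast
      then obtain v where "v \<in> X" "y = a k v" using aX[OF k(1)] \<open>y \<in> X\<close> by blast
      then show "(k', y) \<in> ?f ` (K \<times> X)" using k by force
    qed
  qed
  have aX: "a k ` verts B = verts B" "a k ` white B = white B" "a k ` black B = black B"
    "inj_on (a k) (verts B)" if "k \<in> K" for k
    using a[OF that] by (auto simp: graph_iso_def bij_betw_def)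
  have pra: "pr (a k v) = a k ` pr v" if "k \<in> K" "v \<in> verts B" for k v
    using pr_eqI a\<Omega> pr_in that by blast
  have "bij_betw ?f (K \<times> verts B) (K' \<times> verts B)"
    using img[OF aX(1)] hK(2) aX(4) by (auto simp: bij_betw_def inj_on_def)
  moreover have "(i, (k, w), (l, b)) \<in> cedges (std_graph K \<tau>) \<longleftrightarrow>
      (i, (h k, a k w), (h l, a l b)) \<in> cedges (std_graph K' \<tau>')"
    if "k \<in> K" "l \<in> K" "w \<in> white B" "b \<in> black B" for i k w l b
  proof (cases "i = 0")
    case True
    have "a k w \<in> white B" "a l b \<in> black B" "w \<in> verts B" "b \<in> verts B"
      using aX(2)[OF that(1)] aX(3)[OF that(2)] that(3,4) by (blast, blast, simp_all add: verts_cases)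
    then show ?thesis
      using True that iff[of l k "pr b" "pr w"] pr_in by (simp add: cedges_std_graph_0 pra)
  next
    case False
    have "h k \<in> K'" using hK that by blast
    then show ?thesis using False that hK(2) a[OF that(1)]
      by (auto simp: cedges_std_graph_pos graph_iso_def)
  qed
  ultimately show ?thesis
    using img[OF aX(2)] img[OF aX(3)] by (auto simp: graph_iso_def verts_std_graph)
qed

section \<open>Coordinates on stuffed Walsh maps\<close>

text \<open>The choice has no effect: by \<open>closing_intertwine\<close> for the identity, two
  closings of the same \<tau> agree on the positions, and elsewhere both are the identity.\<close>

definition clo :: "nat set \<Rightarrow> (nat \<times> 'v set) rel \<Rightarrow> nat \<times> 'v set \<Rightarrow> nat \<times> 'v set" where
  "clo K \<tau> = (SOME \<sigma>. closing (K \<times> \<Omega>) \<tau> \<sigma>)"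

lemma closing_clo: "partial_inj (K \<times> \<Omega>) \<tau> \<Longrightarrow> closing (K \<times> \<Omega>) \<tau> (clo K \<tau>)"
  unfolding clo_def by (rule someI_ex[of "closing (K \<times> \<Omega>) \<tau>"]) (rule closing_ex)

lemma clo_tau: "partial_inj (K \<times> \<Omega>) \<tau> \<Longrightarrow> (a, b) \<in> \<tau> \<Longrightarrow> clo K \<tau> a = b"
  using closing_clo by (fastforce simp: closing_def)

lemma clo_in: "partial_inj (K \<times> \<Omega>) \<tau> \<Longrightarrow> a \<in> K \<times> \<Omega> \<Longrightarrow> clo K \<tau> a \<in> K \<times> \<Omega>"
  using closing_clo[of K \<tau>] permutes_in_image[of "clo K \<tau>" "K \<times> \<Omega>" a] by (simp add: closing_def)

text \<open>The black half-edge at position \<open>(k, x)\<close> is \<open>Inr (k, x)\<close>; it is attached to the cilium of the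
  vertex \<open>x\<close> in the \<open>k\<close>-th copy of \<open>M\<close>.\<close>

definition std_map ::
    "nat set \<Rightarrow> (nat \<times> 'v set) rel \<Rightarrow> ((nat \<times> 'v set hedge) + (nat \<times> 'v set)) wmap" where
  "std_map K \<tau> = \<lparr>darts = Inl ` (K \<times> darts M) \<union> Inr ` (K \<times> \<Omega>),
     rot = (\<lambda>d. case d of Inl (k, h) \<Rightarrow> Inl (k, rot M h) | Inr a \<Rightarrow> Inr (clo K \<tau> a)),
     opp = (\<lambda>d. case d of Inl (k, h) \<Rightarrow> (case h of Cil x \<Rightarrow> Inr (k, x) | _ \<Rightarrow> Inl (k, opp M h))
       | Inr (k, x) \<Rightarrow> Inl (k, Cil x)),
     lab = (\<lambda>d. case d of Inl (k, h) \<Rightarrow> (case h of Cil x \<Rightarrow> cols x | _ \<Rightarrow> hedge_label h)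
       | Inr (k, x) \<Rightarrow> cols x),
     blk = Inr ` (K \<times> \<Omega>), cil = Inr ` (K \<times> \<Omega> - Domain \<tau>)\<rparr>"

lemma std_map_simps [simp]:
  "darts (std_map K \<tau>) = Inl ` (K \<times> darts M) \<union> Inr ` (K \<times> \<Omega>)"
  "blk (std_map K \<tau>) = Inr ` (K \<times> \<Omega>)" "cil (std_map K \<tau>) = Inr ` (K \<times> \<Omega> - Domain \<tau>)"
  "rot (std_map K \<tau>) (Inl (k, h)) = Inl (k, rot M h)" "rot (std_map K \<tau>) (Inr a) = Inr (clo K \<tau> a)"
  "opp (std_map K \<tau>) (Inl (k, Cil x)) = Inr (k, x)" "opp (std_map K \<tau>) (Inr (k, x)) = Inl (k, Cil x)"
  "lab (std_map K \<tau>) (Inl (k, Cil x)) = cols x" "lab (std_map K \<tau>) (Inr (k, x)) = cols x"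
  by (simp_all add: std_map_def)

lemma std_map_not_Cil:
  assumes "\<nexists>x. h = Cil x"
  shows "opp (std_map K \<tau>) (Inl (k, h)) = Inl (k, opp M h)" "lab (std_map K \<tau>) (Inl (k, h)) = hedge_label h"
  using assms by (cases h; simp add: std_map_def)+

text \<open>An isomorphism constrains rotation and involution only on darts and sees
  \<open>blk\<close> and \<open>cil\<close> only through their images, so \<open>permutes\<close>
  and the inclusions are demanded separately.\<close>

definition coded_map :: "'d wmap \<Rightarrow> ('d \<Rightarrow> 'v set hedge) \<Rightarrow> nat set \<Rightarrow> (nat \<times> 'v set) rel \<Rightarrow>
    ('d \<Rightarrow> (nat \<times> 'v set hedge) + (nat \<times> 'v set)) \<Rightarrow> bool" where
  "coded_map W \<mu> K \<tau> c \<longleftrightarrow> partial_inj (K \<times> \<Omega>) \<tau> \<and> rot W permutes darts W \<and> opp W permutes darts W \<and>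
     blk W \<subseteq> darts W \<and> cil W \<subseteq> blk W \<and> walsh_iso c W (std_map K \<tau>) \<and>
     (\<forall>d\<in>darts W - blk W. \<exists>k. c d = Inl (k, \<mu> d))"

text \<open>Meaningful at blue darts, where \<open>c\<close> takes left values; \<open>mpos\<close>
  is its counterpart for black darts and right values.\<close>

definition mkap :: "('d \<Rightarrow> (nat \<times> 'v set hedge) + (nat \<times> 'v set)) \<Rightarrow> 'd \<Rightarrow> nat" where
  "mkap c d = fst (projl (c d))"

definition mpos :: "('d \<Rightarrow> (nat \<times> 'v set hedge) + (nat \<times> 'v set)) \<Rightarrow> 'd \<Rightarrow> nat \<times> 'v set" where
  "mpos c d = projr (c d)"

definition mcopy :: "'d wmap \<Rightarrow> ('d \<Rightarrow> (nat \<times> 'v set hedge) + (nat \<times> 'v set)) \<Rightarrow> nat \<Rightarrow> 'd cmap" where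
  "mcopy W c k = submap (delete_black W) {d \<in> darts W - blk W. mkap c d = k}"

context
  fixes W :: "'d wmap" and \<mu> K \<tau> c
  assumes cm: "coded_map W \<mu> K \<tau> c"
begin

lemma cm_simps:
  shows cm_partial_inj: "partial_inj (K \<times> \<Omega>) \<tau>" and cm_tau: "\<tau> \<subseteq> (K \<times> \<Omega>) \<times> (K \<times> \<Omega>)"
    and cm_rot: "rot W permutes darts W" and cm_opp: "opp W permutes darts W"
    and cm_blk: "blk W \<subseteq> darts W" and cm_cil: "cil W \<subseteq> blk W"
    and cm_bij: "bij_betw c (darts W) (Inl ` (K \<times> darts M) \<union> Inr ` (K \<times> \<Omega>))"
    and cm_c_blk: "c ` blk W = Inr ` (K \<times> \<Omega>)" and cm_c_cil: "c ` cil W = Inr ` (K \<times> \<Omega> - Domain \<tau>)"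
    and cm_c_rot: "d \<in> darts W \<Longrightarrow> c (rot W d) = rot (std_map K \<tau>) (c d)"
    and cm_c_opp: "d \<in> darts W \<Longrightarrow> c (opp W d) = opp (std_map K \<tau>) (c d)"
    and cm_c_lab: "d \<in> darts W \<Longrightarrow> lab W d = lab (std_map K \<tau>) (c d)"
  using cm by (auto simp: coded_map_def walsh_iso_def map_iso_def partial_inj_def)

lemma cm_in: "d \<in> darts W \<Longrightarrow> rot W d \<in> darts W" "d \<in> darts W \<Longrightarrow> opp W d \<in> darts W"
  using cm_rot cm_opp by (simp_all add: permutes_in_image)

lemma cm_inj: "d \<in> darts W \<Longrightarrow> e \<in> darts W \<Longrightarrow> c d = c e \<Longrightarrow> d = e"
  using cm_bij by (auto simp: bij_betw_def dest: inj_onD)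

lemma cm_blk_iff: assumes "d \<in> darts W" shows "d \<in> blk W \<longleftrightarrow> (\<exists>a. c d = Inr a)"
proof
  assume "d \<in> blk W"
  then show "\<exists>a. c d = Inr a" using cm_c_blk by blast
next
  assume "\<exists>a. c d = Inr a"
  moreover have "c d \<in> Inl ` (K \<times> darts M) \<union> Inr ` (K \<times> \<Omega>)"
    using cm_bij bij_betwE assms by blast
  ultimately have "c d \<in> c ` blk W" using cm_c_blk by auto
  then show "d \<in> blk W" using cm_inj cm_blk assms by blast
qed

lemma cm_blue: assumes "d \<in> darts W" "d \<notin> blk W"
  shows "c d = Inl (mkap c d, \<mu> d)" "mkap c d \<in> K" "\<mu> d \<in> darts M"
proof -
  have "\<forall>d\<in>darts W - blk W. \<exists>k. c d = Inl (k, \<mu> d)" using cm by (simp add: coded_map_def)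
  then obtain k where k: "c d = Inl (k, \<mu> d)" using assms by blast
  then show cd: "c d = Inl (mkap c d, \<mu> d)" by (simp add: mkap_def)
  have "c d \<in> Inl ` (K \<times> darts M) \<union> Inr ` (K \<times> \<Omega>)" using cm_bij bij_betwE assms by blast
  then show "mkap c d \<in> K" "\<mu> d \<in> darts M" using cd by auto
qed

lemma cm_black: assumes "d \<in> blk W"
  shows "d \<in> darts W" "c d = Inr (mpos c d)" "mpos c d \<in> K \<times> \<Omega>"
proof -
  show d: "d \<in> darts W" using cm_blk assms by blast
  have "c d \<in> Inr ` (K \<times> \<Omega>)" using cm_c_blk assms by blast
  then show "c d = Inr (mpos c d)" "mpos c d \<in> K \<times> \<Omega>" by (auto simp: mpos_def)
qed

lemma cm_finite: "finite (darts W)"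
proof -
  have "finite (Inl ` (K \<times> darts M) \<union> Inr ` (K \<times> \<Omega>) :: ((nat \<times> 'v set hedge) + (nat \<times> 'v set)) set)"
    using code_finite[OF cm_partial_inj] finite_darts_M finite_Omega by simp
  then show ?thesis using cm_bij bij_betw_finite by blast
qed

lemma cm_mpos_bij: "bij_betw (mpos c) (blk W) (K \<times> \<Omega>)"
proof (rule bij_betwI')
  fix d e assume "d \<in> blk W" "e \<in> blk W"
  then show "(mpos c d = mpos c e) = (d = e)" using cm_black[of d] cm_black[of e] cm_inj[of d e] by auto
next
  fix d assume "d \<in> blk W"
  then show "mpos c d \<in> K \<times> \<Omega>" by (rule cm_black(3))
next
  fix a assume "a \<in> K \<times> \<Omega>"
  then have "Inr a \<in> c ` blk W" using cm_c_blk by auto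
  then obtain d where "d \<in> blk W" "c d = Inr a" by (metis imageE)
  then show "\<exists>d\<in>blk W. a = mpos c d" by (intro bexI[of _ d]) (simp_all add: mpos_def)
qed

lemma cm_mpos_inj: "d \<in> blk W \<Longrightarrow> e \<in> blk W \<Longrightarrow> mpos c d = mpos c e \<Longrightarrow> d = e"
  using cm_mpos_bij by (auto simp: bij_betw_def dest: inj_onD)

lemma cm_mpos_surj: assumes "a \<in> K \<times> \<Omega>" obtains d where "d \<in> blk W" "mpos c d = a"
proof -
  have "a \<in> mpos c ` blk W" using cm_mpos_bij assms by (simp add: bij_betw_def)
  then show ?thesis using that by blast
qed

lemma cm_blue_inj:
  assumes "d \<in> darts W" "d \<notin> blk W" "e \<in> darts W" "e \<notin> blk W" "mkap c d = mkap c e" "\<mu> d = \<mu> e"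
  shows "d = e"
  using cm_blue(1)[OF assms(1,2)] cm_blue(1)[OF assms(3,4)] cm_inj assms by simp

lemma cm_blue_surj: assumes "k \<in> K" "h \<in> darts M"
  obtains d where "d \<in> darts W" "d \<notin> blk W" "mkap c d = k" "\<mu> d = h"
proof -
  have "Inl (k, h) \<in> c ` darts W" using cm_bij assms by (auto simp: bij_betw_def)
  then obtain d where d: "d \<in> darts W" "c d = Inl (k, h)" by (metis imageE)
  then have "d \<notin> blk W" using cm_blk_iff by simp
  moreover have "mkap c d = k" "\<mu> d = h" using cm_blue(1)[OF d(1) \<open>d \<notin> blk W\<close>] d by auto
  ultimately show ?thesis using that d by blast
qed

lemma cm_rot_blue: assumes "d \<in> darts W" "d \<notin> blk W"
  shows "rot W d \<in> darts W" "rot W d \<notin> blk W" "mkap c (rot W d) = mkap c d" "\<mu> (rot W d) = rot M (\<mu> d)"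
proof -
  have eq: "c (rot W d) = Inl (mkap c d, rot M (\<mu> d))" using cm_c_rot assms cm_blue(1) by simp
  show 1: "rot W d \<in> darts W" using cm_in assms by blast
  then show 2: "rot W d \<notin> blk W" using cm_blk_iff eq by simp
  show "mkap c (rot W d) = mkap c d" "\<mu> (rot W d) = rot M (\<mu> d)" using cm_blue(1)[OF 1 2] eq by auto
qed

lemma cm_rot_black: assumes "d \<in> blk W"
  shows "rot W d \<in> blk W" "mpos c (rot W d) = clo K \<tau> (mpos c d)"
proof -
  have eq: "c (rot W d) = Inr (clo K \<tau> (mpos c d))" using cm_c_rot assms cm_black by simp
  then show "rot W d \<in> blk W" using cm_blk_iff cm_in cm_black(1)[OF assms] by simp
  show "mpos c (rot W d) = clo K \<tau> (mpos c d)" using eq by (simp add: mpos_def)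
qed

lemma cm_opp_Cil: assumes "d \<in> darts W" "d \<notin> blk W" "\<mu> d = Cil x"
  shows "opp W d \<in> blk W" "mpos c (opp W d) = (mkap c d, x)" "lab W d = cols x"
proof -
  have eq: "c (opp W d) = Inr (mkap c d, x)" using cm_c_opp assms cm_blue(1) by simp
  then show "opp W d \<in> blk W" using cm_blk_iff cm_in assms by simp
  show "mpos c (opp W d) = (mkap c d, x)" using eq by (simp add: mpos_def)
  show "lab W d = cols x" using cm_c_lab assms cm_blue(1) by simp
qed

lemma cm_opp_blue: assumes "d \<in> darts W" "d \<notin> blk W" "\<nexists>x. \<mu> d = Cil x"
  shows "opp W d \<in> darts W" "opp W d \<notin> blk W" "mkap c (opp W d) = mkap c d" "\<mu> (opp W d) = opp M (\<mu> d)"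
    "lab W d = hedge_label (\<mu> d)"
proof -
  have eq: "c (opp W d) = Inl (mkap c d, opp M (\<mu> d))"
    using cm_c_opp assms cm_blue(1) std_map_not_Cil by simp
  show 1: "opp W d \<in> darts W" using cm_in assms by blast
  then show 2: "opp W d \<notin> blk W" using cm_blk_iff eq by simp
  show "mkap c (opp W d) = mkap c d" "\<mu> (opp W d) = opp M (\<mu> d)" using cm_blue(1)[OF 1 2] eq by auto
  show "lab W d = hedge_label (\<mu> d)" using cm_c_lab assms cm_blue(1) std_map_not_Cil by simp
qed

lemma cm_opp_black: assumes "d \<in> blk W"
  shows "opp W d \<in> darts W" "opp W d \<notin> blk W" "mkap c (opp W d) = fst (mpos c d)"
    "\<mu> (opp W d) = Cil (snd (mpos c d))" "lab W d = cols (snd (mpos c d))"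
proof -
  note d = cm_black[OF assms]
  have eq: "c (opp W d) = Inl (fst (mpos c d), Cil (snd (mpos c d)))"
    using cm_c_opp[OF d(1)] d(2) by (metis prod.collapse std_map_simps(7))
  show 1: "opp W d \<in> darts W" using cm_in d by blast
  then show 2: "opp W d \<notin> blk W" using cm_blk_iff eq by simp
  show "mkap c (opp W d) = fst (mpos c d)" "\<mu> (opp W d) = Cil (snd (mpos c d))"
    using cm_blue(1)[OF 1 2] eq by auto
  show "lab W d = cols (snd (mpos c d))" using cm_c_lab[OF d(1)] d(2) by (metis prod.collapse std_map_simps(9))
qed

lemma cm_cil_iff: assumes "d \<in> blk W" shows "d \<in> cil W \<longleftrightarrow> mpos c d \<notin> Domain \<tau>"
proof -
  have "d \<in> cil W \<longleftrightarrow> c d \<in> c ` cil W" using cm_inj cm_cil cm_blk assms by blast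
  then show ?thesis using cm_c_cil cm_black[OF assms] by auto
qed

lemma cm_opp_opp: assumes "d \<in> darts W"
  shows "opp W (opp W d) = d" "lab W (opp W d) = lab W d" "opp W d \<noteq> d"
proof -
  have "opp W (opp W d) = d \<and> lab W (opp W d) = lab W d \<and> opp W d \<noteq> d"
  proof (cases "d \<in> blk W")
    case True
    note o = cm_opp_black[OF True]
    note o2 = cm_opp_Cil[OF o(1,2,4)]
    have "opp W (opp W d) = d" using o o2 True by (intro cm_mpos_inj) auto
    then show ?thesis using o o2 True by auto
  next
    case False
    show ?thesis
    proof (cases "\<exists>x. \<mu> d = Cil x")
      case True
      then obtain x where x: "\<mu> d = Cil x" by blast
      note o = cm_opp_Cil[OF assms False x]
      note o2 = cm_opp_black[OF o(1)]
      have "opp W (opp W d) = d" using o o2 assms False x by (intro cm_blue_inj) auto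
      then show ?thesis using o o2 False by auto
    next
      case nC: False
      note o = cm_opp_blue[OF assms False nC]
      have mu: "\<mu> d \<in> darts M" using cm_blue(3) assms False by blast
      \<comment> \<open>Were the image a cilium, it would be fixed by the involution of
        \<open>M\<close>, and then so would \<open>\<mu> d\<close>.\<close>
      have nC2: "\<nexists>x. \<mu> (opp W d) = Cil x"
        using o(4) nC opp_M_fix[OF opp_M_in[OF mu]] opp_opp_M[OF mu] opp_M_fix[OF mu] by metis
      note o2 = cm_opp_blue[OF o(1,2) nC2]
      have "opp W (opp W d) = d" using o o2 assms False opp_opp_M[OF mu] by (intro cm_blue_inj) auto
      moreover have "opp W d \<noteq> d" using o(4) nC opp_M_fix[OF mu] by metis
      ultimately show ?thesis using o o2 lab_opp_M[OF mu] by auto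
    qed
  qed
  then show "opp W (opp W d) = d" "lab W (opp W d) = lab W d" "opp W d \<noteq> d" by auto
qed

lemma cm_comb_map: "comb_map W"
  using cm_finite cm_rot cm_opp cm_opp_opp by (simp add: comb_map_def)

section \<open>Blue submaps, labels and cilia of a coded map\<close>

lemma cm_delete_black:
  "darts (delete_black W) = darts W - blk W"
  "d \<in> darts W \<Longrightarrow> d \<notin> blk W \<Longrightarrow> rot (delete_black W) d = rot W d"
  "d \<in> darts W \<Longrightarrow> d \<notin> blk W \<Longrightarrow> opp (delete_black W) d = (if \<exists>x. \<mu> d = Cil x then d else opp W d)"
  "d \<in> darts W \<Longrightarrow> d \<notin> blk W \<Longrightarrow> lab (delete_black W) d = hedge_label (\<mu> d)"
proof -
  show "darts (delete_black W) = darts W - blk W" by (simp add: delete_black_def Let_def)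
  show "d \<in> darts W \<Longrightarrow> d \<notin> blk W \<Longrightarrow> rot (delete_black W) d = rot W d"
    by (simp add: delete_black_def Let_def perm_restrict_def)
  assume d: "d \<in> darts W" "d \<notin> blk W"
  have iff: "opp W d \<in> blk W \<longleftrightarrow> (\<exists>x. \<mu> d = Cil x)"
    using cm_opp_Cil(1)[OF d] cm_opp_blue(2)[OF d] by blast
  show "opp (delete_black W) d = (if \<exists>x. \<mu> d = Cil x then d else opp W d)"
    using d iff by (simp add: delete_black_def Let_def perm_restrict_def)
  show "lab (delete_black W) d = hedge_label (\<mu> d)"
  proof (cases "\<exists>x. \<mu> d = Cil x")
    case True
    then show ?thesis using iff by (auto simp: delete_black_def Let_def)
  next
    case False
    then show ?thesis using iff cm_opp_blue(5)[OF d] by (auto simp: delete_black_def Let_def)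
  qed
qed

lemma cm_opp_delete: assumes "d \<in> darts W" "d \<notin> blk W"
  shows "opp (delete_black W) d \<in> darts W" "opp (delete_black W) d \<notin> blk W"
    "mkap c (opp (delete_black W) d) = mkap c d" "\<mu> (opp (delete_black W) d) = opp M (\<mu> d)"
proof -
  note eq = cm_delete_black(3)[OF assms]
  have "opp (delete_black W) d \<in> darts W \<and> opp (delete_black W) d \<notin> blk W \<and>
    mkap c (opp (delete_black W) d) = mkap c d \<and> \<mu> (opp (delete_black W) d) = opp M (\<mu> d)"
  proof (cases "\<exists>x. \<mu> d = Cil x")
    case True
    then have "opp M (\<mu> d) = \<mu> d" using opp_M_fix cm_blue(3) assms by blast
    then show ?thesis using eq True assms by simp
  next
    case False
    then show ?thesis using eq cm_opp_blue[OF assms False] by simp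
  qed
  then show "opp (delete_black W) d \<in> darts W" "opp (delete_black W) d \<notin> blk W"
    "mkap c (opp (delete_black W) d) = mkap c d" "\<mu> (opp (delete_black W) d) = opp M (\<mu> d)" by auto
qed

text \<open>As for graphs: both kinds of steps keep the copy number, and a walk in the connected map
  \<open>M\<close> lifts through \<mu> to any copy.\<close>

lemma cm_component:
  assumes d: "d \<in> darts W" "d \<notin> blk W" and e: "e \<in> darts W" "e \<notin> blk W"
  shows "(d, e) \<in> (dart_step (delete_black W))\<^sup>* \<longleftrightarrow> mkap c d = mkap c e"
proof
  assume "(d, e) \<in> (dart_step (delete_black W))\<^sup>*"
  then show "mkap c d = mkap c e"
  proof induction
    case (step y z)
    then have y: "y \<in> darts W" "y \<notin> blk W" "z = rot W y \<or> z = opp (delete_black W) y"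
      by (auto simp: dart_step_def cm_delete_black(1,2))
    then show ?case using step cm_rot_blue(3)[OF y(1,2)] cm_opp_delete(3)[OF y(1,2)] by auto
  qed simp
next
  assume eq: "mkap c d = mkap c e"
  have "\<exists>e. e \<in> darts W \<and> e \<notin> blk W \<and> mkap c e = mkap c d \<and> \<mu> e = h \<and> (d, e) \<in> (dart_step (delete_black W))\<^sup>*"
    if "(\<mu> d, h) \<in> (dart_step M)\<^sup>*" for h
    using that
  proof induction
    case base
    show ?case using d by blast
  next
    case (step y z)
    then obtain e where e: "e \<in> darts W" "e \<notin> blk W" "mkap c e = mkap c d" "\<mu> e = y"
      "(d, e) \<in> (dart_step (delete_black W))\<^sup>*" by blast
    from step(2) consider "z = rot M y" | "z = opp M y" by (auto simp: dart_step_def)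
    then show ?case
    proof cases
      case 1
      have "(e, rot W e) \<in> dart_step (delete_black W)" using e by (simp add: dart_step_def cm_delete_black)
      then show ?thesis using 1 e cm_rot_blue[OF e(1,2)] by (intro exI[of _ "rot W e"]) auto
    next
      case 2
      have "(e, opp (delete_black W) e) \<in> dart_step (delete_black W)"
        using e by (simp add: dart_step_def cm_delete_black(1))
      then show ?thesis using 2 e cm_opp_delete[OF e(1,2)] by (intro exI[of _ "opp (delete_black W) e"]) auto
    qed
  qed
  moreover have "(\<mu> d, \<mu> e) \<in> (dart_step M)\<^sup>*" using M_connected cm_blue(3) d e by blast
  ultimately obtain e' where e': "e' \<in> darts W" "e' \<notin> blk W" "mkap c e' = mkap c d" "\<mu> e' = \<mu> e"
    "(d, e') \<in> (dart_step (delete_black W))\<^sup>*" by blast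
  then have "e' = e" using cm_blue_inj e eq by metis
  then show "(d, e) \<in> (dart_step (delete_black W))\<^sup>*" using e' by simp
qed

lemma cm_mcopy_ex: assumes "k \<in> K" obtains d where "d \<in> darts W" "d \<notin> blk W" "mkap c d = k"
proof -
  obtain x where "x \<in> \<Omega>" using Omega_nonempty by blast
  then show ?thesis using cm_blue_surj[OF assms, of "Cil x"] that by auto
qed

lemma darts_mcopy: "darts (mcopy W c k) = {d \<in> darts W - blk W. mkap c d = k}"
  by (simp add: mcopy_def submap_def)

lemma cm_blue_submaps: "blue_submaps W = mcopy W c ` K"
proof -
  have eq: "submap (delete_black W) {e \<in> darts (delete_black W). (d, e) \<in> (dart_step (delete_black W))\<^sup>*} =
    mcopy W c (mkap c d)" if d: "d \<in> darts W" "d \<notin> blk W" for d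
    using cm_component[OF d] by (auto simp: mcopy_def cm_delete_black(1) intro!: arg_cong[where f = "submap _"])
  show ?thesis
  proof
    show "blue_submaps W \<subseteq> mcopy W c ` K"
      using eq cm_blue(2) by (auto simp: blue_submaps_def map_components_def cm_delete_black(1))
    show "mcopy W c ` K \<subseteq> blue_submaps W"
    proof
      fix N assume "N \<in> mcopy W c ` K"
      then obtain k where k: "k \<in> K" "N = mcopy W c k" by blast
      obtain d where d: "d \<in> darts W" "d \<notin> blk W" "mkap c d = k" using cm_mcopy_ex[OF k(1)] .
      then have "N = submap (delete_black W) {e \<in> darts (delete_black W). (d, e) \<in> (dart_step (delete_black W))\<^sup>*}"
        using eq k by simp
      then show "N \<in> blue_submaps W"
        using d unfolding blue_submaps_def map_components_def cm_delete_black(1) by blast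
    qed
  qed
qed

lemma mcopy_inj: "inj_on (mcopy W c) K"
proof (rule inj_onI)
  fix k l assume kl: "k \<in> K" "l \<in> K" "mcopy W c k = mcopy W c l"
  obtain d where d: "d \<in> darts W" "d \<notin> blk W" "mkap c d = k" using cm_mcopy_ex[OF kl(1)] .
  then have "d \<in> darts (mcopy W c l)" using kl(3) darts_mcopy[of k] by auto
  then show "k = l" using d darts_mcopy[of l] by simp
qed

lemma cm_mcopy_iso: assumes "k \<in> K" shows "map_iso \<mu> (mcopy W c k) M"
proof -
  have "bij_betw \<mu> (darts (mcopy W c k)) (darts M)"
  proof (rule bij_betwI')
    fix h assume "h \<in> darts M"
    then obtain d where "d \<in> darts W" "d \<notin> blk W" "mkap c d = k" "\<mu> d = h" using cm_blue_surj assms by metis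
    then show "\<exists>d\<in>darts (mcopy W c k). h = \<mu> d" by (auto simp: darts_mcopy)
  qed (use cm_blue_inj cm_blue(3) in \<open>auto simp: darts_mcopy\<close>)
  moreover have "\<mu> (rot (mcopy W c k) d) = rot M (\<mu> d) \<and> \<mu> (opp (mcopy W c k) d) = opp M (\<mu> d) \<and>
      lab M (\<mu> d) = lab (mcopy W c k) d" if d: "d \<in> darts (mcopy W c k)" for d
  proof -
    have d': "d \<in> darts W" "d \<notin> blk W" "d \<in> {d \<in> darts W - blk W. mkap c d = k}" using d by (auto simp: darts_mcopy)
    have "rot (mcopy W c k) d = rot W d" "opp (mcopy W c k) d = opp (delete_black W) d"
      "lab (mcopy W c k) d = lab (delete_black W) d"
      using d'(3) cm_delete_black(2)[OF d'(1,2)] by (simp_all add: mcopy_def submap_def perm_restrict_def)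
    then show ?thesis using cm_rot_blue(4)[OF d'(1,2)] cm_opp_delete(4)[OF d'(1,2)] cm_delete_black(4)[OF d'(1,2)] by simp
  qed
  ultimately show ?thesis by (simp add: map_iso_def)
qed

lemma cm_orbit_blue: assumes d: "d \<in> darts W" "d \<notin> blk W"
  shows "\<mu> ` orbit (rot W) d = orbit (rot M) (\<mu> d)" "orbit (rot W) d \<subseteq> darts W - blk W"
proof -
  have cl: "rot W ` (darts W - blk W) \<subseteq> darts W - blk W" using cm_rot_blue by blast
  show "\<mu> ` orbit (rot W) d = orbit (rot M) (\<mu> d)"
    by (rule orbit_image_semiconj[where Y = "darts W - blk W"]) (use d cl cm_rot_blue(4) in auto)
  show "orbit (rot W) d \<subseteq> darts W - blk W"
  proof
    fix e assume "e \<in> orbit (rot W) d"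
    then show "e \<in> darts W - blk W" by induction (use cl d in auto)
  qed
qed

text \<open>The rotation at the blue end is a copy of the rotation of \<open>M\<close> at a pair,
  and the colors met there are exactly those of the label chosen in \<open>std_map\<close>.\<close>

lemma cm_black_label: assumes "d \<in> blk W"
  shows "lab W d = (\<Union>e\<in>orbit (rot W) (opp W d). lab (delete_black W) e)"
proof -
  note o = cm_opp_black[OF assms]
  have x: "snd (mpos c d) \<in> \<Omega>" using cm_black(3)[OF assms] by auto
  have "(\<Union>e\<in>orbit (rot W) (opp W d). lab (delete_black W) e) = (\<Union>e\<in>orbit (rot W) (opp W d). hedge_label (\<mu> e))"
    using cm_orbit_blue(2)[OF o(1,2)] cm_delete_black(4) by (intro SUP_cong) auto
  also have "\<dots> = (\<Union>h\<in>orbit (rot M) (Cil (snd (mpos c d))). hedge_label h)"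
    using cm_orbit_blue(1)[OF o(1,2)] o(4) by (metis image_image)
  also have "\<dots> = cols (snd (mpos c d))" using rot_M_orbit[OF x] Union_labels[OF x] by simp
  finally show ?thesis using o(5) by simp
qed

lemma cm_cil_orbit: assumes "d \<in> cil W" "e \<in> cil W" "e \<in> orbit (rot W) d" shows "e = d"
proof -
  have de: "d \<in> blk W" "e \<in> blk W" using assms cm_cil by auto
  have "mpos c ` orbit (rot W) d = orbit (clo K \<tau>) (mpos c d)"
    by (rule orbit_image_semiconj[where Y = "blk W"]) (use de cm_rot_black in auto)
  then have "mpos c e \<in> orbit (clo K \<tau>) (mpos c d)" using assms by blast
  moreover have "mpos c d \<in> K \<times> \<Omega> - Domain \<tau>" "mpos c e \<in> K \<times> \<Omega> - Domain \<tau>"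
    using cm_cil_iff cm_black(3) de assms by auto
  ultimately have "mpos c e = mpos c d" using closing_clo[OF cm_partial_inj] by (simp add: closing_def)
  then show ?thesis using cm_mpos_inj de by blast
qed

lemma cm_card_cil: "card (cil W) = card (K \<times> \<Omega> - Domain \<tau>)"
proof -
  have "cil W = {d \<in> blk W. mpos c d \<notin> Domain \<tau>}" using cm_cil cm_cil_iff by blast
  then show ?thesis using bij_betw_card_not_in[OF cm_mpos_bij] by simp
qed

text \<open>A black dart is counted with the copy to whose cilium it is attached, so that every dart
  belongs to a copy.\<close>

definition idx :: "'d \<Rightarrow> nat" where "idx d = (if d \<in> blk W then fst (mpos c d) else mkap c d)"

lemma idx_K: "d \<in> darts W \<Longrightarrow> idx d \<in> K"
  using cm_blue(2) cm_black(3)[of d] by (auto simp: idx_def mem_Times_iff)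

text \<open>At a ciliated corner the rotation goes from the end of a path of \<tau> to its start,
  and the path itself already connects the two. Hence closing the paths does not change
  connectedness.\<close>

lemma cm_clo_adj: assumes "a \<in> K \<times> \<Omega>" shows "(fst a, fst (clo K \<tau> a)) \<in> (code_adj \<tau>)\<^sup>*"
proof (cases "a \<in> Domain \<tau>")
  case True
  then obtain b where "(a, b) \<in> \<tau>" by blast
  then have "(fst a, fst b) \<in> code_adj \<tau>" by (cases a; cases b) (auto simp: code_adj_def)
  then show ?thesis using clo_tau[OF cm_partial_inj \<open>(a, b) \<in> \<tau>\<close>] by auto
next
  case False
  have "(clo K \<tau> a, a) \<in> \<tau>\<^sup>*"
    using closing_start(1)[OF closing_clo cm_partial_inj assms False] cm_partial_inj by blast
  moreover have "(fst b, fst a) \<in> (code_adj \<tau>)\<^sup>*" if "(b, a) \<in> \<tau>\<^sup>*" for a b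
    using that
  proof induction
    case (step y z)
    then have "(fst y, fst z) \<in> code_adj \<tau>" by (cases y; cases z) (auto simp: code_adj_def)
    with step show ?case by simp
  qed simp
  ultimately have "(fst (clo K \<tau> a), fst a) \<in> (code_adj \<tau>)\<^sup>*" by blast
  then show ?thesis using sym_rtrancl[OF sym_code_adj] by (auto dest: symD)
qed

lemma cm_step_rtrancl:
  assumes "d \<in> darts W" "e \<in> darts W"
  shows "(d, e) \<in> (dart_step W)\<^sup>* \<longleftrightarrow> (idx d, idx e) \<in> (code_adj \<tau>)\<^sup>*"
proof
  have step: "(idx y, idx z) \<in> (code_adj \<tau>)\<^sup>*" if yz: "(y, z) \<in> dart_step W" for y z
  proof -
    have y: "y \<in> darts W" "z = rot W y \<or> z = opp W y" using yz by (auto simp: dart_step_def)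
    show ?thesis
    proof (cases "y \<in> blk W")
      case True
      then show ?thesis using y(2) cm_rot_black[OF True] cm_opp_black[OF True] cm_clo_adj[OF cm_black(3)[OF True]]
        by (auto simp: idx_def)
    next
      case False
      show ?thesis
      proof (cases "\<exists>x. \<mu> y = Cil x")
        case True
        then obtain x where x: "\<mu> y = Cil x" by blast
        show ?thesis using y False cm_rot_blue[OF y(1) False] cm_opp_Cil[OF y(1) False x] by (auto simp: idx_def)
      next
        case nC: False
        show ?thesis using y False cm_rot_blue[OF y(1) False] cm_opp_blue[OF y(1) False nC] by (auto simp: idx_def)
      qed
    qed
  qed
  show "(d, e) \<in> (dart_step W)\<^sup>* \<Longrightarrow> (idx d, idx e) \<in> (code_adj \<tau>)\<^sup>*"
    by (induction rule: rtrancl_induct) (use step in \<open>auto intro: rtrancl_trans\<close>)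
next
  have st: "(y, rot W y) \<in> dart_step W" "(y, opp W y) \<in> dart_step W" if "y \<in> darts W" for y
    using that by (auto simp: dart_step_def)
  have sub: "(dart_step (delete_black W))\<^sup>* \<subseteq> (dart_step W)\<^sup>*"
  proof (rule rtrancl_subset_rtrancl)
    show "dart_step (delete_black W) \<subseteq> (dart_step W)\<^sup>*"
    proof clarify
      fix y z assume "(y, z) \<in> dart_step (delete_black W)"
      then have y: "y \<in> darts W" "y \<notin> blk W" "z = rot W y \<or> z = opp (delete_black W) y"
        by (auto simp: dart_step_def cm_delete_black(1,2))
      then show "(y, z) \<in> (dart_step W)\<^sup>*"
        using st[OF y(1)] cm_delete_black(3)[OF y(1,2)] by (auto split: if_splits)
    qed
  qed
  have same: "(y, z) \<in> (dart_step W)\<^sup>*" if yz: "y \<in> darts W" "z \<in> darts W" "idx y = idx z" for y z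
  proof -
    have blue: "\<exists>y'. y' \<in> darts W \<and> y' \<notin> blk W \<and> mkap c y' = idx y \<and> (y, y') \<in> (dart_step W)\<^sup>* \<and> (y', y) \<in> (dart_step W)\<^sup>*"
      if y: "y \<in> darts W" for y
    proof (cases "y \<in> blk W")
      case True
      note o = cm_opp_black[OF True]
      have "(opp W y, y) \<in> dart_step W" using st(2)[OF o(1)] cm_opp_opp(1)[OF y] by simp
      then show ?thesis using o st(2)[OF y] True by (intro exI[of _ "opp W y"]) (auto simp: idx_def)
    next
      case False
      then show ?thesis using y by (intro exI[of _ y]) (auto simp: idx_def)
    qed
    obtain y' where y': "y' \<in> darts W" "y' \<notin> blk W" "mkap c y' = idx y" "(y, y') \<in> (dart_step W)\<^sup>*"
      using blue[OF yz(1)] by blast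
    obtain z' where z': "z' \<in> darts W" "z' \<notin> blk W" "mkap c z' = idx z" "(z', z) \<in> (dart_step W)\<^sup>*"
      using blue[OF yz(2)] by blast
    have "(y', z') \<in> (dart_step W)\<^sup>*" using cm_component[OF y'(1,2) z'(1,2)] y' z' yz(3) sub by auto
    then show ?thesis using y'(4) z'(4) by (meson rtrancl_trans)
  qed
  have "\<forall>e\<in>darts W. idx e = l \<longrightarrow> (d, e) \<in> (dart_step W)\<^sup>*" if "(idx d, l) \<in> (code_adj \<tau>)\<^sup>*" for l
    using that
  proof induction
    case base
    show ?case using same[OF assms(1)] by auto
  next
    case (step l l')
    obtain x y where xy: "((l, x), (l', y)) \<in> \<tau> \<or> ((l', y), (l, x)) \<in> \<tau>"
      using step(2) by (auto simp: code_adj_def)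
    then have in_K: "(l, x) \<in> K \<times> \<Omega>" "(l', y) \<in> K \<times> \<Omega>" using cm_tau by auto
    obtain s where s: "s \<in> blk W" "mpos c s = (l, x)" using cm_mpos_surj[OF in_K(1)] .
    obtain t where t: "t \<in> blk W" "mpos c t = (l', y)" using cm_mpos_surj[OF in_K(2)] .
    note sW = cm_black(1)[OF s(1)] and tW = cm_black(1)[OF t(1)]
    have "(s, t) \<in> (dart_step W)\<^sup>*"
      using xy
    proof
      assume "((l, x), (l', y)) \<in> \<tau>"
      then have "mpos c (rot W s) = mpos c t" using cm_rot_black[OF s(1)] clo_tau[OF cm_partial_inj] s t by simp
      then have "rot W s = t" using cm_mpos_inj cm_rot_black[OF s(1)] t by blast
      then show ?thesis using st(1)[OF sW] by auto
    next
      assume "((l', y), (l, x)) \<in> \<tau>"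
      then have "mpos c (rot W t) = mpos c s" using cm_rot_black[OF t(1)] clo_tau[OF cm_partial_inj] s t by simp
      then have "rot W t = s" using cm_mpos_inj cm_rot_black[OF t(1)] s by blast
      \<comment> \<open>The rotation leads from \<open>t\<close> to \<open>s\<close>; the way back
        completes the turn around the black vertex.\<close>
      then show ?thesis using permutes_rtrancl_back[OF cm_rot cm_finite tW, of "dart_step W"] st(1) by auto
    qed
    moreover have "(d, s) \<in> (dart_step W)\<^sup>*" using step s sW by (simp add: idx_def)
    moreover have "(t, e) \<in> (dart_step W)\<^sup>*" if "e \<in> darts W" "idx e = l'" for e
      using same[OF tW that(1)] t that(2) by (simp add: idx_def)
    ultimately show ?case by (meson rtrancl_trans)
  qed
  then show "(idx d, idx e) \<in> (code_adj \<tau>)\<^sup>* \<Longrightarrow> (d, e) \<in> (dart_step W)\<^sup>*" using assms by blast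
qed

lemma cm_connected: "map_connected W \<longleftrightarrow> K \<noteq> {} \<and> (\<forall>k\<in>K. \<forall>l\<in>K. (k, l) \<in> (code_adj \<tau>)\<^sup>*)"
proof
  assume W: "map_connected W"
  then have "K \<noteq> {}" using idx_K by (auto simp: map_connected_def)
  moreover have "(k, l) \<in> (code_adj \<tau>)\<^sup>*" if kl: "k \<in> K" "l \<in> K" for k l
  proof -
    obtain d where d: "d \<in> darts W" "d \<notin> blk W" "mkap c d = k" using cm_mcopy_ex[OF kl(1)] .
    obtain e where e: "e \<in> darts W" "e \<notin> blk W" "mkap c e = l" using cm_mcopy_ex[OF kl(2)] .
    show ?thesis using W cm_step_rtrancl[OF d(1) e(1)] d e by (simp add: map_connected_def idx_def)
  qed
  ultimately show "K \<noteq> {} \<and> (\<forall>k\<in>K. \<forall>l\<in>K. (k, l) \<in> (code_adj \<tau>)\<^sup>*)" by blast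
next
  assume *: "K \<noteq> {} \<and> (\<forall>k\<in>K. \<forall>l\<in>K. (k, l) \<in> (code_adj \<tau>)\<^sup>*)"
  then have "darts W \<noteq> {}" using cm_mcopy_ex by blast
  moreover have "(d, e) \<in> (dart_step W)\<^sup>*" if "d \<in> darts W" "e \<in> darts W" for d e
    using * cm_step_rtrancl[OF that] idx_K that by simp
  ultimately show "map_connected W" by (simp add: map_connected_def)
qed

lemma coded_map_in_id_walsh_maps: "(W, \<mu>) \<in> id_walsh_maps M p \<longleftrightarrow> valid_code p K \<tau>"
proof -
  have "\<forall>d\<in>darts W. opp W d \<noteq> d" using cm_opp_opp(3) by blast
  moreover have "rot W ` blk W \<subseteq> blk W" using cm_rot_black(1) by blast
  moreover have "\<forall>d\<in>blk W. opp W d \<notin> blk W" using cm_opp_black(2) by blast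
  moreover have "\<forall>N\<in>blue_submaps W. map_iso \<mu> N M" unfolding cm_blue_submaps using cm_mcopy_iso by simp
  moreover have "\<forall>d\<in>blk W. lab W d = (\<Union>e\<in>orbit (rot W) (opp W d). lab (delete_black W) e)"
    using cm_black_label by simp
  moreover have "\<forall>c\<in>cil W. \<forall>c'\<in>cil W. c' \<in> orbit (rot W) c \<longrightarrow> c' = c" using cm_cil_orbit by simp
  moreover have "\<forall>N\<in>blue_submaps W. \<exists>f. map_iso f N M" unfolding cm_blue_submaps using cm_mcopy_iso by blast
  ultimately show ?thesis
    using cm_comb_map cm_blk cm_cil
    unfolding id_walsh_maps_def walsh_maps_def valid_code_def mem_Collect_eq case_prod_conv
      cm_connected cm_card_cil by - (rule iffI; elim conjE; intro conjI; assumption)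
qed

end

section \<open>Existence and uniqueness of the code of a map\<close>

lemma std_map_opp:
  assumes "d \<in> darts (std_map K \<tau>)"
  shows "opp (std_map K \<tau>) d \<in> darts (std_map K \<tau>)" "opp (std_map K \<tau>) (opp (std_map K \<tau>) d) = d"
proof -
  have "opp (std_map K \<tau>) d \<in> darts (std_map K \<tau>) \<and> opp (std_map K \<tau>) (opp (std_map K \<tau>) d) = d"
  proof (cases d)
    case (Inl kh)
    then obtain k h where d: "d = Inl (k, h)" "k \<in> K" "h \<in> darts M" using assms by auto
    show ?thesis
    proof (cases "\<exists>x. h = Cil x")
      case True
      then show ?thesis using d by auto
    next
      case False
      have "\<nexists>x. opp M h = Cil x"
        using False d opp_M_fix opp_opp_M opp_M_in by metis
      then show ?thesis using d False opp_opp_M opp_M_in by (auto simp: std_map_not_Cil)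
    qed
  next
    case (Inr a)
    then show ?thesis using assms by auto
  qed
  then show "opp (std_map K \<tau>) d \<in> darts (std_map K \<tau>)" "opp (std_map K \<tau>) (opp (std_map K \<tau>) d) = d" by auto
qed

lemma std_map_rot:
  assumes "partial_inj (K \<times> \<Omega>) \<tau>"
  shows "bij_betw (rot (std_map K \<tau>)) (darts (std_map K \<tau>)) (darts (std_map K \<tau>))"
proof (rule bij_betwI')
  have clo: "clo K \<tau> permutes K \<times> \<Omega>" using closing_clo[OF assms] by (simp add: closing_def)
  have M_eq: "rot M h = rot M h' \<longleftrightarrow> h = h'" for h h' using rot_M_permutes by (metis permutes_inj injD)
  have clo_eq: "clo K \<tau> a = clo K \<tau> b \<longleftrightarrow> a = b" for a b using clo by (metis permutes_inj injD)
  {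
    fix d e assume de: "d \<in> darts (std_map K \<tau>)" "e \<in> darts (std_map K \<tau>)"
    show "(rot (std_map K \<tau>) d = rot (std_map K \<tau>) e) = (d = e)"
      by (cases d; cases e) (auto simp: M_eq clo_eq)
  next
    fix d assume "d \<in> darts (std_map K \<tau>)"
    then show "rot (std_map K \<tau>) d \<in> darts (std_map K \<tau>)"
      using rot_M_darts clo_in[OF assms] by (auto simp del: mem_Sigma_iff simp: mem_Times_iff)
  next
    fix e assume "e \<in> darts (std_map K \<tau>)"
    then consider k h where "e = Inl (k, h)" "k \<in> K" "h \<in> darts M" | a where "e = Inr a" "a \<in> K \<times> \<Omega>" by auto
    then show "\<exists>d\<in>darts (std_map K \<tau>). e = rot (std_map K \<tau>) d"
    proof cases
      case 1
      then obtain h' where "h' \<in> darts M" "rot M h' = h" using rot_M_permutes by (metis permutes_def permutes_in_image)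
      then show ?thesis using 1 by (intro bexI[of _ "Inl (k, h')"]) auto
    next
      case 2
      then obtain b where "b \<in> K \<times> \<Omega>" "clo K \<tau> b = a" using clo by (metis permutes_def permutes_in_image)
      then show ?thesis using 2 by (intro bexI[of _ "Inr b"]) auto
    qed
  }
qed

lemma ex_coded_map:
  assumes pi: "partial_inj (K \<times> \<Omega>) \<tau>"
  shows "\<exists>(W :: nat wmap) \<mu> c. coded_map W \<mu> K \<tau> c"
proof -
  let ?S = "std_map K \<tau>"
  have "finite (darts ?S)" using code_finite[OF pi] finite_darts_M finite_Omega by simp
  moreover have "bij_betw (opp ?S) (darts ?S) (darts ?S)"
    by (rule bij_betw_involution) (use std_map_opp in auto)
  moreover have "blk ?S \<subseteq> darts ?S" "cil ?S \<subseteq> blk ?S" by auto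
  ultimately obtain W :: "nat wmap" and c where W: "rot W permutes darts W" "opp W permutes darts W"
    "blk W \<subseteq> darts W" "cil W \<subseteq> blk W" "walsh_iso c W ?S"
    using ex_nat_walsh_iso[of ?S] std_map_rot[OF pi] by blast
  have "\<exists>k. c d = Inl (k, snd (projl (c d)))" if d: "d \<in> darts W - blk W" for d
  proof -
    have bij: "bij_betw c (darts W) (darts ?S)" and im: "c ` blk W = Inr ` (K \<times> \<Omega>)"
      using W(5) by (auto simp: walsh_iso_def map_iso_def)
    have "c d \<notin> c ` blk W" using bij d W(3) by (auto simp: bij_betw_def inj_on_def)
    moreover have "c d \<in> darts ?S" using bij bij_betwE d by blast
    ultimately show ?thesis using im by auto
  qed
  then have "coded_map W (\<lambda>d. snd (projl (c d))) K \<tau> c" using W pi by (simp add: coded_map_def)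
  then show ?thesis by blast
qed

text \<open>Coordinates of blue darts are found as for graphs, those of black darts through the
  edges that carry them. The delicate point is the rotation at ciliated corners: it is not part of
  \<tau> and must be shown to agree with \<open>clo\<close>.\<close>

lemma ex_coded_map_of_id_walsh_map:
  fixes W :: "'d wmap"
  assumes "(W, \<mu>) \<in> id_walsh_maps M p"
  shows "\<exists>K \<tau> c. coded_map W \<mu> K \<tau> c"
proof -
  let ?N = "delete_black W"
  let ?X = "darts W - blk W"
  have Wmem: "W \<in> walsh_maps M p" and iso: "\<And>N. N \<in> blue_submaps W \<Longrightarrow> map_iso \<mu> N M"
    using assms by (auto simp: id_walsh_maps_def)
  have comb: "comb_map W" and nofix: "\<And>d. d \<in> darts W \<Longrightarrow> opp W d \<noteq> d"
    and blk: "blk W \<subseteq> darts W" and rblk: "rot W ` blk W \<subseteq> blk W"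
    and oblk: "\<And>d. d \<in> blk W \<Longrightarrow> opp W d \<notin> blk W"
    and labb: "\<And>d. d \<in> blk W \<Longrightarrow> lab W d = (\<Union>e\<in>orbit (rot W) (opp W d). lab ?N e)"
    and cil: "cil W \<subseteq> blk W"
    using Wmem by (auto simp: walsh_maps_def)
  have cil1: "\<And>c c'. c \<in> cil W \<Longrightarrow> c' \<in> cil W \<Longrightarrow> c' \<in> orbit (rot W) c \<Longrightarrow> c' = c"
    using Wmem unfolding walsh_maps_def by blast
  have fin: "finite (darts W)" and rot: "rot W permutes darts W" and opp: "opp W permutes darts W"
    and oo: "\<And>d. d \<in> darts W \<Longrightarrow> opp W (opp W d) = d" and lo: "\<And>d. d \<in> darts W \<Longrightarrow> lab W (opp W d) = lab W d"
    using comb by (auto simp: comb_map_def)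
  have oin: "opp W d \<in> darts W" if "d \<in> darts W" for d using opp that by (simp add: permutes_in_image)
  note cl = delete_black_closed[OF Wmem]
  have dN: "darts ?N = ?X" by (simp add: delete_black_def Let_def)
  have rotN: "rot ?N d = rot W d" and oppN: "opp ?N d = (if opp W d \<in> blk W then d else opp W d)" if "d \<in> ?X" for d
    using that by (simp_all add: delete_black_def Let_def perm_restrict_def)
  have labN: "lab ?N d = (if opp W d \<in> blk W then {} else lab W d)" for d
    by (simp add: delete_black_def Let_def)
  have rX: "rot W d \<in> ?X" if "d \<in> ?X" for d
    using cl(1) that rotN[OF that] by (metis dN permutes_in_image)
  define C where "C d = {e \<in> ?X. (d, e) \<in> (dart_step ?N)\<^sup>*}" for d
  have sym: "(e, d) \<in> (dart_step ?N)\<^sup>*" if "(d, e) \<in> (dart_step ?N)\<^sup>*" for d e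
    using dart_step_rtrancl_sym[OF _ cl(1) _ that] cl(2,3) fin dN by simp
  have Ciso: "map_iso \<mu> (submap ?N (C d)) M" if "d \<in> ?X" for d
    using iso that by (auto simp: blue_submaps_def map_components_def C_def dN)
  have C_self: "d \<in> C d" if "d \<in> ?X" for d using that by (simp add: C_def)
  have C_eq: "C d = C e \<longleftrightarrow> (d, e) \<in> (dart_step ?N)\<^sup>*" if "d \<in> ?X" "e \<in> ?X" for d e
  proof
    assume "C d = C e"
    then have "e \<in> C d" using C_self that by simp
    then show "(d, e) \<in> (dart_step ?N)\<^sup>*" by (simp add: C_def)
  next
    assume "(d, e) \<in> (dart_step ?N)\<^sup>*"
    then show "C d = C e" using sym by (auto simp: C_def intro: rtrancl_trans)
  qed
  have bijC: "bij_betw \<mu> (C d) (darts M)" if "d \<in> ?X" for d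
    using Ciso[OF that] by (simp add: map_iso_def submap_def)
  have \<mu>M: "\<mu> d \<in> darts M" and \<mu>rot: "\<mu> (rot W d) = rot M (\<mu> d)" and \<mu>opp: "\<mu> (opp ?N d) = opp M (\<mu> d)"
    and \<mu>lab: "hedge_label (\<mu> d) = lab ?N d" if d: "d \<in> ?X" for d
    using Ciso[OF d] C_self[OF d] bij_betwE[OF bijC[OF d]] rotN[OF d]
    by (auto simp: map_iso_def submap_def perm_restrict_def)
  \<comment> \<open>Cilia of \<open>M\<close> are the fixed points of its involution, and an
    isomorphism respects fixed points. The involution of \<open>W\<close> has none, so a fixed point
    after deletion can only come from an edge to a black vertex.\<close>
  have Cil_iff: "opp W d \<in> blk W \<longleftrightarrow> (\<exists>x. \<mu> d = Cil x)" if d: "d \<in> ?X" for d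
  proof
    assume "opp W d \<in> blk W"
    then show "\<exists>x. \<mu> d = Cil x" using oppN[OF d] \<mu>opp[OF d] opp_M_fix[OF \<mu>M[OF d]] by simp
  next
    assume "\<exists>x. \<mu> d = Cil x"
    then have "\<mu> (opp ?N d) = \<mu> d" using \<mu>opp[OF d] opp_M_fix[OF \<mu>M[OF d]] by simp
    moreover have oC: "opp ?N d \<in> C d"
    proof -
      have "(d, opp ?N d) \<in> dart_step ?N" using d by (simp add: dart_step_def dN)
      then show ?thesis using cl(2)[of d] d by (auto simp: C_def dN)
    qed
    ultimately have "opp ?N d = d" using bijC[OF d] C_self[OF d] by (auto simp: bij_betw_def dest: inj_onD)
    then show "opp W d \<in> blk W" using oppN[OF d] nofix[of d] d by (auto split: if_splits)
  qed
  obtain \<iota> :: "'d set \<Rightarrow> nat" where \<iota>: "inj_on \<iota> (C ` ?X)"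
    using finite_imp_inj_to_nat_seg[of "C ` ?X"] fin by auto
  define \<kappa> where "\<kappa> d = \<iota> (C d)" for d
  define K where "K = \<kappa> ` ?X"
  have \<kappa>_eq: "\<kappa> d = \<kappa> e \<longleftrightarrow> (d, e) \<in> (dart_step ?N)\<^sup>*" if "d \<in> ?X" "e \<in> ?X" for d e
    using inj_on_eq_iff[OF \<iota>, of "C d" "C e"] C_eq[OF that] that by (simp add: \<kappa>_def)
  have binj: "d = e" if de: "d \<in> ?X" "e \<in> ?X" "\<kappa> d = \<kappa> e" "\<mu> d = \<mu> e" for d e
  proof -
    have "e \<in> C d" "d \<in> C d" using de \<kappa>_eq[OF de(1,2)] by (auto simp: C_def)
    then show ?thesis using bijC[OF de(1)] de(4) by (auto simp: bij_betw_def dest: inj_onD)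
  qed
  have bsurj: "\<exists>d\<in>?X. \<kappa> d = k \<and> \<mu> d = h" if kh: "k \<in> K" "h \<in> darts M" for k h
  proof -
    obtain e where e: "e \<in> ?X" "k = \<kappa> e" using kh by (auto simp: K_def)
    have "h \<in> \<mu> ` C e" using bijC[OF e(1)] kh by (simp add: bij_betw_def)
    then obtain d where d: "d \<in> C e" "\<mu> d = h" by blast
    then have "d \<in> ?X" "\<kappa> d = \<kappa> e" using \<kappa>_eq[of d e] e sym by (auto simp: C_def)
    then show ?thesis using d e by blast
  qed
  have \<kappa>rot: "\<kappa> (rot W d) = \<kappa> d" if d: "d \<in> ?X" for d
  proof -
    have "(d, rot W d) \<in> dart_step ?N" using d by (simp add: dart_step_def dN rotN)
    then show ?thesis using \<kappa>_eq[OF d rX[OF d]] by auto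
  qed
  have \<kappa>opp: "\<kappa> (opp W d) = \<kappa> d" "opp W d \<in> ?X" if d: "d \<in> ?X" "opp W d \<notin> blk W" for d
  proof -
    show oX: "opp W d \<in> ?X" using oin d by auto
    have "(d, opp W d) \<in> dart_step ?N" using d oppN[OF d(1)] by (simp add: dart_step_def dN)
    then show "\<kappa> (opp W d) = \<kappa> d" using \<kappa>_eq[OF d(1) oX] by auto
  qed
  \<comment> \<open>A black dart is located by the other half of its edge: the copy number there,
    and the pair whose cilium it replaces.\<close>
  define pos where "pos d = (\<kappa> (opp W d), base (\<mu> (opp W d)))" for d
  have blkX: "opp W d \<in> ?X" "opp W (opp W d) = d" if "d \<in> blk W" for d
    using that blk oin oblk oo by auto
  have pos_Cil: "\<mu> (opp W d) = Cil (snd (pos d))" "snd (pos d) \<in> \<Omega>" if d: "d \<in> blk W" for d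
  proof -
    obtain x where "\<mu> (opp W d) = Cil x" using Cil_iff[OF blkX(1)[OF d]] blkX(2)[OF d] d by auto
    then show "\<mu> (opp W d) = Cil (snd (pos d))" "snd (pos d) \<in> \<Omega>"
      using \<mu>M[OF blkX(1)[OF d]] by (auto simp: pos_def)
  qed
  have pos_in: "pos d \<in> K \<times> \<Omega>" if d: "d \<in> blk W" for d
    using pos_Cil(2)[OF d] blkX(1)[OF d] by (auto simp: pos_def K_def)
  have pos_inj: "d = e" if de: "d \<in> blk W" "e \<in> blk W" "pos d = pos e" for d e
  proof -
    have "opp W d = opp W e"
      using pos_Cil(1)[OF de(1)] pos_Cil(1)[OF de(2)] de(3)
      by (intro binj[OF blkX(1)[OF de(1)] blkX(1)[OF de(2)]]) (auto simp: pos_def)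
    then show ?thesis using blkX(2) de by metis
  qed
  have pos_opp: "pos (opp W d) = (\<kappa> d, x)" if "d \<in> ?X" "\<mu> d = Cil x" for d x
    using that oo by (simp add: pos_def)
  have pos_bij: "bij_betw pos (blk W) (K \<times> \<Omega>)"
  proof (rule bij_betwI')
    fix a assume a: "a \<in> K \<times> \<Omega>"
    then obtain d where d: "d \<in> ?X" "\<kappa> d = fst a" "\<mu> d = Cil (snd a)" using bsurj[of "fst a" "Cil (snd a)"] by auto
    then have "opp W d \<in> blk W" "pos (opp W d) = a" using Cil_iff pos_opp[OF d(1,3)] by auto
    then show "\<exists>d\<in>blk W. a = pos d" by (metis)
  qed (use pos_in pos_inj in blast)+
  \<comment> \<open>The unciliated rotation is recorded on darts, and as \<tau> on positions. The
    actual rotation will be a closing of the former, \<open>clo\<close> is one of the latter, and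
    uniqueness identifies them along \<open>pos\<close>.\<close>
  define \<tau>W where "\<tau>W = {(d, rot W d) | d. d \<in> blk W - cil W}"
  define \<tau> where "\<tau> = {(pos d, pos (rot W d)) | d. d \<in> blk W - cil W}"
  have rinj: "rot W d = rot W e \<Longrightarrow> d = e" for d e using permutes_inj[OF rot] by (auto dest: injD)
  have rb: "rot W d \<in> blk W" if "d \<in> blk W" for d using rblk that by blast
  have piW: "partial_inj (blk W) \<tau>W"
    using finite_subset[OF blk fin] rb rinj by (auto simp: partial_inj_def \<tau>W_def single_valued_def)
  have pi: "partial_inj (K \<times> \<Omega>) \<tau>"
  proof -
    have "finite (K \<times> \<Omega>)" using pos_bij finite_subset[OF blk fin] bij_betw_finite by blast
    moreover have "\<tau> \<subseteq> (K \<times> \<Omega>) \<times> (K \<times> \<Omega>)" unfolding \<tau>_def using pos_in rb by blast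
    moreover have "single_valued \<tau>"
    proof (rule single_valuedI)
      fix a b b' assume "(a, b) \<in> \<tau>" "(a, b') \<in> \<tau>"
      then obtain d e where "a = pos d" "b = pos (rot W d)" "d \<in> blk W" "a = pos e" "b' = pos (rot W e)" "e \<in> blk W"
        unfolding \<tau>_def by blast
      then show "b = b'" using pos_inj by metis
    qed
    moreover have "single_valued (\<tau>\<inverse>)"
    proof (rule single_valuedI)
      fix a b b' assume "(a, b) \<in> \<tau>\<inverse>" "(a, b') \<in> \<tau>\<inverse>"
      then obtain d e where "b = pos d" "a = pos (rot W d)" "d \<in> blk W" "b' = pos e" "a = pos (rot W e)" "e \<in> blk W"
        unfolding \<tau>_def by blast
      then show "b = b'" using pos_inj rinj rb by metis
    qed
    ultimately show ?thesis by (simp add: partial_inj_def)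
  qed
  let ?\<sigma> = "perm_restrict (rot W) (blk W)"
  have orb: "orbit ?\<sigma> d = orbit (rot W) d" if "d \<in> blk W" for d
    by (rule orbit_cong0[of _ "blk W"]) (use that rb in \<open>auto simp: perm_restrict_def\<close>)
  \<comment> \<open>Here the condition of at most one cilium per black vertex enters: it is the
    orbit clause of \<open>closing\<close>.\<close>
  have "closing (blk W) \<tau>W ?\<sigma>"
  proof -
    have "bij_betw ?\<sigma> (blk W) (blk W)"
    proof -
      have "inj_on ?\<sigma> (blk W)" using rinj by (auto simp: inj_on_def perm_restrict_def)
      moreover have "?\<sigma> ` blk W \<subseteq> blk W" using rb by (auto simp: perm_restrict_def)
      ultimately show ?thesis using finite_subset[OF blk fin] by (simp add: bij_betw_def endo_inj_surj)
    qed
    then have "?\<sigma> permutes blk W" by (rule bij_imp_permutes) (simp add: perm_restrict_def)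
    moreover have "blk W - Domain \<tau>W = cil W" using cil by (auto simp: \<tau>W_def)
    ultimately show ?thesis
      using cil1 orb cil unfolding closing_def by (auto simp: \<tau>W_def perm_restrict_def)
  qed
  moreover have pos_tau: "(d, e) \<in> \<tau>W \<longleftrightarrow> (pos d, pos e) \<in> \<tau>" if de: "d \<in> blk W" "e \<in> blk W" for d e
  proof
    assume "(pos d, pos e) \<in> \<tau>"
    then obtain s where s: "pos d = pos s" "pos e = pos (rot W s)" "s \<in> blk W - cil W" unfolding \<tau>_def by blast
    then have "d = s" "e = rot W s" using pos_inj de rb by (metis DiffE)+
    then show "(d, e) \<in> \<tau>W" using s by (simp add: \<tau>W_def)
  qed (auto simp: \<tau>W_def \<tau>_def)
  ultimately have "pos (?\<sigma> d) = clo K \<tau> (pos d)" if "d \<in> blk W" for d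
    using closing_intertwine[OF _ piW closing_clo[OF pi] pi pos_bij] that by blast
  then have pos_rot: "pos (rot W d) = clo K \<tau> (pos d)" if "d \<in> blk W" for d
    using that by (simp add: perm_restrict_def)
  have pos_cil: "d \<in> cil W \<longleftrightarrow> pos d \<notin> Domain \<tau>" if d: "d \<in> blk W" for d
  proof -
    have "pos d \<in> Domain \<tau> \<longleftrightarrow> (\<exists>s\<in>blk W - cil W. pos d = pos s)" unfolding \<tau>_def by blast
    then show ?thesis using pos_inj d cil by (metis DiffD1 DiffD2 DiffI)
  qed
  \<comment> \<open>The label is prescribed as the union of the colors around the blue end;
    transported by \<mu>, this union becomes \<open>cols\<close>.\<close>
  have lab_blk: "lab W d = cols (snd (pos d))" if d: "d \<in> blk W" for d
  proof -
    let ?e = "opp W d"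
    have e: "?e \<in> ?X" using blkX d by blast
    have "\<mu> ` orbit (rot W) ?e = orbit (rot M) (\<mu> ?e)"
      by (rule orbit_image_semiconj[where Y = ?X]) (use e rX \<mu>rot in auto)
    moreover have "orbit (rot W) ?e \<subseteq> ?X"
    proof
      fix y assume "y \<in> orbit (rot W) ?e"
      then show "y \<in> ?X" by induction (use e rX in auto)
    qed
    then have "(\<Union>y\<in>orbit (rot W) ?e. lab ?N y) = (\<Union>y\<in>orbit (rot W) ?e. hedge_label (\<mu> y))"
      using \<mu>lab by (intro SUP_cong) auto
    ultimately have "lab W d = (\<Union>h\<in>orbit (rot M) (\<mu> ?e). hedge_label h)"
      using labb[OF d] by (metis image_image)
    then show ?thesis
      using pos_Cil[OF d] rot_M_orbit Union_labels by simp
  qed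
  define c where "c d = (if d \<in> blk W then Inr (pos d) else Inl (\<kappa> d, \<mu> d))" for d
  have "map_iso c W (std_map K \<tau>)"
  proof -
    have "bij_betw c (darts W) (darts (std_map K \<tau>))"
    proof (rule bij_betwI')
      fix d e assume "d \<in> darts W" "e \<in> darts W"
      then show "(c d = c e) = (d = e)" using pos_inj binj by (auto simp: c_def)
    next
      fix d assume d: "d \<in> darts W"
      then show "c d \<in> darts (std_map K \<tau>)" using pos_in[of d] \<mu>M[of d] by (auto simp: c_def K_def)
    next
      fix y assume "y \<in> darts (std_map K \<tau>)"
      then consider k h where "y = Inl (k, h)" "k \<in> K" "h \<in> darts M" | a where "y = Inr a" "a \<in> K \<times> \<Omega>" by auto
      then show "\<exists>d\<in>darts W. y = c d"
      proof cases
        case 1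
        then obtain d where "d \<in> ?X" "\<kappa> d = k" "\<mu> d = h" using bsurj by blast
        then show ?thesis using 1 by (intro bexI[of _ d]) (auto simp: c_def)
      next
        case 2
        then have "a \<in> pos ` blk W" using pos_bij by (simp add: bij_betw_def)
        then obtain d where "d \<in> blk W" "pos d = a" by blast
        then show ?thesis using 2 blk by (intro bexI[of _ d]) (auto simp: c_def)
      qed
    qed
    moreover have "c (rot W d) = rot (std_map K \<tau>) (c d) \<and> c (opp W d) = opp (std_map K \<tau>) (c d) \<and>
        lab (std_map K \<tau>) (c d) = lab W d" if d: "d \<in> darts W" for d
    proof (cases "d \<in> blk W")
      case True
      have "opp (std_map K \<tau>) (Inr (pos d)) = Inl (\<kappa> (opp W d), \<mu> (opp W d))"
        using pos_Cil(1)[OF True] by (simp add: pos_def)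
      moreover have "lab (std_map K \<tau>) (Inr (pos d)) = lab W d"
        using lab_blk[OF True] by (simp add: pos_def)
      ultimately show ?thesis using True rb oblk pos_rot by (simp add: c_def)
    next
      case False
      then have dX: "d \<in> ?X" using d by simp
      have r: "c (rot W d) = rot (std_map K \<tau>) (c d)" using rX[OF dX] False \<kappa>rot[OF dX] \<mu>rot[OF dX] by (simp add: c_def)
      show ?thesis
      proof (cases "\<exists>x. \<mu> d = Cil x")
        case True
        then obtain x where x: "\<mu> d = Cil x" by blast
        have "opp W d \<in> blk W" using Cil_iff[OF dX] True by blast
        moreover have "lab W d = cols x"
          using lo[OF d] lab_blk[OF calculation] pos_opp[OF dX x] by simp
        ultimately show ?thesis using r False x pos_opp[OF dX x] by (simp add: c_def)
      next
        case nC: False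
        then have nb: "opp W d \<notin> blk W" using Cil_iff[OF dX] by blast
        have "\<mu> (opp W d) = opp M (\<mu> d)" "lab W d = hedge_label (\<mu> d)"
          using \<mu>opp[OF dX] \<mu>lab[OF dX] oppN[OF dX] labN[of d] nb by auto
        then show ?thesis using r False nb nC \<kappa>opp[OF dX nb] by (simp add: c_def std_map_not_Cil)
      qed
    qed
    ultimately show ?thesis by (simp add: map_iso_def)
  qed
  moreover have "c ` blk W = Inr ` (K \<times> \<Omega>)"
  proof -
    have "c ` blk W = Inr ` pos ` blk W" by (force simp: c_def image_image)
    then show ?thesis using pos_bij by (simp add: bij_betw_def)
  qed
  moreover have "c ` cil W = Inr ` (K \<times> \<Omega> - Domain \<tau>)"
  proof -
    have "cil W = {d \<in> blk W. pos d \<notin> Domain \<tau>}" using pos_cil cil by blast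
    then have "pos ` cil W = pos ` blk W - Domain \<tau>" by auto
    then have "pos ` cil W = K \<times> \<Omega> - Domain \<tau>" using pos_bij by (simp add: bij_betw_def)
    moreover have "c ` cil W = Inr ` pos ` cil W" using cil by (force simp: c_def image_image)
    ultimately show ?thesis by simp
  qed
  ultimately have "coded_map W \<mu> K \<tau> c"
    using pi rot opp blk cil by (simp add: coded_map_def walsh_iso_def c_def)
  then show ?thesis by blast
qed

text \<open>Reads the code off the map itself, as its rotation at corners without cilium, and so
  makes it independent of the coordinates.\<close>

lemma cm_tau_iff:
  assumes cm: "coded_map W \<mu> K \<tau> c" and st: "s \<in> blk W" "t \<in> blk W"
  shows "(mpos c s, mpos c t) \<in> \<tau> \<longleftrightarrow> s \<notin> cil W \<and> rot W s = t"
proof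
  assume *: "(mpos c s, mpos c t) \<in> \<tau>"
  then have "mpos c (rot W s) = mpos c t"
    using cm_rot_black(2)[OF cm st(1)] clo_tau[OF cm_partial_inj[OF cm]] by simp
  then show "s \<notin> cil W \<and> rot W s = t"
    using * cm_cil_iff[OF cm st(1)] cm_mpos_inj[OF cm cm_rot_black(1)[OF cm st(1)] st(2)] by blast
next
  assume *: "s \<notin> cil W \<and> rot W s = t"
  then obtain b where "(mpos c s, b) \<in> \<tau>" using cm_cil_iff[OF cm st(1)] by blast
  then show "(mpos c s, mpos c t) \<in> \<tau>"
    using * cm_rot_black(2)[OF cm st(1)] clo_tau[OF cm_partial_inj[OF cm]] by metis
qed

lemma coded_map_unique:
  assumes W: "coded_map W \<mu> K \<tau> c" and W': "coded_map W \<mu> K' \<tau>' c'"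
  obtains h where "bij_betw h K K'"
    "\<And>k l x y. \<lbrakk>k \<in> K; l \<in> K; x \<in> \<Omega>; y \<in> \<Omega>\<rbrakk> \<Longrightarrow> ((k, x), (l, y)) \<in> \<tau> \<longleftrightarrow> ((h k, x), (h l, y)) \<in> \<tau>'"
proof -
  let ?X = "darts W - blk W"
  have iff: "mkap c u = mkap c v \<longleftrightarrow> mkap c' u = mkap c' v" if "u \<in> ?X" "v \<in> ?X" for u v
    using cm_component[OF W, of u v] cm_component[OF W', of u v] that by auto
  define h where "h k = mkap c' (SOME v. v \<in> ?X \<and> mkap c v = k)" for k
  have h: "h (mkap c v) = mkap c' v" if v: "v \<in> ?X" for v
  proof -
    let ?u = "SOME u. u \<in> ?X \<and> mkap c u = mkap c v"
    have "?u \<in> ?X \<and> mkap c ?u = mkap c v" by (rule someI[of _ v]) (use v in simp)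
    then show ?thesis using iff[of ?u v] v unfolding h_def by blast
  qed
  have ex: "\<exists>u\<in>?X. mkap c u = k" if "k \<in> K" for k using cm_mcopy_ex[OF W that] by blast
  have ex': "\<exists>u\<in>?X. mkap c' u = k" if "k \<in> K'" for k using cm_mcopy_ex[OF W' that] by blast
  have "bij_betw h K K'"
  proof (rule bij_betwI')
    fix k l assume "k \<in> K" "l \<in> K"
    then obtain u v where "u \<in> ?X" "mkap c u = k" "v \<in> ?X" "mkap c v = l" using ex by metis
    then show "(h k = h l) = (k = l)" using h iff by metis
  next
    fix k assume "k \<in> K"
    then obtain u where "u \<in> ?X" "mkap c u = k" using ex by metis
    then show "h k \<in> K'" using h[of u] cm_blue(2)[OF W', of u] by auto
  next
    fix k' assume "k' \<in> K'"
    then obtain u where "u \<in> ?X" "mkap c' u = k'" using ex' by metis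
    then show "\<exists>k\<in>K. k' = h k" using h[of u] cm_blue(2)[OF W, of u] by (intro bexI[of _ "mkap c u"]) auto
  qed
  moreover have "((k, x), (l, y)) \<in> \<tau> \<longleftrightarrow> ((h k, x), (h l, y)) \<in> \<tau>'"
    if kl: "k \<in> K" "l \<in> K" "x \<in> \<Omega>" "y \<in> \<Omega>" for k l x y
  proof -
    \<comment> \<open>Both positions are read at the blue end of the same edge, where \<mu> gives
      the same pair and the copy numbers differ by \<open>h\<close>.\<close>
    have pos': "mpos c' s = (h (fst (mpos c s)), snd (mpos c s))" if s: "s \<in> blk W" for s
      using cm_opp_black[OF W s] cm_opp_black[OF W' s] h[of "opp W s"] by (auto intro: prod_eqI)
    obtain s where s: "s \<in> blk W" "mpos c s = (k, x)" using cm_mpos_surj[OF W, of "(k, x)"] kl by auto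
    obtain t where t: "t \<in> blk W" "mpos c t = (l, y)" using cm_mpos_surj[OF W, of "(l, y)"] kl by auto
    show ?thesis
      using cm_tau_iff[OF W s(1) t(1)] cm_tau_iff[OF W' s(1) t(1)] pos'[OF s(1)] pos'[OF t(1)] s t by simp
  qed
  ultimately show ?thesis using that by blast
qed

section \<open>Automorphisms\<close>

lemma nb_not_cols: assumes "i \<notin> cols x" shows "nb i x = x"
proof (cases "i \<in> {1..D}")
  case True
  then show ?thesis using assms by (simp add: cols_def)
qed (auto simp: nb_def)

context
  fixes g :: "'v set hedge \<Rightarrow> 'v set hedge"
  assumes g: "map_iso g M M"
begin

definition auto_pair :: "'v set \<Rightarrow> 'v set" where "auto_pair x = base (g (Cil x))"

lemma auto_simps:
  shows auto_in: "d \<in> darts M \<Longrightarrow> g d \<in> darts M" and auto_inj: "d \<in> darts M \<Longrightarrow> e \<in> darts M \<Longrightarrow> g d = g e \<Longrightarrow> d = e"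
    and auto_rot: "d \<in> darts M \<Longrightarrow> g (rot M d) = rot M (g d)"
    and auto_opp: "d \<in> darts M \<Longrightarrow> g (opp M d) = opp M (g d)"
    and auto_label: "d \<in> darts M \<Longrightarrow> hedge_label (g d) = hedge_label d"
  using g by (auto simp: map_iso_def bij_betw_def dest: inj_onD)

text \<open>Cilia are the fixed points of the involution, which \<open>g\<close> respects in both
  directions by injectivity.\<close>

lemma auto_Cil_iff: assumes "d \<in> darts M" shows "(\<exists>x. g d = Cil x) \<longleftrightarrow> (\<exists>x. d = Cil x)"
  using assms opp_M_fix auto_in auto_opp auto_inj opp_M_in by metis

lemma auto_Cil: assumes "x \<in> \<Omega>" shows "g (Cil x) = Cil (auto_pair x)" "auto_pair x \<in> \<Omega>"
proof -
  obtain y where "g (Cil x) = Cil y" using auto_Cil_iff[of "Cil x"] assms by auto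
  then show "g (Cil x) = Cil (auto_pair x)" "auto_pair x \<in> \<Omega>" using auto_in[of "Cil x"] assms by (auto simp: auto_pair_def)
qed

lemma auto_around: assumes "x \<in> \<Omega>" shows "g ` set (around os is x) = set (around os is (auto_pair x))"
proof -
  have "g ` orbit (rot M) (Cil x) = orbit (rot M) (g (Cil x))"
    by (rule orbit_image_semiconj[where Y = "darts M"]) (use assms rot_M_darts auto_rot in auto)
  then show ?thesis using rot_M_orbit assms auto_Cil by simp
qed

lemma auto_cols: assumes "x \<in> \<Omega>" shows "cols (auto_pair x) = cols x"
proof -
  have sub: "set (around os is x) \<subseteq> darts M" using assms darts_M by auto
  have "cols (auto_pair x) = (\<Union>d\<in>g ` set (around os is x). hedge_label d)"
    using Union_labels[OF auto_Cil(2)[OF assms]] auto_around[OF assms] by simp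
  also have "\<dots> = (\<Union>d\<in>set (around os is x). hedge_label d)"
    using sub auto_label by (simp add: image_image subset_iff)
  finally show ?thesis using Union_labels[OF assms] by simp
qed

lemma auto_base: assumes "d \<in> darts M" shows "base (g d) = auto_pair (base d)"
proof -
  have "base d \<in> \<Omega>" "d \<in> set (around os is (base d))" using base_darts assms by auto
  then have "g d \<in> set (around os is (auto_pair (base d)))" using auto_around by blast
  then show ?thesis by (rule base_around)
qed

text \<open>Cilia go to cilia and \<open>g\<close> commutes with the rotation, so positions counted
  clockwise from the cilium are preserved.\<close>

lemma auto_nth: assumes "x \<in> \<Omega>" "j < length (around os is x)"
  shows "g (around os is x ! j) = around os is (auto_pair x) ! j"
  using assms(2)
proof (induction j)
  case 0
  then show ?case using auto_Cil assms(1) by (simp add: around_0)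
next
  case (Suc j)
  have len: "length (around os is (auto_pair x)) = length (around os is x)"
    using length_around(1) auto_cols auto_Cil assms(1) by simp
  have "around os is x ! j \<in> set (around os is x)" using Suc by auto
  then have "around os is x ! j \<in> darts M" using darts_M assms(1) by blast
  then have "g (rot M (around os is x ! j)) = rot M (around os is (auto_pair x) ! j)"
    using auto_rot Suc by simp
  then show ?case
    using rot_M_nth[OF assms(1), of j] rot_M_nth[OF auto_Cil(2)[OF assms(1)], of j] len Suc by simp
qed

text \<open>The first half of the positions after the cilium belongs to outgoing edges, and both
  vertices have the same number of them because \<open>auto_cols\<close> equates their colors. The
  color itself is preserved as a label.\<close>

lemma auto_Out: assumes "x \<in> \<Omega>" "i \<in> cols x" shows "g (Out i x) = Out i (auto_pair x)"
proof -
  have Out: "around os is y ! Suc j = Out (os y ! j) y" if "j < length (os y)" for y j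
    using that by (simp add: around_def nth_append)
  obtain j where j: "j < length (os x)" "os x ! j = i"
    using assms orders_cols(2)[OF assms(1)] by (metis in_set_conv_nth)
  have "Suc j < length (around os is x)" using j by (simp add: around_def)
  then have "g (Out i x) = around os is (auto_pair x) ! Suc j" using auto_nth[OF assms(1)] Out[OF j(1)] j(2) by metis
  moreover have "j < length (os (auto_pair x))" using j length_around(2) auto_cols auto_Cil assms(1) by simp
  ultimately have eq: "g (Out i x) = Out (os (auto_pair x) ! j) (auto_pair x)" using Out by simp
  have "hedge_label (g (Out i x)) = {i}" using auto_label assms by simp
  then show ?thesis using eq by simp
qed

text \<open>For a color at \<open>x\<close>, the opposite half of the outgoing edge is based at
  \<open>nb i x\<close>, and \<open>g\<close> respects opposite halves and bases. Other colors fix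
  both pairs.\<close>

lemma auto_nb: assumes "x \<in> \<Omega>" shows "auto_pair (nb i x) = nb i (auto_pair x)"
proof (cases "i \<in> cols x")
  case True
  have "Out i x \<in> darts M" using True assms by simp
  then have "g (Inc i (nb i x)) = opp M (Out i (auto_pair x))"
    using auto_opp[of "Out i x"] auto_Out[OF assms True] opp_M(2)[OF assms True] by simp
  then have "g (Inc i (nb i x)) = Inc i (nb i (auto_pair x))" using True auto_cols auto_Cil assms by simp
  moreover have "Inc i (nb i x) \<in> darts M" using True assms nb_in cols_nb by simp
  ultimately show ?thesis using auto_base[of "Inc i (nb i x)"] by simp
next
  case False
  then have "nb i x = x" "nb i (auto_pair x) = auto_pair x"
    using auto_cols[OF assms] nb_not_cols by auto
  then show ?thesis by simp
qed

text \<open>The induced permutation of the pairs commutes with every \<open>nb i\<close>. By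
  \<open>cedges_B_iff\<close>, letting it act on white and on black vertices through their pairs
  preserves edges.\<close>

lemma auto_induced: "\<exists>a. graph_iso a B B \<and> (\<forall>x\<in>\<Omega>. g (Cil x) = Cil (a ` x))"
proof -
  have inj: "auto_pair x = auto_pair y \<Longrightarrow> x = y" if "x \<in> \<Omega>" "y \<in> \<Omega>" for x y
    using auto_inj[of "Cil x" "Cil y"] auto_Cil that by simp
  have surj: "\<exists>x\<in>\<Omega>. auto_pair x = y" if "y \<in> \<Omega>" for y
  proof -
    have "inj_on auto_pair \<Omega>" "auto_pair ` \<Omega> \<subseteq> \<Omega>" using inj auto_Cil by (auto simp: inj_on_def)
    then have "auto_pair ` \<Omega> = \<Omega>" using finite_Omega by (simp add: endo_inj_surj)
    then show ?thesis using that by (metis imageE)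
  qed
  define a where "a v = (if v \<in> white B then wh (auto_pair (pr v)) else bl (auto_pair (pr v)))" for v
  have w: "a v \<in> white B" "pr (a v) = auto_pair (pr v)" if "v \<in> white B" for v
    using that pair_eq(1) auto_Cil(2) pr_in by (auto simp: a_def verts_cases)
  have b: "a v \<in> black B" "pr (a v) = auto_pair (pr v)" if "v \<in> black B" for v
  proof -
    have "v \<notin> white B" using that B_bip by blast
    then show "a v \<in> black B" "pr (a v) = auto_pair (pr v)"
      using that pair_eq(2) auto_Cil(2) pr_in by (auto simp: a_def verts_cases)
  qed
  have ax: "a ` x = auto_pair x" if x: "x \<in> \<Omega>" for x
  proof -
    have wb: "wh x \<in> white B" "bl x \<in> black B" using pair_eq x by auto
    then have "a (wh x) = wh (auto_pair x)" "a (bl x) = bl (auto_pair x)"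
      using w[of "wh x"] b[of "bl x"] x by (metis wh_pr pr_wh_bl(1), metis bl_pr pr_wh_bl(2))
    then have "a ` {wh x, bl x} = {wh (auto_pair x), bl (auto_pair x)}" by simp
    then show ?thesis using pair_eq(3)[OF x] pair_eq(3)[OF auto_Cil(2)[OF x]] by simp
  qed
  have "graph_iso a B B"
  proof -
    have aw: "a ` white B = white B"
    proof
      show "white B \<subseteq> a ` white B"
      proof
        fix v assume v: "v \<in> white B"
        then obtain x where x: "x \<in> \<Omega>" "auto_pair x = pr v" using surj pr_in by (metis verts_cases)
        then have "a (wh x) = v" "wh x \<in> white B" using v pair_eq(1) by (auto simp: a_def)
        then show "v \<in> a ` white B" by (metis image_eqI)
      qed
    qed (use w in auto)
    have ab: "a ` black B = black B"
    proof
      show "black B \<subseteq> a ` black B"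
      proof
        fix v assume v: "v \<in> black B"
        then obtain x where x: "x \<in> \<Omega>" "auto_pair x = pr v" using surj pr_in by (metis verts_cases)
        then have bx: "bl x \<in> black B" using pair_eq(2) by blast
        then have "pr (a (bl x)) = pr v" using b x by simp
        then have "a (bl x) = v" using b[OF bx] v by (metis bl_pr)
        then show "v \<in> a ` black B" using bx by (metis image_eqI)
      qed
    qed (use b in auto)
    have "a ` verts B = verts B" using aw ab by (simp add: verts_def image_Un)
    then have "bij_betw a (verts B) (verts B)"
      using B_bip(1) by (simp add: bij_betw_def eq_card_imp_inj_on)
    moreover have "(i, u, v) \<in> cedges B \<longleftrightarrow> (i, a u, a v) \<in> cedges B"
      if uv: "u \<in> white B" "v \<in> black B" for i u v
    proof -
      have pu: "pr u \<in> \<Omega>" "pr v \<in> \<Omega>" using uv pr_in by (auto simp: verts_cases)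
      have "pr v = nb i (pr u) \<longleftrightarrow> auto_pair (pr v) = auto_pair (nb i (pr u))" using inj nb_in pu by metis
      then show ?thesis using uv w[OF uv(1)] b[OF uv(2)] auto_nb[OF pu(1)] by (simp add: cedges_B_iff)
    qed
    ultimately show ?thesis using aw ab by (simp add: graph_iso_def)
  qed
  then show ?thesis using auto_Cil(1) ax by (intro exI[of _ a]) simp
qed

end

text \<open>Companion of \<open>std_graph_iso\<close>. Blue darts move by \<open>g\<close>, black
  ones by the action of \<open>a\<close> on pairs; the condition on \<open>Cil\<close> makes the two
  motions agree across black-blue edges.\<close>

lemma std_map_iso:
  assumes pi: "partial_inj (K \<times> \<Omega>) \<tau>" and pi': "partial_inj (K' \<times> \<Omega>) \<tau>'"
    and h: "bij_betw h K K'" and g: "\<And>k. k \<in> K \<Longrightarrow> map_iso (g k) M M"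
    and Cil: "\<And>k x. k \<in> K \<Longrightarrow> x \<in> \<Omega> \<Longrightarrow> g k (Cil x) = Cil (a k ` x)"
    and iff: "\<And>k l x y. \<lbrakk>k \<in> K; l \<in> K; x \<in> \<Omega>; y \<in> \<Omega>\<rbrakk> \<Longrightarrow>
      ((k, x), (l, y)) \<in> \<tau> \<longleftrightarrow> ((h k, a k ` x), (h l, a l ` y)) \<in> \<tau>'"
  shows "walsh_iso (\<lambda>d. case d of Inl (k, d) \<Rightarrow> Inl (h k, g k d) | Inr (k, x) \<Rightarrow> Inr (h k, a k ` x))
    (std_map K \<tau>) (std_map K' \<tau>')" (is "walsh_iso ?F ?S ?S'")
proof -
  define f where "f = (\<lambda>(k, x). (h k, a k ` x))"
  have F [simp]: "?F (Inl (k, d)) = Inl (h k, g k d)" "?F (Inr b) = Inr (f b)" for k d b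
    by (auto simp: f_def split: prod.split)
  have hK: "h k \<in> K'" if "k \<in> K" for k using h bij_betwE that by blast
  have hinj: "k = l" if "k \<in> K" "l \<in> K" "h k = h l" for k l using h that by (auto simp: bij_betw_def dest: inj_onD)
  have hsurj: "\<exists>k\<in>K. k' = h k" if "k' \<in> K'" for k' using h that by (auto simp: bij_betw_def)
  have a\<Omega>: "a k ` x \<in> \<Omega>" if "k \<in> K" "x \<in> \<Omega>" for k x
    using auto_in[OF g[OF that(1)], of "Cil x"] Cil that by simp
  have ainj: "x = y" if "k \<in> K" "x \<in> \<Omega>" "y \<in> \<Omega>" "a k ` x = a k ` y" for k x y
    using auto_inj[OF g[OF that(1)], of "Cil x" "Cil y"] Cil that by simp
  have asurj: "\<exists>x\<in>\<Omega>. a k ` x = y" if ky: "k \<in> K" "y \<in> \<Omega>" for k y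
  proof -
    have "inj_on ((`) (a k)) \<Omega>" by (rule inj_onI) (use ainj ky in blast)
    moreover have "(`) (a k) ` \<Omega> \<subseteq> \<Omega>" using a\<Omega>[OF ky(1)] by (rule image_subsetI)
    ultimately have "(`) (a k) ` \<Omega> = \<Omega>" using finite_Omega by (simp add: endo_inj_surj)
    then show ?thesis using ky by (metis imageE)
  qed
  have fbij: "bij_betw f (K \<times> \<Omega>) (K' \<times> \<Omega>)"
  proof (rule bij_betwI')
    fix b d assume "b \<in> K \<times> \<Omega>" "d \<in> K \<times> \<Omega>"
    then show "(f b = f d) = (b = d)"
      using hinj[of "fst b" "fst d"] ainj[of "fst b" "snd b" "snd d"]
      by (auto simp: f_def case_prod_beta mem_Times_iff intro: prod_eqI)
  next
    fix b assume "b \<in> K \<times> \<Omega>"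
    then show "f b \<in> K' \<times> \<Omega>" using hK a\<Omega> by (auto simp: f_def)
  next
    fix b assume "b \<in> K' \<times> \<Omega>"
    then obtain k' y where b: "b = (k', y)" "k' \<in> K'" "y \<in> \<Omega>" by blast
    obtain k where k: "k \<in> K" "k' = h k" using hsurj b by blast
    obtain x where "x \<in> \<Omega>" "a k ` x = y" using asurj k b by blast
    then show "\<exists>d\<in>K \<times> \<Omega>. b = f d" using k b by (intro bexI[of _ "(k, x)"]) (auto simp: f_def)
  qed
  have fiff: "(b, d) \<in> \<tau> \<longleftrightarrow> (f b, f d) \<in> \<tau>'" if "b \<in> K \<times> \<Omega>" "d \<in> K \<times> \<Omega>" for b d
    using iff that by (auto simp: f_def)
  \<comment> \<open>The hypothesis on \<tau> speaks only of unciliated corners; uniqueness of the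
    closing extends it to the whole black rotation.\<close>
  have fclo: "f (clo K \<tau> b) = clo K' \<tau>' (f b)" if "b \<in> K \<times> \<Omega>" for b
    by (rule closing_intertwine[OF closing_clo[OF pi] pi closing_clo[OF pi'] pi' fbij fiff that])
  have fDom: "f b \<in> Domain \<tau>' \<longleftrightarrow> b \<in> Domain \<tau>" if b: "b \<in> K \<times> \<Omega>" for b
  proof
    assume "f b \<in> Domain \<tau>'"
    then obtain d' where d': "(f b, d') \<in> \<tau>'" by blast
    then have "d' \<in> f ` (K \<times> \<Omega>)" using fbij partial_injD(3)[OF pi'] by (auto simp: bij_betw_def)
    then show "b \<in> Domain \<tau>" using d' fiff b by blast
  next
    assume "b \<in> Domain \<tau>"
    then show "f b \<in> Domain \<tau>'" using fiff b partial_injD(3)[OF pi] by blast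
  qed
  have cols_a: "cols (a k ` x) = cols x" if "k \<in> K" "x \<in> \<Omega>" for k x
    using auto_cols[OF g[OF that(1)] that(2)] auto_Cil(1)[OF g[OF that(1)] that(2)] Cil that by simp
  have "bij_betw ?F (darts ?S) (darts ?S')"
  proof (rule bij_betwI')
    fix d e assume de: "d \<in> darts ?S" "e \<in> darts ?S"
    show "(?F d = ?F e) = (d = e)"
    proof (cases d; cases e)
      fix y z assume "d = Inl y" "e = Inl z"
      then obtain k u l v where "d = Inl (k, u)" "e = Inl (l, v)" "k \<in> K" "l \<in> K" "u \<in> darts M" "v \<in> darts M"
        using de by auto
      then show ?thesis using hinj[of k l] auto_inj[OF g, of k u v] by auto
    next
      fix y z assume yz: "d = Inr y" "e = Inr z"
      then have "y \<in> K \<times> \<Omega>" "z \<in> K \<times> \<Omega>" using de by auto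
      then have "f y = f z \<longleftrightarrow> y = z" using fbij inj_on_eq_iff by (metis bij_betw_def)
      then show ?thesis unfolding yz F by simp
    qed (use F in \<open>auto split: prod.splits\<close>)
  next
    fix d assume "d \<in> darts ?S"
    then consider k u where "d = Inl (k, u)" "k \<in> K" "u \<in> darts M" | b where "d = Inr b" "b \<in> K \<times> \<Omega>" by auto
    then show "?F d \<in> darts ?S'"
    proof cases
      case 1
      then show ?thesis using hK auto_in[OF g] by simp
    next
      case 2
      then have "f b \<in> K' \<times> \<Omega>" using fbij bij_betwE by blast
      then show ?thesis using 2 unfolding 2(1) F by simp
    qed
  next
    fix d assume "d \<in> darts ?S'"
    then consider k' u where "d = Inl (k', u)" "k' \<in> K'" "u \<in> darts M" | b where "d = Inr b" "b \<in> K' \<times> \<Omega>" by auto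
    then show "\<exists>e\<in>darts ?S. d = ?F e"
    proof cases
      case 1
      obtain k where k: "k \<in> K" "k' = h k" using hsurj 1 by blast
      have "u \<in> g k ` darts M" using g[OF k(1)] 1 by (simp add: map_iso_def bij_betw_def)
      then obtain v where "v \<in> darts M" "u = g k v" by blast
      then show ?thesis using 1 k by (intro bexI[of _ "Inl (k, v)"]) auto
    next
      case 2
      then have "b \<in> f ` (K \<times> \<Omega>)" using fbij by (simp add: bij_betw_def)
      then obtain e where e: "e \<in> K \<times> \<Omega>" "b = f e" by blast
      then have "d = ?F (Inr e)" unfolding F 2 by simp
      moreover have "Inr e \<in> darts ?S" using e by simp
      ultimately show ?thesis by (rule bexI)
    qed
  qed
  moreover have "?F (rot ?S d) = rot ?S' (?F d) \<and> ?F (opp ?S d) = opp ?S' (?F d) \<and> lab ?S' (?F d) = lab ?S d"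
    if d: "d \<in> darts ?S" for d
  proof -
    consider k u where "d = Inl (k, u)" "k \<in> K" "u \<in> darts M" | b where "d = Inr b" "b \<in> K \<times> \<Omega>" using d by auto
    then show ?thesis
    proof cases
      case 1
      have r: "?F (rot ?S d) = rot ?S' (?F d)" using 1 auto_rot[OF g] by simp
      show ?thesis
      proof (cases "\<exists>x. u = Cil x")
        case True
        then obtain x where x: "u = Cil x" "x \<in> \<Omega>" using 1 by auto
        have "?F (opp ?S d) = opp ?S' (?F d)" using 1 x Cil by simp
        moreover have "lab ?S' (?F d) = lab ?S d" using 1 x Cil cols_a by simp
        ultimately show ?thesis using r by blast
      next
        case False
        then have F': "\<nexists>x. g k u = Cil x" using auto_Cil_iff[OF g[OF 1(2)] 1(3)] by simp
        have "?F (opp ?S d) = opp ?S' (?F d)"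
          using 1 auto_opp[OF g] std_map_not_Cil(1)[OF False] std_map_not_Cil(1)[OF F'] by simp
        moreover have "lab ?S' (?F d) = lab ?S d"
          using 1 auto_label[OF g] std_map_not_Cil(2)[OF False] std_map_not_Cil(2)[OF F'] by simp
        ultimately show ?thesis using r by blast
      qed
    next
      case 2
      then obtain k x where b: "b = (k, x)" "k \<in> K" "x \<in> \<Omega>" by blast
      have "?F (rot ?S d) = Inr (f (clo K \<tau> b))" unfolding 2(1) std_map_simps F by simp
      also have "\<dots> = rot ?S' (?F d)" using fclo[OF 2(2)] unfolding 2(1) F by simp
      finally show ?thesis using 2 b Cil cols_a by simp
    qed
  qed
  ultimately have "map_iso ?F ?S ?S'" by (simp add: map_iso_def)
  moreover have im: "?F ` Inr ` Y = Inr ` f ` Y" for Y :: "(nat \<times> 'v set) set"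
    unfolding image_image F ..
  moreover have "f ` (K \<times> \<Omega>) = K' \<times> \<Omega>" using fbij by (simp add: bij_betw_def)
  moreover have "f ` (K \<times> \<Omega> - Domain \<tau>) = K' \<times> \<Omega> - Domain \<tau>'"
  proof -
    have "f ` (K \<times> \<Omega> - Domain \<tau>) = f ` (K \<times> \<Omega>) - Domain \<tau>'" using fDom by blast
    then show ?thesis using fbij by (simp add: bij_betw_def)
  qed
  ultimately show ?thesis unfolding walsh_iso_def std_map_simps by simp
qed

section \<open>Graphs and maps with a common code\<close>

lemma coded_graph_recode:
  assumes "coded_graph G \<theta> K \<tau> c" "partial_inj (K' \<times> \<Omega>) \<tau>'"
    and "graph_iso f (std_graph K \<tau>) (std_graph K' \<tau>')" "\<And>v. v \<in> verts G \<Longrightarrow> snd (f (c v)) = \<theta>' v"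
  shows "coded_graph G \<theta>' K' \<tau>' (f \<circ> c)"
  using assms graph_iso_comp[of c G "std_graph K \<tau>" f] by (simp add: coded_graph_def)

lemma coded_map_recode:
  assumes "coded_map W \<mu> K \<tau> c" "partial_inj (K' \<times> \<Omega>) \<tau>'"
    and "walsh_iso f (std_map K \<tau>) (std_map K' \<tau>')"
    and "\<And>d. d \<in> darts W - blk W \<Longrightarrow> \<exists>k. f (c d) = Inl (k, \<mu>' d)"
  shows "coded_map W \<mu>' K' \<tau>' (f \<circ> c)"
  using assms walsh_iso_comp[of c W "std_map K \<tau>" f] by (simp add: coded_map_def)

lemma coded_graph_iso:
  assumes "coded_graph G \<theta> K \<tau> c" "graph_iso f G' G" "bip_graph {0..D} G'"
    and "\<And>v. v \<in> verts G' \<Longrightarrow> \<theta> (f v) = \<theta>' v"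
  shows "coded_graph G' \<theta>' K \<tau> (c \<circ> f)"
proof -
  have "f v \<in> verts G" if "v \<in> verts G'" for v
    using assms(2) that by (auto simp: graph_iso_def bij_betw_def)
  then show ?thesis using assms graph_iso_comp[of f G' G c] by (simp add: coded_graph_def)
qed

lemma coded_map_iso:
  assumes "coded_map W \<mu> K \<tau> c" "walsh_iso f W' W" "(W', \<mu>') \<in> id_walsh_maps M p"
    and "\<And>d. d \<in> darts W' - blk W' \<Longrightarrow> \<mu> (f d) = \<mu>' d"
  shows "coded_map W' \<mu>' K \<tau> (c \<circ> f)"
proof -
  have W': "rot W' permutes darts W'" "opp W' permutes darts W'" "blk W' \<subseteq> darts W'" "cil W' \<subseteq> blk W'"
    using assms(3) by (auto simp: id_walsh_maps_def walsh_maps_def comb_map_def)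
  have "\<exists>k. c (f d) = Inl (k, \<mu>' d)" if "d \<in> darts W' - blk W'" for d
    using assms(1,4) walsh_iso_blue[OF assms(2) W'(3) that] that unfolding coded_map_def by metis
  then show ?thesis using assms(1) W' walsh_iso_comp[OF assms(2), of c] by (simp add: coded_map_def)
qed

lemma coded_graphs_iso:
  assumes G: "coded_graph G \<theta> K \<tau> c" and G': "coded_graph G' \<theta>' K \<tau> c'"
  shows "\<exists>f. graph_iso f G G' \<and> (\<forall>v\<in>verts G. \<theta>' (f v) = \<theta> v)"
proof -
  let ?i = "inv_into (verts G') c'"
  have iso: "graph_iso c G (std_graph K \<tau>)" "graph_iso c' G' (std_graph K \<tau>)"
    using G G' by (auto simp: coded_graph_def)
  have "graph_iso (?i \<circ> c) G G'" by (rule graph_iso_comp[OF iso(1) graph_iso_inv[OF iso(2)]])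
  moreover have "\<theta>' ((?i \<circ> c) v) = \<theta> v" if v: "v \<in> verts G" for v
  proof -
    have "c v \<in> K \<times> verts B" using bij_betwE[OF cg_bij[OF G]] v by blast
    then have "c' (?i (c v)) = c v" "?i (c v) \<in> verts G'"
      using cg_bij[OF G'] by (auto simp: bij_betw_inv_into_right bij_betw_def inv_into_into)
    then show ?thesis using cg_snd[OF G v] cg_snd[OF G', of "?i (c v)"] by simp
  qed
  ultimately show ?thesis by blast
qed

lemma coded_maps_iso:
  assumes W: "coded_map W \<mu> K \<tau> c" and W': "coded_map W' \<mu>' K \<tau> c'"
  shows "\<exists>f. walsh_iso f W W' \<and> (\<forall>d\<in>darts W - blk W. \<mu>' (f d) = \<mu> d)"
proof -
  let ?i = "inv_into (darts W') c'"
  have iso: "walsh_iso c W (std_map K \<tau>)" "walsh_iso c' W' (std_map K \<tau>)"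
    using W W' by (auto simp: coded_map_def)
  have "walsh_iso ?i (std_map K \<tau>) W'"
    by (rule walsh_iso_inv[OF iso(2)]) (use cm_in[OF W'] cm_blk[OF W'] cm_cil[OF W'] in auto)
  then have f: "walsh_iso (?i \<circ> c) W W'" by (rule walsh_iso_comp[OF iso(1)])
  moreover have "\<mu>' ((?i \<circ> c) d) = \<mu> d" if d: "d \<in> darts W - blk W" for d
  proof -
    have "c d \<in> Inl ` (K \<times> darts M) \<union> Inr ` (K \<times> \<Omega>)" using bij_betwE[OF cm_bij[OF W]] d by blast
    then have "c' (?i (c d)) = c d" by (rule bij_betw_inv_into_right[OF cm_bij[OF W']])
    moreover have "?i (c d) \<in> darts W' - blk W'" using walsh_iso_blue[OF f cm_blk[OF W] d] by simp
    ultimately show ?thesis using cm_blue(1)[OF W, of d] cm_blue(1)[OF W', of "?i (c d)"] d by simp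
  qed
  ultimately show ?thesis by blast
qed

text \<open>The relation that descends to the bijection. Only the existence of a common code is
  asked, since the numbering of the copies is arbitrary on each side.\<close>

definition same_code :: "'a cgraph \<times> ('a \<Rightarrow> 'v) \<Rightarrow> 'd wmap \<times> ('d \<Rightarrow> 'v set hedge) \<Rightarrow> bool" where
  "same_code = (\<lambda>(G, \<theta>) (W, \<mu>). \<exists>K \<tau> c c'. coded_graph G \<theta> K \<tau> c \<and> coded_map W \<mu> K \<tau> c')"

lemma same_codeI: "coded_graph G \<theta> K \<tau> c \<Longrightarrow> coded_map W \<mu> K \<tau> c' \<Longrightarrow> same_code (G, \<theta>) (W, \<mu>)"
  by (auto simp: same_code_def)

text \<open>Two codes of one graph differ by a renumbering; this moves a map sharing the first code
  to the second, with its identification unchanged.\<close>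

lemma coded_map_relabel:
  assumes W: "coded_map W \<mu> K \<tau> c" and pi': "partial_inj (K' \<times> \<Omega>) \<tau>'" and h: "bij_betw h K K'"
    and iff: "\<And>k l x y. \<lbrakk>k \<in> K; l \<in> K; x \<in> \<Omega>; y \<in> \<Omega>\<rbrakk> \<Longrightarrow> ((k, x), (l, y)) \<in> \<tau> \<longleftrightarrow> ((h k, x), (h l, y)) \<in> \<tau>'"
  shows "\<exists>c'. coded_map W \<mu> K' \<tau>' c'"
proof -
  have "walsh_iso (\<lambda>d. case d of Inl (k, d) \<Rightarrow> Inl (h k, d) | Inr (k, x) \<Rightarrow> Inr (h k, (\<lambda>v. v) ` x))
    (std_map K \<tau>) (std_map K' \<tau>')"
    by (rule std_map_iso[OF cm_partial_inj[OF W] pi' h, where g = "\<lambda>k d. d"])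
      (use iff map_iso_ident in auto)
  then have "coded_map W \<mu> K' \<tau>'
      ((\<lambda>d. case d of Inl (k, d) \<Rightarrow> Inl (h k, d) | Inr (k, x) \<Rightarrow> Inr (h k, (\<lambda>v. v) ` x)) \<circ> c)"
    by (rule coded_map_recode[OF W pi']) (use cm_blue(1)[OF W] in auto)
  then show ?thesis by blast
qed

lemma coded_graph_relabel:
  assumes G: "coded_graph G \<theta> K \<tau> c" and pi': "partial_inj (K' \<times> \<Omega>) \<tau>'" and h: "bij_betw h K K'"
    and iff: "\<And>k l x y. \<lbrakk>k \<in> K; l \<in> K; x \<in> \<Omega>; y \<in> \<Omega>\<rbrakk> \<Longrightarrow> ((k, x), (l, y)) \<in> \<tau> \<longleftrightarrow> ((h k, x), (h l, y)) \<in> \<tau>'"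
  shows "\<exists>c'. coded_graph G \<theta> K' \<tau>' c'"
proof -
  have "\<tau>' \<subseteq> (K' \<times> \<Omega>) \<times> (K' \<times> \<Omega>)" using pi' by (simp add: partial_inj_def)
  then have "graph_iso (\<lambda>(k, v). (h k, v)) (std_graph K \<tau>) (std_graph K' \<tau>')"
    by (rule std_graph_iso[OF h _ cg_tau[OF G], where a = "\<lambda>k v. v"]) (use iff graph_iso_ident in auto)
  then have "coded_graph G \<theta> K' \<tau>' ((\<lambda>(k, v). (h k, v)) \<circ> c)"
    by (rule coded_graph_recode[OF G pi']) (simp add: case_prod_beta cg_snd[OF G])
  then show ?thesis by blast
qed

text \<open>Changing the identifications of the copies by automorphisms changes the code but
  neither the graph nor the map.\<close>

lemma same_code_twist:
  assumes G: "coded_graph G \<theta> K \<tau> c" and W: "coded_map W \<mu> K \<tau> c'"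
    and a: "\<And>k. k \<in> K \<Longrightarrow> graph_iso (a k) B B" and g: "\<And>k. k \<in> K \<Longrightarrow> map_iso (g k) M M"
    and Cil: "\<And>k x. k \<in> K \<Longrightarrow> x \<in> \<Omega> \<Longrightarrow> g k (Cil x) = Cil (a k ` x)"
    and \<theta>': "\<And>v. v \<in> verts G \<Longrightarrow> \<theta>' v = a (fst (c v)) (\<theta> v)"
    and \<mu>': "\<And>d. d \<in> darts W - blk W \<Longrightarrow> \<mu>' d = g (mkap c' d) (\<mu> d)"
  shows "same_code (G, \<theta>') (W, \<mu>')"
proof -
  have pi: "partial_inj (K \<times> \<Omega>) \<tau>" using cg_partial_inj[OF G] .
  define f where "f = (\<lambda>(k, x). (k, a k ` x))"
  \<comment> \<open>The new code keeps the copies and moves each pair of copy \<open>k\<close> by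
    the automorphism chosen there; \<open>f\<close> is this motion on positions.\<close>
  define \<tau>' where "\<tau>' = {(f s, f t) | s t. (s, t) \<in> \<tau>}"
  have a\<Omega>: "a k ` x \<in> \<Omega>" if "k \<in> K" "x \<in> \<Omega>" for k x
    using auto_in[OF g[OF that(1)], of "Cil x"] Cil that by simp
  have ainj: "x = y" if "k \<in> K" "x \<in> \<Omega>" "y \<in> \<Omega>" "a k ` x = a k ` y" for k x y
    using auto_inj[OF g[OF that(1)], of "Cil x" "Cil y"] Cil that by simp
  have finj: "p = q" if "p \<in> K \<times> \<Omega>" "q \<in> K \<times> \<Omega>" "f p = f q" for p q
    using that ainj[of "fst p" "snd p" "snd q"] by (auto simp: f_def case_prod_beta intro: prod_eqI)
  have fiff: "(p, q) \<in> \<tau> \<longleftrightarrow> (f p, f q) \<in> \<tau>'" if pq: "p \<in> K \<times> \<Omega>" "q \<in> K \<times> \<Omega>" for p q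
  proof
    assume "(f p, f q) \<in> \<tau>'"
    then obtain p' q' where *: "f p = f p'" "f q = f q'" "(p', q') \<in> \<tau>" unfolding \<tau>'_def by blast
    then have "p = p'" "q = q'" using finj pq partial_injD(3)[OF pi *(3)] by auto
    then show "(p, q) \<in> \<tau>" using * by simp
  next
    assume "(p, q) \<in> \<tau>"
    then show "(f p, f q) \<in> \<tau>'" unfolding \<tau>'_def by blast
  qed
  have pi': "partial_inj (K \<times> \<Omega>) \<tau>'"
  proof -
    have "finite (K \<times> \<Omega>)" using pi by (simp add: partial_inj_def)
    moreover have "f s \<in> K \<times> \<Omega>" if "s \<in> K \<times> \<Omega>" for s using a\<Omega> that by (auto simp: f_def)
    then have "\<tau>' \<subseteq> (K \<times> \<Omega>) \<times> (K \<times> \<Omega>)" using partial_injD(3)[OF pi] unfolding \<tau>'_def by blast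
    moreover have "single_valued \<tau>'"
    proof (rule single_valuedI)
      fix p q q' assume "(p, q) \<in> \<tau>'" "(p, q') \<in> \<tau>'"
      then obtain s t s' t' where *: "p = f s" "q = f t" "(s, t) \<in> \<tau>" "p = f s'" "q' = f t'" "(s', t') \<in> \<tau>"
        unfolding \<tau>'_def by blast
      then have "s = s'" using finj partial_injD(3)[OF pi] by metis
      then show "q = q'" using * partial_injD(1)[OF pi] by metis
    qed
    moreover have "single_valued (\<tau>'\<inverse>)"
    proof (rule single_valuedI)
      fix p q q' assume "(p, q) \<in> \<tau>'\<inverse>" "(p, q') \<in> \<tau>'\<inverse>"
      then obtain s t s' t' where *: "q = f s" "p = f t" "(s, t) \<in> \<tau>" "q' = f s'" "p = f t'" "(s', t') \<in> \<tau>"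
        unfolding \<tau>'_def by blast
      then have "t = t'" using finj partial_injD(3)[OF pi] by metis
      then show "q = q'" using * partial_injD(2)[OF pi] by metis
    qed
    ultimately show ?thesis by (simp add: partial_inj_def)
  qed
  have iff: "((k, x), (l, y)) \<in> \<tau> \<longleftrightarrow> ((k, a k ` x), (l, a l ` y)) \<in> \<tau>'"
    if "k \<in> K" "l \<in> K" "x \<in> \<Omega>" "y \<in> \<Omega>" for k l x y
    using fiff[of "(k, x)" "(l, y)"] that by (simp add: f_def)
  have sub: "\<tau>' \<subseteq> (K \<times> \<Omega>) \<times> (K \<times> \<Omega>)" using pi' by (simp add: partial_inj_def)
  have id: "bij_betw (\<lambda>k. k) K K" by (simp add: bij_betw_def)
  have "graph_iso (\<lambda>(k, v). (k, a k v)) (std_graph K \<tau>) (std_graph K \<tau>')"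
    by (rule std_graph_iso[OF id sub cg_tau[OF G] a a\<Omega> iff])
  then have "coded_graph G \<theta>' K \<tau>' ((\<lambda>(k, v). (k, a k v)) \<circ> c)"
  proof (rule coded_graph_recode[OF G pi'])
    fix v assume v: "v \<in> verts G"
    show "snd ((\<lambda>(k, v). (k, a k v)) (c v)) = \<theta>' v" using \<theta>'[OF v] cg_c[OF G v] by (metis case_prod_conv snd_conv)
  qed
  moreover have "walsh_iso (\<lambda>d. case d of Inl (k, d) \<Rightarrow> Inl (k, g k d) | Inr (k, x) \<Rightarrow> Inr (k, a k ` x))
    (std_map K \<tau>) (std_map K \<tau>')"
    by (rule std_map_iso[OF pi pi' id g Cil iff])
  then have "coded_map W \<mu>' K \<tau>'
      ((\<lambda>d. case d of Inl (k, d) \<Rightarrow> Inl (k, g k d) | Inr (k, x) \<Rightarrow> Inr (k, a k ` x)) \<circ> c')"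
  proof (rule coded_map_recode[OF W pi'])
    fix d assume d: "d \<in> darts W - blk W"
    then show "\<exists>k. (case c' d of Inl (k, d) \<Rightarrow> Inl (k, g k d) | Inr (k, x) \<Rightarrow> Inr (k, a k ` x)) = Inl (k, \<mu>' d)"
      using \<mu>'[OF d] cm_blue(1)[OF W, of d] by simp
  qed
  ultimately show ?thesis by (auto simp: same_code_def)
qed

text \<open>On copy \<open>k\<close> the two identifications differ by an automorphism
  \<open>a k\<close> of \<open>B\<close>. Its lift to \<open>M\<close> changes \<mu> accordingly,
  and the bare map stays the same.\<close>

lemma same_code_change_theta:
  assumes lift: "automorphisms_lift B \<Omega> M"
    and same: "same_code (G, \<theta>) (W, \<mu>)" and \<theta>': "(G, \<theta>') \<in> id_graphs D B p"
  shows "\<exists>\<mu>'. same_code (G, \<theta>') (W, \<mu>')"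
proof -
  obtain K \<tau> c c' where G: "coded_graph G \<theta> K \<tau> c" and W: "coded_map W \<mu> K \<tau> c'"
    using same by (auto simp: same_code_def)
  define a where "a k = \<theta>' \<circ> inv_into (verts (gcopy G c k)) \<theta>" for k
  have a: "graph_iso (a k) B B" if k: "k \<in> K" for k
  proof -
    have "graph_iso \<theta>' (gcopy G c k) B" using \<theta>' k cg_bubbles[OF G] by (auto simp: id_graphs_def)
    then show ?thesis unfolding a_def by (rule graph_iso_comp[OF graph_iso_inv[OF cg_gcopy_iso[OF G k]]])
  qed
  have "\<forall>k\<in>K. \<exists>g. map_iso g M M \<and> (\<forall>x\<in>\<Omega>. g (Cil x) = Cil (a k ` x))"
    using lift a by (simp add: automorphisms_lift_def)
  then obtain g where g: "\<And>k. k \<in> K \<Longrightarrow> map_iso (g k) M M" "\<And>k x. k \<in> K \<Longrightarrow> x \<in> \<Omega> \<Longrightarrow> g k (Cil x) = Cil (a k ` x)"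
    by metis
  have "\<theta>' v = a (fst (c v)) (\<theta> v)" if v: "v \<in> verts G" for v
  proof -
    have "v \<in> verts (gcopy G c (fst (c v)))" using v verts_gcopy[OF G] by simp
    moreover have "inj_on \<theta> (verts (gcopy G c (fst (c v))))"
      using cg_gcopy_iso[OF G] cg_in(3)[OF G v] by (auto simp: graph_iso_def bij_betw_def)
    ultimately show ?thesis by (simp add: a_def)
  qed
  then have "same_code (G, \<theta>') (W, \<lambda>d. g (mkap c' d) (\<mu> d))"
    by (intro same_code_twist[OF G W a g]) auto
  then show ?thesis by blast
qed

text \<open>The opposite direction needs no assumption on lifts: the automorphism of
  \<open>M\<close> by which the identifications of a copy differ induces one of
  \<open>B\<close>.\<close>

lemma same_code_change_mu:
  assumes same: "same_code (G, \<theta>) (W, \<mu>)" and \<mu>': "(W, \<mu>') \<in> id_walsh_maps M p"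
  shows "\<exists>\<theta>'. same_code (G, \<theta>') (W, \<mu>')"
proof -
  obtain K \<tau> c c' where G: "coded_graph G \<theta> K \<tau> c" and W: "coded_map W \<mu> K \<tau> c'"
    using same by (auto simp: same_code_def)
  define g where "g k = \<mu>' \<circ> inv_into (darts (mcopy W c' k)) \<mu>" for k
  have g: "map_iso (g k) M M" if k: "k \<in> K" for k
  proof -
    have "map_iso \<mu>' (mcopy W c' k) M" using \<mu>' k cm_blue_submaps[OF W] by (auto simp: id_walsh_maps_def)
    moreover have "map_iso (inv_into (darts (mcopy W c' k)) \<mu>) M (mcopy W c' k)"
    proof (rule map_iso_inv[OF cm_mcopy_iso[OF W k]])
      fix d assume d: "d \<in> darts (mcopy W c' k)"
      then have d': "d \<in> darts W" "d \<notin> blk W" "mkap c' d = k" by (auto simp: darts_mcopy[OF W])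
      then have "rot (mcopy W c' k) d = rot W d" "opp (mcopy W c' k) d = opp (delete_black W) d"
        using cm_delete_black(2)[OF W] by (simp_all add: mcopy_def submap_def perm_restrict_def)
      then show "rot (mcopy W c' k) d \<in> darts (mcopy W c' k) \<and> opp (mcopy W c' k) d \<in> darts (mcopy W c' k)"
        using d' cm_rot_blue[OF W d'(1,2)] cm_opp_delete[OF W d'(1,2)] by (simp add: darts_mcopy[OF W])
    qed
    ultimately show ?thesis unfolding g_def by (intro map_iso_comp)
  qed
  then have "\<forall>k\<in>K. \<exists>a. graph_iso a B B \<and> (\<forall>x\<in>\<Omega>. g k (Cil x) = Cil (a ` x))" using auto_induced by blast
  then obtain a where a: "\<And>k. k \<in> K \<Longrightarrow> graph_iso (a k) B B" "\<And>k x. k \<in> K \<Longrightarrow> x \<in> \<Omega> \<Longrightarrow> g k (Cil x) = Cil (a k ` x)"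
    by metis
  have "\<mu>' d = g (mkap c' d) (\<mu> d)" if d: "d \<in> darts W - blk W" for d
  proof -
    have "d \<in> darts (mcopy W c' (mkap c' d))" using d darts_mcopy[OF W] by simp
    moreover have "inj_on \<mu> (darts (mcopy W c' (mkap c' d)))"
      using cm_mcopy_iso[OF W cm_blue(2)[OF W]] d by (auto simp: map_iso_def bij_betw_def)
    ultimately show ?thesis by (simp add: g_def)
  qed
  then have "same_code (G, \<lambda>v. a (fst (c v)) (\<theta> v)) (W, \<mu>')"
    by (intro same_code_twist[OF G W a(1) g a(2)]) auto
  then show ?thesis by blast
qed

section \<open>Faces\<close>

text \<open>From the corner at position \<open>a\<close> a face of color \<open>i\<close> crosses an edge of color 0 and then an
  edge of color \<open>i\<close>.\<close>

definition fstep :: "nat set \<Rightarrow> (nat \<times> 'v set) rel \<Rightarrow> nat \<Rightarrow> nat \<times> 'v set \<Rightarrow> nat \<times> 'v set" where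
  "fstep K \<tau> i a = (if a \<in> K \<times> \<Omega> then (fst (clo K \<tau> a), nb i (snd (clo K \<tau> a))) else a)"

text \<open>An orbit that leaves \<open>Domain \<tau>\<close> is broken: in the graph the
  alternating walk stops at a free black vertex, in the map the boundary walk reaches a ciliated
  corner.\<close>

definition code_faces :: "nat set \<Rightarrow> (nat \<times> 'v set) rel \<Rightarrow> nat \<Rightarrow> (nat \<times> 'v set) set set" where
  "code_faces K \<tau> i = {S. \<exists>a\<in>K \<times> \<Omega>. S = orbit (fstep K \<tau> i) a \<and> S \<subseteq> Domain \<tau>}"

lemma fstep_permutes:
  assumes "partial_inj (K \<times> \<Omega>) \<tau>"
  shows "fstep K \<tau> i permutes K \<times> \<Omega>"
proof (rule bij_imp_permutes)
  have clo: "clo K \<tau> permutes K \<times> \<Omega>" using closing_clo[OF assms] by (simp add: closing_def)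
  have inj: "inj_on (fstep K \<tau> i) (K \<times> \<Omega>)"
  proof (rule inj_onI)
    fix a b assume ab: "a \<in> K \<times> \<Omega>" "b \<in> K \<times> \<Omega>" "fstep K \<tau> i a = fstep K \<tau> i b"
    have cab: "snd (clo K \<tau> a) \<in> \<Omega>" "snd (clo K \<tau> b) \<in> \<Omega>" using clo_in[OF assms] ab by (auto simp: mem_Times_iff)
    have "fst (clo K \<tau> a) = fst (clo K \<tau> b)" "nb i (snd (clo K \<tau> a)) = nb i (snd (clo K \<tau> b))"
      using ab by (auto simp: fstep_def)
    then have "clo K \<tau> a = clo K \<tau> b" using nb_inj[OF cab] by (simp add: prod_eqI)
    then show "a = b" using permutes_inj[OF clo] by (auto dest: injD)
  qed
  have sub: "fstep K \<tau> i ` (K \<times> \<Omega>) \<subseteq> K \<times> \<Omega>"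
  proof (rule image_subsetI)
    fix a assume "a \<in> K \<times> \<Omega>"
    then show "fstep K \<tau> i a \<in> K \<times> \<Omega>" using clo_in[OF assms, of a] nb_in by (simp add: fstep_def mem_Times_iff)
  qed
  have "finite (K \<times> \<Omega>)" using assms by (simp add: partial_inj_def)
  then show "bij_betw (fstep K \<tau> i) (K \<times> \<Omega>) (K \<times> \<Omega>)" using inj sub by (simp add: bij_betw_def endo_inj_surj)
qed (simp add: fstep_def)

lemma code_facesI:
  "a \<in> K \<times> \<Omega> \<Longrightarrow> orbit (fstep K \<tau> i) a \<subseteq> Domain \<tau> \<Longrightarrow> orbit (fstep K \<tau> i) a \<in> code_faces K \<tau> i"
  unfolding code_faces_def by blast

lemma code_facesD:
  assumes "partial_inj (K \<times> \<Omega>) \<tau>" "S \<in> code_faces K \<tau> i"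
  shows "S \<subseteq> Domain \<tau>" "S \<subseteq> K \<times> \<Omega>" "S \<noteq> {}" "a \<in> S \<Longrightarrow> orbit (fstep K \<tau> i) a = S"
proof -
  obtain a0 where a0: "a0 \<in> K \<times> \<Omega>" "S = orbit (fstep K \<tau> i) a0" "S \<subseteq> Domain \<tau>"
    using assms(2) by (auto simp: code_faces_def)
  then show "S \<subseteq> Domain \<tau>" by blast
  then show "S \<subseteq> K \<times> \<Omega>" using assms(1) by (auto simp: partial_inj_def)
  show "S \<noteq> {}" using a0 orbit_nonempty by metis
  have "finite (K \<times> \<Omega>)" using assms(1) by (simp add: partial_inj_def)
  then have "cyclic_on (fstep K \<tau> i) S" using cyclic_on_orbit[OF fstep_permutes[OF assms(1)]] a0 by blast
  then show "a \<in> S \<Longrightarrow> orbit (fstep K \<tau> i) a = S" by (rule orbit_cyclic_eq3)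
qed

text \<open>A position stands for its black vertex here. A black vertex on a face contributes its
  edges of colors 0 and \<open>i\<close>, so the face is selected by black ends.\<close>

definition gface :: "'a cgraph \<Rightarrow> ('a \<Rightarrow> nat \<times> 'v) \<Rightarrow> nat \<Rightarrow> (nat \<times> 'v set) set \<Rightarrow> (nat \<times> 'a \<times> 'a) set" where
  "gface G c i S = {(j, w, b). (j, w, b) \<in> cedges G \<and> (j = 0 \<or> j = i) \<and> gpos c b \<in> S}"

context
  fixes G :: "'a cgraph" and \<theta> K \<tau> c
  assumes cg: "coded_graph G \<theta> K \<tau> c"
begin

text \<open>A black vertex has at most one edge of each of the two colors, so the edges of the cycle
  can be recovered from its black vertices.\<close>

lemma cg_cycle_gface:
  assumes i: "i \<in> {1..D}" and n: "0 < n"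
    and e: "\<And>k. k < n \<Longrightarrow> (i, w k, b k) \<in> cedges G \<and> (0, w (Suc k mod n), b k) \<in> cedges G"
  shows "(\<Union>k<n. {(i, w k, b k), (0, w (Suc k mod n), b k)}) = gface G c i ((\<lambda>k. gpos c (b k)) ` {..<n})"
proof
  show "(\<Union>k<n. {(i, w k, b k), (0, w (Suc k mod n), b k)}) \<subseteq> gface G c i ((\<lambda>k. gpos c (b k)) ` {..<n})"
    using e by (auto simp: gface_def)
  show "gface G c i ((\<lambda>k. gpos c (b k)) ` {..<n}) \<subseteq> (\<Union>k<n. {(i, w k, b k), (0, w (Suc k mod n), b k)})"
  proof clarify
    fix j w' b' assume "(j, w', b') \<in> gface G c i ((\<lambda>k. gpos c (b k)) ` {..<n})"
    then obtain k where k: "(j, w', b') \<in> cedges G" "j = 0 \<or> j = i" "gpos c b' = gpos c (b k)" "k < n"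
      by (auto simp: gface_def)
    have "b' \<in> black G" "b k \<in> black G" using k(1) e[OF k(4)] cg_bip(3)[OF cg] by auto
    then have b': "b' = b k" using cg_gpos_inj(2)[OF cg] k(3) by blast
    have "w' = (if j = 0 then w (Suc k mod n) else w k)"
    proof (cases "j = 0")
      case True
      then show ?thesis using k(1) b' e[OF k(4)] cg_edge0_unique(2)[OF cg] by auto
    next
      case False
      then have "j = i" using k(2) by simp
      then show ?thesis using False k(1) b' e[OF k(4)] cg_edge_white_ex1[OF cg i \<open>b k \<in> black G\<close>] by auto
    qed
    then show "(j, w', b') \<in> (\<Union>k<n. {(i, w k, b k), (0, w (Suc k mod n), b k)})"
      using k(2,4) b' i by (intro UN_I[of k]) auto
  qed
qed

lemma cg_fstep:
  assumes i: "i \<in> {1..D}" and e0: "(0, w, b) \<in> cedges G" and ei: "(i, w, b') \<in> cedges G"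
  shows "fstep K \<tau> i (gpos c b) = gpos c b'"
proof -
  have "(gpos c b, gpos c w) \<in> \<tau>" "b \<in> black G" using e0 cg_edge0[OF cg] by auto
  then have "clo K \<tau> (gpos c b) = gpos c w" "gpos c b \<in> K \<times> \<Omega>"
    using clo_tau[OF cg_partial_inj[OF cg]] cg_gpos_in(2)[OF cg] by auto
  moreover have "gpos c b' = (fst (gpos c w), nb i (snd (gpos c w)))"
    using ei cg_edge_nb[OF cg, of i] i by simp
  ultimately show ?thesis by (simp add: fstep_def)
qed

lemma cg_graph_faces: assumes i: "i \<in> {1..D}" shows "graph_faces G i = gface G c i ` code_faces K \<tau> i"
proof
  show "graph_faces G i \<subseteq> gface G c i ` code_faces K \<tau> i"
  proof
    fix F assume "F \<in> graph_faces G i"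
    then obtain n w b where n: "0 < n" and e: "\<And>k. k < n \<Longrightarrow> (i, w k, b k) \<in> cedges G \<and> (0, w (Suc k mod n), b k) \<in> cedges G"
      and F: "F = (\<Union>k<n. {(i, w k, b k), (0, w (Suc k mod n), b k)})" by (auto simp: graph_faces_def)
    define s where "s k = gpos c (b k)" for k
    have "orbit (fstep K \<tau> i) (s 0) = s ` {..<n}"
    proof (rule orbit_cyclic_sequence[OF n])
      fix k assume "k < n"
      then show "fstep K \<tau> i (s k) = s (Suc k mod n)"
        using cg_fstep[OF i, of "w (Suc k mod n)" "b k" "b (Suc k mod n)"] e n by (simp add: s_def)
    qed
    moreover have "s ` {..<n} \<subseteq> Domain \<tau>"
    proof (rule image_subsetI)
      fix k assume "k \<in> {..<n}"
      then have "(0, w (Suc k mod n), b k) \<in> cedges G" using e by simp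
      then show "s k \<in> Domain \<tau>" using cg_edge0[OF cg] by (auto simp: s_def)
    qed
    moreover have "s 0 \<in> K \<times> \<Omega>" using e[OF n] cg_bip(3)[OF cg] cg_gpos_in(2)[OF cg] by (auto simp: s_def)
    ultimately have "s ` {..<n} \<in> code_faces K \<tau> i" using code_facesI by metis
    moreover have "F = gface G c i (s ` {..<n})" unfolding F s_def by (rule cg_cycle_gface[where w = w and b = b, OF i n e])
    ultimately show "F \<in> gface G c i ` code_faces K \<tau> i" by blast
  qed
  show "gface G c i ` code_faces K \<tau> i \<subseteq> graph_faces G i"
  proof (rule image_subsetI)
    fix S assume S: "S \<in> code_faces K \<tau> i"
    note pi = cg_partial_inj[OF cg]
    obtain a where a: "a \<in> K \<times> \<Omega>" "S = orbit (fstep K \<tau> i) a" "S \<subseteq> Domain \<tau>"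
      using S by (auto simp: code_faces_def)
    have "finite (K \<times> \<Omega>)" using pi by (simp add: partial_inj_def)
    then have self: "a \<in> orbit (fstep K \<tau> i) a"
      using fstep_permutes[OF pi] permutation_self_in_orbit permutation_permutes by metis
    \<comment> \<open>The period of \<open>a\<close>: the positions \<open>s k\<close> for
      \<open>k < n\<close> are distinct, as a face requires of its vertices.\<close>
    define n where "n = funpow_dist1 (fstep K \<tau> i) a a"
    define s where "s k = (fstep K \<tau> i ^^ k) a" for k
    have n: "0 < n" by (simp add: n_def)
    have sn: "s n = s 0" using funpow_dist1_prop[OF self] by (simp add: s_def n_def)
    have s_mod: "s (Suc k mod n) = fstep K \<tau> i (s k)" if "k < n" for k
      using sn that by (cases "Suc k = n") (auto simp: s_def)
    have S_eq: "S = s ` {..<n}"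
      using orbit_conv_funpow_dist1[OF self] a by (simp add: n_def s_def atLeast0LessThan)
    have s_inj: "inj_on s {..<n}"
      using inj_on_funpow_dist1[OF self] by (simp add: n_def s_def[abs_def] atLeast0LessThan)
    have sS: "s k \<in> S" if "k < n" for k using S_eq that by simp
    have "\<exists>b. k < n \<longrightarrow> b \<in> black G \<and> gpos c b = s k" for k
      using cg_gpos_surj(2)[OF cg] sS[of k] code_facesD(2)[OF pi S] by (metis subsetD)
    then obtain b where b: "\<And>k. k < n \<Longrightarrow> b k \<in> black G \<and> gpos c (b k) = s k" by metis
    define w where "w k = (THE w. (i, w, b k) \<in> cedges G)" for k
    have w: "(i, w k, b k) \<in> cedges G" if "k < n" for k
      unfolding w_def by (rule theI') (use cg_edge_white_ex1[OF cg i] b that in blast)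
    \<comment> \<open>The edge of color 0 at \<open>b k\<close> exists because the orbit stays in
      \<open>Domain \<tau>\<close>. Its white end \<open>u\<close> has its neighbor of color
      \<open>i\<close> at the next position of the orbit, hence is
      \<open>w (Suc k mod n)\<close>.\<close>
    have e: "(i, w k, b k) \<in> cedges G \<and> (0, w (Suc k mod n), b k) \<in> cedges G" if k: "k < n" for k
    proof -
      let ?k = "Suc k mod n"
      have k': "?k < n" using n by simp
      obtain q where q: "(s k, q) \<in> \<tau>" using sS[OF k] a(3) by blast
      then have "q \<in> K \<times> \<Omega>" using partial_injD(3)[OF pi] by blast
      then obtain u where u: "u \<in> white G" "gpos c u = q" using cg_gpos_surj(1)[OF cg] by metis
      have e0: "(0, u, b k) \<in> cedges G" using q u b[OF k] cg_edge0[OF cg] by simp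
      obtain b' where b': "(i, u, b') \<in> cedges G" using cg_edge_black_ex1[OF cg i u(1)] by blast
      have "gpos c b' = gpos c (b ?k)" using cg_fstep[OF i e0 b'] b[OF k] b[OF k'] s_mod[OF k] by simp
      moreover have "b' \<in> black G" using b' cg_bip(3)[OF cg] by auto
      ultimately have "b' = b ?k" using cg_gpos_inj(2)[OF cg] b[OF k'] by blast
      then have "u = w ?k" using b' w[OF k'] cg_edge_white_ex1[OF cg i] b[OF k'] by blast
      then show ?thesis using e0 w[OF k] by simp
    qed
    have "inj_on b {..<n}"
      using s_inj b by (metis (no_types, lifting) inj_on_def lessThan_iff)
    moreover have "inj_on w {..<n}"
    proof (rule inj_onI)
      fix k l assume kl: "k \<in> {..<n}" "l \<in> {..<n}" "w k = w l"
      have "w k \<in> white G" using w kl(1) cg_bip(3)[OF cg] by auto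
      then have "b k = b l" using w[of k] w[of l] kl cg_edge_black_ex1[OF cg i, of "w k"] by auto
      then show "k = l" using calculation kl by (auto dest: inj_onD)
    qed
    moreover have "gface G c i S = (\<Union>k<n. {(i, w k, b k), (0, w (Suc k mod n), b k)})"
    proof -
      have "S = (\<lambda>k. gpos c (b k)) ` {..<n}" unfolding S_eq using b by (intro image_cong) auto
      then show ?thesis using cg_cycle_gface[where w = w and b = b, OF i n e] by simp
    qed
    ultimately show "gface G c i S \<in> graph_faces G i"
      using n e unfolding graph_faces_def by blast
  qed
qed

text \<open>Every position of a face lies in \<open>Domain \<tau>\<close> and so carries an edge of
  color 0. Thus a face remembers its orbit, which is how images of faces are defined later.\<close>

lemma cg_gface_zero: assumes S: "S \<in> code_faces K \<tau> i"
  shows "gpos c ` {b. \<exists>w. (0, w, b) \<in> gface G c i S} = S"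
proof
  show "gpos c ` {b. \<exists>w. (0, w, b) \<in> gface G c i S} \<subseteq> S" by (auto simp: gface_def)
  show "S \<subseteq> gpos c ` {b. \<exists>w. (0, w, b) \<in> gface G c i S}"
  proof
    fix a assume a: "a \<in> S"
    then obtain q where q: "(a, q) \<in> \<tau>" using code_facesD(1)[OF cg_partial_inj[OF cg] S] by blast
    obtain b where b: "b \<in> black G" "a = gpos c b"
      using cg_gpos_surj(2)[OF cg] partial_injD(3)[OF cg_partial_inj[OF cg] q] by blast
    obtain w where w: "w \<in> white G" "q = gpos c w"
      using cg_gpos_surj(1)[OF cg] partial_injD(3)[OF cg_partial_inj[OF cg] q] by blast
    have "(0, w, b) \<in> cedges G" using q b w cg_edge0[OF cg] by simp
    then have "(0, w, b) \<in> gface G c i S" using a b by (simp add: gface_def)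
    then show "a \<in> gpos c ` {b. \<exists>w. (0, w, b) \<in> gface G c i S}" using b(2) by blast
  qed
qed

end

section \<open>Faces of a coded map\<close>

definition face_perm :: "'d wmap \<Rightarrow> nat \<Rightarrow> 'd \<Rightarrow> 'd" where
  "face_perm W i = opp (mono_submap W i) \<circ> rot (mono_submap W i)"

lemma face_perm_eq:
  "face_perm W i d = (if i \<in> lab W (rot W d) then opp W (rot W d) else rot W d)"
  by (simp add: face_perm_def mono_submap_def)

context
  fixes W :: "'d wmap" and \<mu> K \<tau> c
  assumes cm: "coded_map W \<mu> K \<tau> c"
begin

lemma cm_face_perm_permutes: "face_perm W i permutes darts W"
proof -
  let ?o = "\<lambda>d. if i \<in> lab W d then opp W d else d"
  have "bij_betw ?o (darts W) (darts W)"
    by (rule bij_betw_involution) (use cm_in[OF cm] cm_opp_opp[OF cm] in auto)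
  moreover have "opp W d = d" if "d \<notin> darts W" for d using cm_opp[OF cm] that by (simp add: permutes_def)
  ultimately have "?o permutes darts W" by (intro bij_imp_permutes) auto
  then have "?o \<circ> rot W permutes darts W" by (rule permutes_compose[OF cm_rot[OF cm]])
  moreover have "?o \<circ> rot W = face_perm W i" by (auto simp: face_perm_eq)
  ultimately show ?thesis by simp
qed

text \<open>Boundary steps that do not land at a black vertex. They make up the walk between
  consecutive black corners except its final step.\<close>

definition "walk i = {(e, face_perm W i e) | e. face_perm W i e \<notin> blk W}"

text \<open>Darts whose edge lacks the color \<open>i\<close> are fixed by the involution of the
  monochromatic submap and are passed over. Since \<open>j' < length (around os is x)\<close> the
  walk does not wrap around to the cilium, whose label in \<open>W\<close> is not its
  \<open>hedge_label\<close>.\<close>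

lemma cm_walk_around:
  assumes x: "x \<in> \<Omega>" and e: "e \<in> darts W" "e \<notin> blk W" "\<mu> e = around os is x ! j"
    and j: "j \<le> j'" "j' < length (around os is x)"
    and nolab: "\<And>l. j < l \<Longrightarrow> l \<le> j' \<Longrightarrow> i \<notin> hedge_label (around os is x ! l)"
  shows "\<exists>e'. (e, e') \<in> (walk i)\<^sup>* \<and> e' \<in> darts W \<and> e' \<notin> blk W \<and> mkap c e' = mkap c e \<and> \<mu> e' = around os is x ! j'"
  using j nolab
proof (induction j' rule: dec_induct)
  case base
  then show ?case using e by blast
next
  case (step m)
  then obtain e' where e': "(e, e') \<in> (walk i)\<^sup>*" "e' \<in> darts W" "e' \<notin> blk W" "mkap c e' = mkap c e"
    "\<mu> e' = around os is x ! m" by (metis Suc_lessD le_Suc_eq)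
  note r = cm_rot_blue[OF cm e'(2,3)]
  have mu: "\<mu> (rot W e') = around os is x ! Suc m" using r(4) e'(5) rot_M_nth[OF x, of m] step by simp
  have "around os is x ! Suc m \<noteq> Cil y" for y
    using step(4) by (auto simp: around_def nth_append split: if_splits)
  then have "\<nexists>y. \<mu> (rot W e') = Cil y" using mu by simp
  then have "lab W (rot W e') = hedge_label (around os is x ! Suc m)" using cm_opp_blue(5)[OF cm r(1,2)] mu by simp
  then have "face_perm W i e' = rot W e'" using step by (simp add: face_perm_eq)
  then have "(e', rot W e') \<in> walk i" using r(2) unfolding walk_def by force
  then show ?case using e' r mu by (intro exI[of _ "rot W e'"]) auto
qed

lemma cm_first_return:
  assumes d: "d \<in> blk W"
  shows "\<exists>e. (d, e) \<in> (walk i)\<^sup>* \<and> face_perm W i e \<in> blk W \<and> mpos c (face_perm W i e) = fstep K \<tau> i (mpos c d)"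
proof -
  let ?r = "rot W d"
  have r: "?r \<in> blk W" "mpos c ?r = clo K \<tau> (mpos c d)" using cm_rot_black[OF cm d] .
  define k where "k = fst (mpos c ?r)"
  define x where "x = snd (mpos c ?r)"
  have kx: "mpos c ?r = (k, x)" by (simp add: k_def x_def)
  have x: "x \<in> \<Omega>" using cm_black(3)[OF cm r(1)] kx by simp
  have fs: "fstep K \<tau> i (mpos c d) = (k, nb i x)"
    using cm_black(3)[OF cm d] r(2) by (simp add: fstep_def k_def x_def)
  have lr: "lab W ?r = cols x" using cm_opp_black(5)[OF cm r(1)] kx by simp
  show ?thesis
  proof (cases "i \<in> cols x")
    case False
    \<comment> \<open>The black-blue edge is missing from the monochromatic submap, so the walk
      stays at the black vertex. For a color of \<open>B\<close> this is the case of a discarded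
      edge, where \<open>nb i\<close> fixes the pair.\<close>
    then have "face_perm W i d = ?r" using lr by (simp add: face_perm_eq)
    then show ?thesis using r(1) kx fs nb_not_cols[OF False] by (intro exI[of _ d]) auto
  next
    case True
    let ?e0 = "opp W ?r"
    have e0: "?e0 \<in> darts W" "?e0 \<notin> blk W" "mkap c ?e0 = k" "\<mu> ?e0 = around os is x ! 0"
      using cm_opp_black[OF cm r(1)] kx by (simp_all add: around_0)
    have f0: "face_perm W i d = ?e0" using lr True by (simp add: face_perm_eq)
    then have w0: "(d, ?e0) \<in> walk i" using e0(2) unfolding walk_def by force
    obtain j where j: "j < length (os x)" "os x ! j = i"
      using True orders_cols(2)[OF x] by (metis in_set_conv_nth)
    have Out: "around os is x ! Suc l = Out (os x ! l) x" if "l < length (os x)" for l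
      using that by (simp add: around_def nth_append)
    have len: "Suc j < length (around os is x)" using j by (simp add: around_def)
    \<comment> \<open>Outgoing edges start at position 1, and the one of color \<open>i\<close> is
      at \<open>Suc j\<close>; the positions from 1 to \<open>j\<close> hold outgoing edges of other
      colors.\<close>
    have "i \<notin> hedge_label (around os is x ! l)" if l: "0 < l" "l \<le> j" for l
    proof -
      obtain l' where l': "l = Suc l'" using l by (cases l) auto
      then have "os x ! l' \<noteq> os x ! j" using l j(1) nth_eq_iff_index_eq[OF orders_cols(1)[OF x], of l' j] by simp
      then show ?thesis using Out[of l'] l l' j by simp
    qed
    then obtain e1 where e1: "(?e0, e1) \<in> (walk i)\<^sup>*" "e1 \<in> darts W" "e1 \<notin> blk W" "mkap c e1 = k"
      "\<mu> e1 = around os is x ! j"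
      using cm_walk_around[OF x e0(1,2,4), of j i] len e0(3) by auto
    note r1 = cm_rot_blue[OF cm e1(2,3)]
    have mu1: "\<mu> (rot W e1) = Out i x" using r1(4) e1(5) rot_M_nth[OF x, of j] Out[OF j(1)] j(2) len by simp
    then have nC: "\<nexists>y. \<mu> (rot W e1) = Cil y" by simp
    note o1 = cm_opp_blue[OF cm r1(1,2) nC]
    let ?e2 = "opp W (rot W e1)" and ?y = "nb i x"
    have f1: "face_perm W i e1 = ?e2" using o1(5) mu1 by (simp add: face_perm_eq)
    then have w1: "(e1, ?e2) \<in> walk i" using o1(2) unfolding walk_def by force
    have y: "?y \<in> \<Omega>" "i \<in> cols ?y" using nb_in cols_nb x True by auto
    have mu2: "\<mu> ?e2 = Inc i ?y" using o1(4) mu1 x True by simp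
    obtain m where m: "m < length (is ?y)" "is ?y ! m = i"
      using y orders_cols(4)[OF y(1)] by (metis in_set_conv_nth)
    \<comment> \<open>The position of the first incoming edge, after the cilium and all outgoing
      ones. The walk arrives at \<open>?q + m\<close>, beyond which only incoming edges of other
      colors are left. Were the incoming group first, the walk would run into the outgoing edge of
      color \<open>i\<close> before the cilium.\<close>
    let ?q = "Suc (length (os ?y))"
    have Inc: "around os is ?y ! (?q + l) = Inc (is ?y ! l) ?y" if "l < length (is ?y)" for l
      using that by (simp add: around_def nth_append)
    have leny: "length (around os is ?y) = ?q + length (is ?y)" by (simp add: around_def)
    let ?L = "length (around os is ?y) - 1"
    have "i \<notin> hedge_label (around os is ?y ! l)" if l: "?q + m < l" "l \<le> ?L" for l
    proof -
      define l' where "l' = l - ?q"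
      have l': "l = ?q + l'" "m < l'" "l' < length (is ?y)" using l leny m by (auto simp: l'_def)
      then have "is ?y ! l' \<noteq> is ?y ! m" using m(1) nth_eq_iff_index_eq[OF orders_cols(3)[OF y(1)], of l' m] by simp
      then show ?thesis using Inc[OF l'(3)] l'(1) m by simp
    qed
    moreover have "\<mu> ?e2 = around os is ?y ! (?q + m)" using mu2 Inc[OF m(1)] m(2) by simp
    moreover have "?q + m \<le> ?L" "?L < length (around os is ?y)" using leny m by auto
    ultimately obtain e3 where e3: "(?e2, e3) \<in> (walk i)\<^sup>*" "e3 \<in> darts W" "e3 \<notin> blk W" "mkap c e3 = mkap c ?e2"
      "\<mu> e3 = around os is ?y ! ?L"
      using cm_walk_around[OF y(1) o1(1,2), of "?q + m" ?L i] by blast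
    note r3 = cm_rot_blue[OF cm e3(2,3)]
    \<comment> \<open>After the last position the turn closes at the cilium. Its edge carries the
      label \<open>cols (nb i x)\<close>, which contains \<open>i\<close>, so the walk crosses to
      the black vertex.\<close>
    have "Suc ?L mod length (around os is ?y) = 0" using leny by simp
    then have mu3: "\<mu> (rot W e3) = Cil ?y"
      using r3(4) e3(5) rot_M_nth[OF y(1), of ?L] leny by (simp add: around_0)
    note o3 = cm_opp_Cil[OF cm r3(1,2) mu3]
    have "face_perm W i e3 = opp W (rot W e3)" using o3(3) y(2) by (simp add: face_perm_eq)
    moreover have "mpos c (opp W (rot W e3)) = (k, ?y)" using o3(2) r3(3) e3(4) o1(3) r1(3) e1(4) by simp
    moreover have "(d, e3) \<in> (walk i)\<^sup>*"
      using w0 e1(1) w1 e3(1) by (meson r_into_rtrancl rtrancl_trans)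
    ultimately show ?thesis using o3(1) fs by (intro exI[of _ e3]) auto
  qed
qed

lemma cm_face_black: assumes d: "d \<in> blk W"
  shows "mpos c ` (orbit (face_perm W i) d \<inter> blk W) = orbit (fstep K \<tau> i) (mpos c d)"
proof -
  \<comment> \<open>The step \<open>fstep\<close> pulled back to black darts; by
    \<open>cm_first_return\<close> it is the first return of the boundary walk.\<close>
  define r where "r d = inv_into (blk W) (mpos c) (fstep K \<tau> i (mpos c d))" for d
  have r: "r d \<in> blk W" "mpos c (r d) = fstep K \<tau> i (mpos c d)" if d: "d \<in> blk W" for d
  proof -
    have "fstep K \<tau> i (mpos c d) \<in> K \<times> \<Omega>"
      using permutes_in_image[OF fstep_permutes[OF cm_partial_inj[OF cm], of i], of "mpos c d"] cm_black(3)[OF cm d]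
      by (rule iffD2)
    then have *: "fstep K \<tau> i (mpos c d) \<in> mpos c ` blk W" using cm_mpos_bij[OF cm] by (simp add: bij_betw_def)
    show "r d \<in> blk W" "mpos c (r d) = fstep K \<tau> i (mpos c d)"
      unfolding r_def using inv_into_into[OF *] f_inv_into_f[OF *] by auto
  qed
  have "orbit (face_perm W i) d \<inter> blk W = orbit r d"
  proof (rule orbit_first_return)
    show "r ` blk W \<subseteq> blk W" using r(1) by blast
    fix y assume y: "y \<in> blk W"
    obtain e where e: "(y, e) \<in> (walk i)\<^sup>*" "face_perm W i e \<in> blk W"
      "mpos c (face_perm W i e) = fstep K \<tau> i (mpos c y)" using cm_first_return[OF y] by blast
    obtain n where n: "e = (face_perm W i ^^ n) y" "\<forall>j. 0 < j \<and> j \<le> n \<longrightarrow> (face_perm W i ^^ j) y \<notin> blk W"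
      using funpow_of_rtrancl_avoiding[OF e(1)[unfolded walk_def]] by blast
    have "face_perm W i e = r y" using cm_mpos_inj[OF cm e(2) r(1)[OF y]] e(3) r(2)[OF y] by simp
    then show "\<exists>n. (face_perm W i ^^ Suc n) y = r y \<and> (\<forall>j. 0 < j \<and> j \<le> n \<longrightarrow> (face_perm W i ^^ j) y \<notin> blk W)"
      using n by (intro exI[of _ n]) auto
  qed (rule d)
  moreover have "mpos c ` orbit r d = orbit (fstep K \<tau> i) (mpos c d)"
    by (rule orbit_image_semiconj[where Y = "blk W"]) (use r d in auto)
  ultimately show ?thesis by simp
qed

text \<open>For an orbit \<open>S\<close> of \<open>fstep\<close> all these darts lie on one face,
  so the union is a single orbit; writing it this way avoids choosing a dart.\<close>

definition "mface i S = (\<Union>d\<in>{d \<in> blk W. mpos c d \<in> S}. orbit (face_perm W i) d)"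

lemma cm_orbit_eq: "e \<in> orbit (face_perm W i) d \<Longrightarrow> orbit (face_perm W i) e = orbit (face_perm W i) d"
  using orbit_cyclic_eq3[OF cyclic_on_orbit[OF cm_face_perm_permutes cm_finite[OF cm]]] by blast

lemma cm_self_in_orbit: "d \<in> orbit (face_perm W i) d"
  using cm_face_perm_permutes cm_finite[OF cm] permutation_self_in_orbit permutation_permutes by metis

lemma cm_face_black': assumes d: "d \<in> blk W"
  shows "orbit (face_perm W i) d \<inter> blk W = {e \<in> blk W. mpos c e \<in> orbit (fstep K \<tau> i) (mpos c d)}"
proof
  show "orbit (face_perm W i) d \<inter> blk W \<subseteq> {e \<in> blk W. mpos c e \<in> orbit (fstep K \<tau> i) (mpos c d)}"
    using cm_face_black[OF d, of i] by blast
  show "{e \<in> blk W. mpos c e \<in> orbit (fstep K \<tau> i) (mpos c d)} \<subseteq> orbit (face_perm W i) d \<inter> blk W"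
  proof
    fix e assume "e \<in> {e \<in> blk W. mpos c e \<in> orbit (fstep K \<tau> i) (mpos c d)}"
    then have e: "e \<in> blk W" "mpos c e \<in> orbit (fstep K \<tau> i) (mpos c d)" by auto
    then obtain e' where "e' \<in> orbit (face_perm W i) d \<inter> blk W" "mpos c e = mpos c e'"
      unfolding cm_face_black[OF d, of i, symmetric] by blast
    then show "e \<in> orbit (face_perm W i) d \<inter> blk W" using cm_mpos_inj[OF cm e(1)] by auto
  qed
qed

lemma cm_mface: assumes d: "d \<in> blk W" and S: "S = orbit (fstep K \<tau> i) (mpos c d)"
  shows "mface i S = orbit (face_perm W i) d"
proof -
  have sub: "{e \<in> blk W. mpos c e \<in> S} \<subseteq> orbit (face_perm W i) d" using cm_face_black'[OF d, of i] S by blast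
  have d': "d \<in> {e \<in> blk W. mpos c e \<in> S}"
    using cm_face_black'[OF d, of i] cm_self_in_orbit[of d i] d S by blast
  have "orbit (face_perm W i) e = orbit (face_perm W i) d" if "e \<in> {e \<in> blk W. mpos c e \<in> S}" for e
    using cm_orbit_eq sub that by blast
  then show ?thesis unfolding mface_def using d' by blast
qed

lemma cm_code_face_dart: assumes S: "S \<in> code_faces K \<tau> i"
  obtains d where "d \<in> blk W" "S = orbit (fstep K \<tau> i) (mpos c d)"
proof -
  note S' = code_facesD[OF cm_partial_inj[OF cm] S]
  obtain a where a: "a \<in> S" using S'(3) by blast
  obtain d where d: "d \<in> blk W" "mpos c d = a" using cm_mpos_surj[OF cm, of a] a S'(2) by blast
  then show ?thesis using that[of d] S'(4)[OF a] by simp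
qed

lemma cm_mface_blk: assumes S: "S \<in> code_faces K \<tau> i"
  shows "mface i S \<inter> blk W = {d \<in> blk W. mpos c d \<in> S}"
proof -
  obtain d where "d \<in> blk W" "S = orbit (fstep K \<tau> i) (mpos c d)" using cm_code_face_dart[OF S] .
  then show ?thesis using cm_mface cm_face_black' by simp
qed

text \<open>Cilia sit exactly at the positions outside \<open>Domain \<tau>\<close>, so avoiding
  them is the domain condition of \<open>code_faces\<close>.\<close>

lemma cm_black_faces: "black_faces W i = mface i ` code_faces K \<tau> i"
proof
  have mf: "map_faces (mono_submap W i) = {orbit (face_perm W i) d | d. d \<in> darts W}"
    by (simp add: map_faces_def face_perm_def mono_submap_def)
  show "black_faces W i \<subseteq> mface i ` code_faces K \<tau> i"
  proof
    fix F assume "F \<in> black_faces W i"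
    then obtain d0 d where F: "F = orbit (face_perm W i) d0" and d: "d \<in> F" "d \<in> blk W" and no: "F \<inter> cil W = {}"
      unfolding black_faces_def mf by blast
    have Fd: "F = orbit (face_perm W i) d" using cm_orbit_eq d(1) F by blast
    let ?S = "orbit (fstep K \<tau> i) (mpos c d)"
    have "?S \<subseteq> Domain \<tau>"
    proof
      fix a assume "a \<in> ?S"
      then obtain e where "e \<in> F \<inter> blk W" "a = mpos c e" using cm_face_black[OF d(2), of i] Fd by blast
      then show "a \<in> Domain \<tau>" using cm_cil_iff[OF cm, of e] no by blast
    qed
    then have "?S \<in> code_faces K \<tau> i" using cm_black(3)[OF cm d(2)] by (intro code_facesI)
    moreover have "F = mface i ?S" using cm_mface[OF d(2) refl] Fd by simp
    ultimately show "F \<in> mface i ` code_faces K \<tau> i" by blast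
  qed
  show "mface i ` code_faces K \<tau> i \<subseteq> black_faces W i"
  proof (rule image_subsetI)
    fix S assume S: "S \<in> code_faces K \<tau> i"
    obtain d where d: "d \<in> blk W" "S = orbit (fstep K \<tau> i) (mpos c d)" using cm_code_face_dart[OF S] .
    have m: "mface i S = orbit (face_perm W i) d" using cm_mface[OF d] .
    have "mface i S \<in> map_faces (mono_submap W i)" unfolding mf m using cm_black(1)[OF cm d(1)] by blast
    moreover have "mface i S \<inter> blk W \<noteq> {}" using m cm_self_in_orbit d(1) by blast
    moreover have "mface i S \<inter> cil W = {}"
      using cm_mface_blk[OF S] cm_cil_iff[OF cm] cm_cil[OF cm] code_facesD(1)[OF cm_partial_inj[OF cm] S] by blast
    ultimately show "mface i S \<in> black_faces W i" by (simp add: black_faces_def)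
  qed
qed

end

lemma same_code_corresponds:
  assumes "same_code (G, \<theta>) (W, \<mu>)"
  shows "corresponds D \<Omega> (G, \<theta>) (W, \<mu>)"
proof -
  obtain K \<tau> c c' where G: "coded_graph G \<theta> K \<tau> c" and W: "coded_map W \<mu> K \<tau> c'"
    using assms by (auto simp: same_code_def)
  note pi = cg_partial_inj[OF G]
  define dart where "dart = inv_into (blk W) (mpos c')"
  have bij: "bij_betw (mpos c') (blk W) (K \<times> \<Omega>)" using cm_mpos_bij[OF W] .
  have dart: "dart a \<in> blk W" "mpos c' (dart a) = a" if "a \<in> K \<times> \<Omega>" for a
    using that bij unfolding dart_def bij_betw_def by (auto simp: inv_into_into f_inv_into_f)
  have dart_mpos: "dart (mpos c' d) = d" if "d \<in> blk W" for d
    using that bij unfolding dart_def bij_betw_def by simp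
  define \<beta> where "\<beta> H = mcopy W c' (inv_into K (gcopy G c) H)" for H
  \<comment> \<open>A black dart names the corner between itself and its successor, and \<tau> leads
    from the pair of the black end to that of the white end; hence the dart at the position of
    \<open>b\<close>.\<close>
  define \<epsilon> where "\<epsilon> = (\<lambda>(j :: nat, w :: 'a, b). dart (gpos c b))"
  \<comment> \<open>Recovers the orbit of positions from the edges of color 0 in a face, so that
    \<phi> is defined on edge sets.\<close>
  define Z where "Z F = gpos c ` {b. \<exists>w. (0, w, b) \<in> F}" for F :: "(nat \<times> 'a \<times> 'a) set"
  define \<phi> where "\<phi> i F = mface W c' i (Z F)" for i F
  have \<beta>: "\<beta> (gcopy G c k) = mcopy W c' k" if "k \<in> K" for k
    using that gcopy_inj[OF G] by (simp add: \<beta>_def)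
  have "bij_betw \<beta> (bubbles_of G) (blue_submaps W)"
  proof -
    have "bij_betw (inv_into K (gcopy G c)) (bubbles_of G) K"
      using gcopy_inj[OF G] cg_bubbles[OF G] by (simp add: bij_betw_inv_into bij_betw_def inj_on_inv_into)
    moreover have "bij_betw (mcopy W c') K (blue_submaps W)"
      using mcopy_inj[OF W] cm_blue_submaps[OF W] by (simp add: bij_betw_def)
    ultimately have "bij_betw (mcopy W c' \<circ> inv_into K (gcopy G c)) (bubbles_of G) (blue_submaps W)"
      by (rule bij_betw_trans)
    then show ?thesis by (simp add: \<beta>_def[abs_def] comp_def)
  qed
  moreover have "bij_betw \<epsilon> {e \<in> cedges G. fst e = 0} (blk W - cil W)"
  proof (rule bij_betwI')
    fix e e' assume ee: "e \<in> {e \<in> cedges G. fst e = 0}" "e' \<in> {e \<in> cedges G. fst e = 0}"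
    obtain w b where e1: "e = (0, w, b)" "(0, w, b) \<in> cedges G" using ee(1) by (cases e) auto
    obtain w' b' where e2: "e' = (0, w', b')" "(0, w', b') \<in> cedges G" using ee(2) by (cases e') auto
    note e = e1 e2
    have bb: "b \<in> black G" "b' \<in> black G" using e cg_edge0[OF G] by auto
    have "\<epsilon> e = dart (gpos c b)" "\<epsilon> e' = dart (gpos c b')" by (simp_all add: e \<epsilon>_def)
    then have "\<epsilon> e = \<epsilon> e' \<longleftrightarrow> gpos c b = gpos c b'"
      using dart(2)[OF cg_gpos_in(2)[OF G bb(1)]] dart(2)[OF cg_gpos_in(2)[OF G bb(2)]] by metis
    also have "\<dots> \<longleftrightarrow> b = b'" using cg_gpos_inj(2)[OF G bb] by blast
    also have "\<dots> \<longleftrightarrow> e = e'" using cg_edge0_unique(2)[OF G] e1(2) e2(2) unfolding e1(1) e2(1) by blast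
    finally show "(\<epsilon> e = \<epsilon> e') = (e = e')" .
  next
    fix e assume "e \<in> {e \<in> cedges G. fst e = 0}"
    then obtain w b where e: "e = (0, w, b)" "(0, w, b) \<in> cedges G" by (cases e) auto
    then have b: "b \<in> black G" "gpos c b \<in> Domain \<tau>" using cg_edge0[OF G] by auto
    note db = dart[OF cg_gpos_in(2)[OF G b(1)]]
    then show "\<epsilon> e \<in> blk W - cil W" using cm_cil_iff[OF W db(1)] b e by (simp add: \<epsilon>_def)
  next
    fix d assume d: "d \<in> blk W - cil W"
    then obtain q where q: "(mpos c' d, q) \<in> \<tau>" using cm_cil_iff[OF W, of d] by blast
    have qK: "mpos c' d \<in> K \<times> \<Omega>" "q \<in> K \<times> \<Omega>" using partial_injD(3)[OF pi q] by simp_all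
    obtain b where b: "b \<in> black G" "mpos c' d = gpos c b" using cg_gpos_surj(2)[OF G qK(1)] by blast
    obtain w where w: "w \<in> white G" "q = gpos c w" using cg_gpos_surj(1)[OF G qK(2)] by blast
    have "(0, w, b) \<in> {e \<in> cedges G. fst e = 0}" using q b w cg_edge0[OF G] by simp
    moreover have "d = \<epsilon> (0, w, b)" using b dart_mpos[of d] d by (simp add: \<epsilon>_def)
    ultimately show "\<exists>e\<in>{e \<in> cedges G. fst e = 0}. d = \<epsilon> e" by blast
  qed
  moreover have faces: "graph_faces G i = gface G c i ` code_faces K \<tau> i" "Z (gface G c i S) = S"
    if "i \<in> {1..D}" "S \<in> code_faces K \<tau> i" for i S
    using cg_graph_faces[OF G that(1)] cg_gface_zero[OF G that(2)] by (auto simp: Z_def)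
  moreover have "bij_betw (\<phi> i) (graph_faces G i) (black_faces W i)" if i: "i \<in> {1..D}" for i
  proof -
    have gf: "graph_faces G i = gface G c i ` code_faces K \<tau> i" using cg_graph_faces[OF G i] .
    have \<phi>: "\<phi> i (gface G c i S) = mface W c' i S" if "S \<in> code_faces K \<tau> i" for S
      using faces(2)[OF i that] by (simp add: \<phi>_def)
    have minj: "S = S'" if SS: "S \<in> code_faces K \<tau> i" "S' \<in> code_faces K \<tau> i" "mface W c' i S = mface W c' i S'" for S S'
    proof -
      have im: "mpos c' ` {d \<in> blk W. mpos c' d \<in> T} = T" if "T \<subseteq> K \<times> \<Omega>" for T
      proof
        show "T \<subseteq> mpos c' ` {d \<in> blk W. mpos c' d \<in> T}"
        proof
          fix a assume "a \<in> T"
          then have "a = mpos c' (dart a)" "dart a \<in> {d \<in> blk W. mpos c' d \<in> T}" using dart[of a] that by auto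
          then show "a \<in> mpos c' ` {d \<in> blk W. mpos c' d \<in> T}" by (rule image_eqI)
        qed
      qed blast
      have "{d \<in> blk W. mpos c' d \<in> S} = {d \<in> blk W. mpos c' d \<in> S'}"
        using cm_mface_blk[OF W SS(1)] cm_mface_blk[OF W SS(2)] SS(3) by simp
      then show ?thesis using im[OF code_facesD(2)[OF pi SS(1)]] im[OF code_facesD(2)[OF pi SS(2)]] by metis
    qed
    have "inj_on (\<phi> i) (graph_faces G i)"
    proof (rule inj_onI)
      fix F F' assume FF: "F \<in> graph_faces G i" "F' \<in> graph_faces G i" "\<phi> i F = \<phi> i F'"
      obtain S where S: "S \<in> code_faces K \<tau> i" "F = gface G c i S" using FF(1) unfolding gf by blast
      obtain S' where S': "S' \<in> code_faces K \<tau> i" "F' = gface G c i S'" using FF(2) unfolding gf by blast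
      have "S = S'" using minj[OF S(1) S'(1)] FF(3) \<phi> S S' by simp
      then show "F = F'" using S S' by simp
    qed
    moreover have "\<phi> i ` graph_faces G i = black_faces W i"
      unfolding gf cm_black_faces[OF W] image_image using \<phi> by (rule image_cong[OF refl])
    ultimately show ?thesis by (simp add: bij_betw_def)
  qed
  moreover have "black_dart_of \<Omega> G \<theta> W \<mu> \<beta> b (\<epsilon> (0, w, b)) \<and> black_dart_of \<Omega> G \<theta> W \<mu> \<beta> w (rot W (\<epsilon> (0, w, b)))"
    if e: "(0, w, b) \<in> cedges G" for w b
  proof -
    have wb: "w \<in> white G" "b \<in> black G" "(gpos c b, gpos c w) \<in> \<tau>" using e cg_edge0[OF G] by auto
    have bd: "black_dart_of \<Omega> G \<theta> W \<mu> \<beta> v d" if v: "v \<in> verts G" "d \<in> blk W" "mpos c' d = gpos c v" for v d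
    proof -
      let ?k = "fst (c v)" and ?x = "pr (\<theta> v)"
      have k: "?k \<in> K" "\<theta> v \<in> verts B" using cg_in(3)[OF G v(1)] by auto
      have g: "mpos c' d = (?k, ?x)" using cg_gpos[OF G v(1)] v(3) by simp
      have "gcopy G c ?k \<in> bubbles_of G" using cg_bubbles[OF G] k by blast
      moreover have "v \<in> verts (gcopy G c ?k)" using verts_gcopy[OF G] v(1) by simp
      moreover have "opp W d \<in> darts (\<beta> (gcopy G c ?k))"
        using \<beta>[OF k(1)] darts_mcopy[OF W] cm_opp_black[OF W v(2)] g by simp
      moreover have "?x \<in> \<Omega>" "\<theta> v \<in> ?x" "\<mu> (opp W d) = Cil ?x"
        using pr_in[OF k(2)] cm_opp_black(4)[OF W v(2)] g by auto
      ultimately show ?thesis unfolding black_dart_of_def using v(2) by blast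
    qed
    note db = dart[OF cg_gpos_in(2)[OF G wb(2)]]
    have \<epsilon>: "\<epsilon> (0, w, b) = dart (gpos c b)" by (simp add: \<epsilon>_def)
    have "mpos c' (rot W (dart (gpos c b))) = gpos c w"
      using cm_rot_black(2)[OF W db(1)] db(2) clo_tau[OF pi wb(3)] by simp
    then show ?thesis unfolding \<epsilon>
      using bd[of b] bd[of w] cg_in(1)[OF G wb(1)] cg_in(2)[OF G wb(2)] db cm_rot_black(1)[OF W db(1)] by blast
  qed
  moreover have "\<phi> i F \<inter> blk W = \<epsilon> ` {e \<in> F. fst e = 0}" if i: "i \<in> {1..D}" and F: "F \<in> graph_faces G i" for i F
  proof -
    obtain S where S: "S \<in> code_faces K \<tau> i" "F = gface G c i S" using cg_graph_faces[OF G i] F by blast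
    have "\<phi> i F \<inter> blk W = {d \<in> blk W. mpos c' d \<in> S}"
      using cm_mface_blk[OF W S(1)] faces(2)[OF i S(1)] S(2) by (simp add: \<phi>_def)
    also have "\<dots> = dart ` S"
    proof
      show "{d \<in> blk W. mpos c' d \<in> S} \<subseteq> dart ` S" using dart_mpos by (metis (mono_tags, lifting) image_eqI mem_Collect_eq subsetI)
      show "dart ` S \<subseteq> {d \<in> blk W. mpos c' d \<in> S}"
      proof (rule image_subsetI)
        fix a assume a: "a \<in> S"
        then have "a \<in> K \<times> \<Omega>" using code_facesD(2)[OF pi S(1)] by blast
        then show "dart a \<in> {d \<in> blk W. mpos c' d \<in> S}" using dart[of a] a by simp
      qed
    qed
    also have "\<dots> = dart ` Z F" using faces(2)[OF i S(1)] S(2) by simp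
    also have "\<dots> = \<epsilon> ` {e \<in> F. fst e = 0}"
    proof -
      have "{e \<in> F. fst e = 0} = (\<lambda>(w, b). (0, w, b)) ` {(w, b). (0, w, b) \<in> F}" by force
      then have "\<epsilon> ` {e \<in> F. fst e = 0} = (\<lambda>(w, b). dart (gpos c b)) ` {(w, b). (0, w, b) \<in> F}"
        by (simp add: image_image case_prod_beta \<epsilon>_def)
      moreover have "\<dots> = dart ` gpos c ` {b. \<exists>w. (0, w, b) \<in> F}" by force
      ultimately show ?thesis unfolding Z_def by simp
    qed
    finally show ?thesis .
  qed
  ultimately have "bij_betw \<beta> (bubbles_of G) (blue_submaps W) \<and>
     bij_betw \<epsilon> {e \<in> cedges G. fst e = 0} (blk W - cil W) \<and>
     (\<forall>i\<in>{1..D}. bij_betw (\<phi> i) (graph_faces G i) (black_faces W i)) \<and>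
     (\<forall>w b. (0, w, b) \<in> cedges G \<longrightarrow>
        black_dart_of \<Omega> G \<theta> W \<mu> \<beta> b (\<epsilon> (0, w, b)) \<and> black_dart_of \<Omega> G \<theta> W \<mu> \<beta> w (rot W (\<epsilon> (0, w, b)))) \<and>
     (\<forall>i\<in>{1..D}. \<forall>F\<in>graph_faces G i. \<phi> i F \<inter> blk W = \<epsilon> ` {e \<in> F. fst e = 0})" by simp
  then show ?thesis unfolding corresponds_def case_prod_conv by blast
qed

section \<open>The bijection\<close>

lemma ex_same_code_of_graph:
  assumes "(G, \<theta>) \<in> id_graphs D B p"
  shows "\<exists>(W :: nat wmap) \<mu>. (W, \<mu>) \<in> id_walsh_maps M p \<and> same_code (G, \<theta>) (W, \<mu>)"
proof -
  obtain K \<tau> c where G: "coded_graph G \<theta> K \<tau> c" using ex_coded_graph_of_id_graph[OF assms] by blast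
  obtain W :: "nat wmap" and \<mu> c' where W: "coded_map W \<mu> K \<tau> c'" using ex_coded_map[OF cg_partial_inj[OF G]] by blast
  have "(W, \<mu>) \<in> id_walsh_maps M p"
    using coded_graph_in_id_graphs[OF G] coded_map_in_id_walsh_maps[OF W] assms by blast
  then show ?thesis using same_codeI[OF G W] by blast
qed

lemma ex_same_code_of_map:
  assumes "(W, \<mu>) \<in> id_walsh_maps M p"
  shows "\<exists>(G :: nat cgraph) \<theta>. (G, \<theta>) \<in> id_graphs D B p \<and> same_code (G, \<theta>) (W, \<mu>)"
proof -
  obtain K \<tau> c' where W: "coded_map W \<mu> K \<tau> c'" using ex_coded_map_of_id_walsh_map[OF assms] by blast
  obtain G :: "nat cgraph" and \<theta> c where G: "coded_graph G \<theta> K \<tau> c" using ex_coded_graph[OF cm_partial_inj[OF W]] by blast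
  have "(G, \<theta>) \<in> id_graphs D B p"
    using coded_graph_in_id_graphs[OF G] coded_map_in_id_walsh_maps[OF W] assms by blast
  then show ?thesis using same_codeI[OF G W] by blast
qed

lemma same_code_in_iff:
  assumes "same_code (G, \<theta>) (W, \<mu>)"
  shows "(G, \<theta>) \<in> id_graphs D B p \<longleftrightarrow> (W, \<mu>) \<in> id_walsh_maps M p"
proof -
  obtain K \<tau> c c' where G: "coded_graph G \<theta> K \<tau> c" and W: "coded_map W \<mu> K \<tau> c'"
    using assms by (auto simp: same_code_def)
  show ?thesis using coded_graph_in_id_graphs[OF G] coded_map_in_id_walsh_maps[OF W] by simp
qed

lemma same_code_iso_graph:
  assumes "same_code (G, \<theta>) (W, \<mu>)" "(G, \<theta>) \<in> id_graphs D B p" "((G, \<theta>), (G', \<theta>')) \<in> id_graph_rel (id_graphs D B p)"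
  shows "same_code (G', \<theta>') (W, \<mu>)"
proof -
  obtain K \<tau> c c' where G: "coded_graph G \<theta> K \<tau> c" and W: "coded_map W \<mu> K \<tau> c'"
    using assms(1) by (auto simp: same_code_def)
  have "((G', \<theta>'), (G, \<theta>)) \<in> id_graph_rel (id_graphs D B p)"
    using equiv_id_graph_rel assms(3) by (meson equivE symE)
  then obtain f where f: "graph_iso f G' G" "\<forall>v\<in>verts G'. \<theta> (f v) = \<theta>' v" "(G', \<theta>') \<in> id_graphs D B p"
    by (auto simp: id_graph_rel_def)
  have "coded_graph G' \<theta>' K \<tau> (c \<circ> f)"
    using coded_graph_iso[OF G f(1)] f(2,3) by (auto simp: id_graphs_def bubble_graphs_def)
  then show ?thesis using W by (auto simp: same_code_def)
qed

lemma same_code_iso_map: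
  assumes "same_code (G, \<theta>) (W, \<mu>)" "((W, \<mu>), (W', \<mu>')) \<in> id_walsh_rel (id_walsh_maps M p)"
  shows "same_code (G, \<theta>) (W', \<mu>')"
proof -
  obtain K \<tau> c c' where G: "coded_graph G \<theta> K \<tau> c" and W: "coded_map W \<mu> K \<tau> c'"
    using assms(1) by (auto simp: same_code_def)
  have "((W', \<mu>'), (W, \<mu>)) \<in> id_walsh_rel (id_walsh_maps M p)"
    using equiv_id_walsh_rel assms(2) by (meson equivE symE)
  then obtain f where f: "walsh_iso f W' W" "\<forall>d\<in>darts W' - blk W'. \<mu> (f d) = \<mu>' d" "(W', \<mu>') \<in> id_walsh_maps M p"
    by (auto simp: id_walsh_rel_def)
  have "coded_map W' \<mu>' K \<tau> (c' \<circ> f)" using coded_map_iso[OF W f(1,3)] f(2) by blast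
  then show ?thesis using G by (auto simp: same_code_def)
qed

text \<open>The two codes of the identified graph differ by a renumbering. Moving one map along it
  gives both maps the same code, hence the same standard map.\<close>

lemma same_code_unique_map:
  assumes "same_code (G, \<theta>) (W, \<mu>)" "same_code (G, \<theta>) (W', \<mu>')"
  shows "\<exists>f. walsh_iso f W W' \<and> (\<forall>d\<in>darts W - blk W. \<mu>' (f d) = \<mu> d)"
proof -
  obtain K \<tau> c c' where G: "coded_graph G \<theta> K \<tau> c" and W: "coded_map W \<mu> K \<tau> c'"
    using assms(1) by (auto simp: same_code_def)
  obtain K1 \<tau>1 c1 c1' where G1: "coded_graph G \<theta> K1 \<tau>1 c1" and W1: "coded_map W' \<mu>' K1 \<tau>1 c1'"
    using assms(2) by (auto simp: same_code_def)
  obtain h where h: "bij_betw h K K1"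
    "\<And>k l x y. \<lbrakk>k \<in> K; l \<in> K; x \<in> \<Omega>; y \<in> \<Omega>\<rbrakk> \<Longrightarrow> ((k, x), (l, y)) \<in> \<tau> \<longleftrightarrow> ((h k, x), (h l, y)) \<in> \<tau>1"
    using coded_graph_unique[OF G G1] by metis
  obtain c'' where "coded_map W \<mu> K1 \<tau>1 c''" using coded_map_relabel[OF W cm_partial_inj[OF W1] h] by blast
  then show ?thesis using coded_maps_iso W1 by blast
qed

lemma same_code_unique_graph:
  assumes "same_code (G, \<theta>) (W, \<mu>)" "same_code (G', \<theta>') (W, \<mu>)"
  shows "\<exists>f. graph_iso f G G' \<and> (\<forall>v\<in>verts G. \<theta>' (f v) = \<theta> v)"
proof -
  obtain K \<tau> c c' where G: "coded_graph G \<theta> K \<tau> c" and W: "coded_map W \<mu> K \<tau> c'"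
    using assms(1) by (auto simp: same_code_def)
  obtain K1 \<tau>1 c1 c1' where G1: "coded_graph G' \<theta>' K1 \<tau>1 c1" and W1: "coded_map W \<mu> K1 \<tau>1 c1'"
    using assms(2) by (auto simp: same_code_def)
  obtain h where h: "bij_betw h K K1"
    "\<And>k l x y. \<lbrakk>k \<in> K; l \<in> K; x \<in> \<Omega>; y \<in> \<Omega>\<rbrakk> \<Longrightarrow> ((k, x), (l, y)) \<in> \<tau> \<longleftrightarrow> ((h k, x), (h l, y)) \<in> \<tau>1"
    using coded_map_unique[OF W W1] by metis
  obtain c'' where "coded_graph G \<theta> K1 \<tau>1 c''" using coded_graph_relabel[OF G cg_partial_inj[OF G1] h] by blast
  then show ?thesis using coded_graphs_iso G1 by blast
qed

lemma same_code_compat: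
  assumes in_sets: "(G, \<theta>) \<in> id_graphs D B p" "(W, \<mu>) \<in> id_walsh_maps M p"
      "(G', \<theta>') \<in> id_graphs D B p" "(W', \<mu>') \<in> id_walsh_maps M p"
    and same: "same_code (G, \<theta>) (W, \<mu>)" "same_code (G', \<theta>') (W', \<mu>')"
  shows "((G, \<theta>), (G', \<theta>')) \<in> id_graph_rel (id_graphs D B p) \<longleftrightarrow>
    ((W, \<mu>), (W', \<mu>')) \<in> id_walsh_rel (id_walsh_maps M p)"
proof
  assume "((G, \<theta>), (G', \<theta>')) \<in> id_graph_rel (id_graphs D B p)"
  then have "same_code (G', \<theta>') (W, \<mu>)" using same_code_iso_graph same(1) in_sets(1) by blast
  then show "((W, \<mu>), (W', \<mu>')) \<in> id_walsh_rel (id_walsh_maps M p)"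
    using same_code_unique_map[OF _ same(2)] in_sets by (simp add: id_walsh_rel_def)
next
  assume "((W, \<mu>), (W', \<mu>')) \<in> id_walsh_rel (id_walsh_maps M p)"
  then have "same_code (G, \<theta>) (W', \<mu>')" using same_code_iso_map same(1) by blast
  then show "((G, \<theta>), (G', \<theta>')) \<in> id_graph_rel (id_graphs D B p)"
    using same_code_unique_graph[OF _ same(2)] in_sets by (simp add: id_graph_rel_def)
qed

lemma bij_identified:
  "\<exists>\<Phi>. bij_betw \<Phi> ((id_graphs D B p :: (nat cgraph \<times> (nat \<Rightarrow> 'v)) set) // id_graph_rel (id_graphs D B p))
      ((id_walsh_maps M p :: (nat wmap \<times> (nat \<Rightarrow> 'v set hedge)) set) // id_walsh_rel (id_walsh_maps M p)) \<and>
    (\<forall>g\<in>id_graphs D B p. \<forall>w\<in>\<Phi> (id_graph_rel (id_graphs D B p) `` {g}). same_code g w)"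
proof (rule bij_betw_quotients[OF equiv_id_graph_rel equiv_id_walsh_rel])
  fix g :: "nat cgraph \<times> (nat \<Rightarrow> 'v)" assume "g \<in> id_graphs D B p"
  then show "\<exists>w :: nat wmap \<times> (nat \<Rightarrow> 'v set hedge)\<in>id_walsh_maps M p. same_code g w"
    using ex_same_code_of_graph by (cases g) fastforce
next
  fix w :: "nat wmap \<times> (nat \<Rightarrow> 'v set hedge)" assume "w \<in> id_walsh_maps M p"
  then show "\<exists>g :: nat cgraph \<times> (nat \<Rightarrow> 'v)\<in>id_graphs D B p. same_code g w"
    using ex_same_code_of_map by (cases w) fastforce
next
  fix g g' :: "nat cgraph \<times> (nat \<Rightarrow> 'v)" and w w' :: "nat wmap \<times> (nat \<Rightarrow> 'v set hedge)"
  assume "g \<in> id_graphs D B p" "w \<in> id_walsh_maps M p" "g' \<in> id_graphs D B p" "w' \<in> id_walsh_maps M p"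
    "same_code g w" "same_code g' w'"
  then show "(g, g') \<in> id_graph_rel (id_graphs D B p) \<longleftrightarrow> (w, w') \<in> id_walsh_rel (id_walsh_maps M p)"
    using same_code_compat by (cases g; cases w; cases g'; cases w') blast
next
  fix g :: "nat cgraph \<times> (nat \<Rightarrow> 'v)" and w w' :: "nat wmap \<times> (nat \<Rightarrow> 'v set hedge)"
  assume "same_code g w" "(w, w') \<in> id_walsh_rel (id_walsh_maps M p)"
  then show "same_code g w'" using same_code_iso_map by (cases g; cases w; cases w') blast
qed

text \<open>Lets the identifications vary, and thereby becomes invariant under isomorphisms that
  ignore them.\<close>

definition same_code_some_id :: "nat \<Rightarrow> 'a cgraph \<Rightarrow> 'd wmap \<Rightarrow> bool" where
  "same_code_some_id p G W \<longleftrightarrow> (\<exists>\<theta> \<mu>. (G, \<theta>) \<in> id_graphs D B p \<and> (W, \<mu>) \<in> id_walsh_maps M p \<and>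
     same_code (G, \<theta>) (W, \<mu>))"

lemma same_code_some_id_map:
  assumes "same_code_some_id p G W" "W' \<in> walsh_maps M p" "walsh_iso f W W'"
  shows "same_code_some_id p G W'"
proof -
  obtain \<theta> \<mu> where G: "(G, \<theta>) \<in> id_graphs D B p" and W: "(W, \<mu>) \<in> id_walsh_maps M p"
    and same: "same_code (G, \<theta>) (W, \<mu>)" using assms(1) by (auto simp: same_code_some_id_def)
  obtain K \<tau> c c' where cg: "coded_graph G \<theta> K \<tau> c" and cm: "coded_map W \<mu> K \<tau> c'"
    using same by (auto simp: same_code_def)
  have Wm: "W \<in> walsh_maps M p" using W by (simp add: id_walsh_maps_def)
  let ?i = "inv_into (darts W) f"
  note i = walsh_iso_sym[OF Wm assms(3)]
  have "rot W' permutes darts W'" "opp W' permutes darts W'"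
    using assms(2) by (auto simp: walsh_maps_def comb_map_def)
  moreover have "\<exists>k. (c' \<circ> ?i) d = Inl (k, \<mu> (?i d))" if "d \<in> darts W' - blk W'" for d
    using walsh_iso_blue[OF i walsh_maps_closed(2)[OF assms(2)] that] cm_blue(1)[OF cm, of "?i d"] by auto
  ultimately have cm': "coded_map W' (\<mu> \<circ> ?i) K \<tau> (c' \<circ> ?i)"
    using cm walsh_maps_closed(2,3)[OF assms(2)] walsh_iso_comp[OF i, of c'] by (simp add: coded_map_def)
  then have s': "same_code (G, \<theta>) (W', \<mu> \<circ> ?i)" using cg by (auto simp: same_code_def)
  then have "(W', \<mu> \<circ> ?i) \<in> id_walsh_maps M p" using same_code_in_iff[OF s'] G by blast
  then show ?thesis using G s' by (auto simp: same_code_some_id_def)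
qed

lemma same_code_some_id_graph:
  assumes "same_code_some_id p G W" "G' \<in> bubble_graphs D B p" "graph_iso f G G'"
  shows "same_code_some_id p G' W"
proof -
  obtain \<theta> \<mu> where G: "(G, \<theta>) \<in> id_graphs D B p" and W: "(W, \<mu>) \<in> id_walsh_maps M p"
    and same: "same_code (G, \<theta>) (W, \<mu>)" using assms(1) by (auto simp: same_code_some_id_def)
  obtain K \<tau> c c' where cg: "coded_graph G \<theta> K \<tau> c" and cm: "coded_map W \<mu> K \<tau> c'"
    using same by (auto simp: same_code_def)
  let ?i = "inv_into (verts G) f"
  have "bip_graph {0..D} G'" using assms(2) by (simp add: bubble_graphs_def)
  then have "coded_graph G' (\<theta> \<circ> ?i) K \<tau> (c \<circ> ?i)"
    using coded_graph_iso[OF cg graph_iso_inv[OF assms(3)], of "\<theta> \<circ> ?i"] by simp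
  then have s': "same_code (G', \<theta> \<circ> ?i) (W, \<mu>)" using cm by (auto simp: same_code_def)
  then have "(G', \<theta> \<circ> ?i) \<in> id_graphs D B p" using same_code_in_iff[OF s'] W by blast
  then show ?thesis using W s' by (auto simp: same_code_some_id_def)
qed

lemma same_code_some_id_compat:
  assumes lift: "automorphisms_lift B \<Omega> M"
    and same: "same_code_some_id p G W" "same_code_some_id p G' W'"
    and in_sets: "G \<in> bubble_graphs D B p" "G' \<in> bubble_graphs D B p" "W \<in> walsh_maps M p" "W' \<in> walsh_maps M p"
  shows "(\<exists>f. graph_iso f G G') \<longleftrightarrow> (\<exists>f. walsh_iso f W W')"
proof
  obtain \<theta>' \<mu>' where G': "(G', \<theta>') \<in> id_graphs D B p" and W': "(W', \<mu>') \<in> id_walsh_maps M p"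
    and same': "same_code (G', \<theta>') (W', \<mu>')" using same(2) by (auto simp: same_code_some_id_def)
  {
    assume "\<exists>f. graph_iso f G G'"
    then have "same_code_some_id p G' W" using same_code_some_id_graph[OF same(1) in_sets(2)] by blast
    then obtain \<theta> \<mu> where "same_code (G', \<theta>) (W, \<mu>)" by (auto simp: same_code_some_id_def)
    \<comment> \<open>The isomorphism transports some identification of \<open>G'\<close>, possibly
      not \<theta>'. The lifting of automorphisms replaces it by \<theta>' without altering the bare
      map.\<close>
    then obtain \<mu>1 where "same_code (G', \<theta>') (W, \<mu>1)" using same_code_change_theta[OF lift _ G'] by blast
    then show "\<exists>f. walsh_iso f W W'" using same_code_unique_map same' by blast
  next
    assume "\<exists>f. walsh_iso f W W'"
    then have "same_code_some_id p G W'" using same_code_some_id_map[OF same(1) in_sets(4)] by blast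
    then obtain \<theta> \<mu> where "same_code (G, \<theta>) (W', \<mu>)" by (auto simp: same_code_some_id_def)
    \<comment> \<open>Now the identification of \<open>W'\<close> is adjusted to \<mu>', which is
      always possible because automorphisms of \<open>M\<close> induce automorphisms of
      \<open>B\<close>.\<close>
    then obtain \<theta>1 where "same_code (G, \<theta>1) (W', \<mu>')" using same_code_change_mu[OF _ W'] by blast
    then show "\<exists>f. graph_iso f G G'" using same_code_unique_graph same' by blast
  }
qed

lemma bij_unidentified:
  assumes lift: "automorphisms_lift B \<Omega> M"
  shows "\<exists>\<Psi>. bij_betw \<Psi> ((bubble_graphs D B p :: nat cgraph set) // graph_iso_rel (bubble_graphs D B p))
      ((walsh_maps M p :: nat wmap set) // walsh_iso_rel (walsh_maps M p)) \<and>
    (\<forall>G\<in>bubble_graphs D B p. \<forall>W\<in>\<Psi> (graph_iso_rel (bubble_graphs D B p) `` {G}). same_code_some_id p G W)"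
proof (rule bij_betw_quotients[OF equiv_graph_iso_rel equiv_walsh_iso_rel])
  fix G :: "nat cgraph" assume "G \<in> bubble_graphs D B p"
  then obtain \<theta> where G: "(G, \<theta>) \<in> id_graphs D B p" using ex_id_graph by blast
  then obtain W :: "nat wmap" and \<mu> where W: "(W, \<mu>) \<in> id_walsh_maps M p" "same_code (G, \<theta>) (W, \<mu>)"
    using ex_same_code_of_graph by blast
  then have "W \<in> walsh_maps M p" "same_code_some_id p G W"
    using G by (auto simp: same_code_some_id_def id_walsh_maps_def)
  then show "\<exists>W :: nat wmap\<in>walsh_maps M p. same_code_some_id p G W" by blast
next
  fix W :: "nat wmap" assume "W \<in> walsh_maps M p"
  then obtain \<mu> where W: "(W, \<mu>) \<in> id_walsh_maps M p" using ex_id_walsh_map by blast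
  then obtain G :: "nat cgraph" and \<theta> where G: "(G, \<theta>) \<in> id_graphs D B p" "same_code (G, \<theta>) (W, \<mu>)"
    using ex_same_code_of_map by blast
  then have "G \<in> bubble_graphs D B p" "same_code_some_id p G W"
    using W by (auto simp: same_code_some_id_def id_graphs_def)
  then show "\<exists>G :: nat cgraph\<in>bubble_graphs D B p. same_code_some_id p G W" by blast
next
  fix G G' :: "nat cgraph" and W W' :: "nat wmap"
  assume *: "G \<in> bubble_graphs D B p" "W \<in> walsh_maps M p" "G' \<in> bubble_graphs D B p" "W' \<in> walsh_maps M p"
    "same_code_some_id p G W" "same_code_some_id p G' W'"
  then show "(G, G') \<in> graph_iso_rel (bubble_graphs D B p) \<longleftrightarrow> (W, W') \<in> walsh_iso_rel (walsh_maps M p)"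
    using same_code_some_id_compat[OF lift *(5,6,1,3,2,4)] by (simp add: graph_iso_rel_def walsh_iso_rel_def)
next
  fix G :: "nat cgraph" and W W' :: "nat wmap"
  assume "same_code_some_id p G W" "(W, W') \<in> walsh_iso_rel (walsh_maps M p)"
  then show "same_code_some_id p G W'" using same_code_some_id_map by (auto simp: walsh_iso_rel_def)
qed

end

theorem theorem3:
  fixes D p :: nat and B :: "'v cgraph" and \<Omega> :: "'v set set"
    and os "is" :: "'v set \<Rightarrow> nat list" and M :: "'v set hedge cmap"
    and GG :: "nat cgraph set" and WW :: "nat wmap set"
    and GGid :: "(nat cgraph \<times> (nat \<Rightarrow> 'v)) set"
    and WWid :: "(nat wmap \<times> (nat \<Rightarrow> 'v set hedge)) set"
  assumes "D \<ge> 2" and "bubble D B" and "pairing B \<Omega>" and "edge_orders B \<Omega> os is"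
    and M: "M = bubble_map B \<Omega> os is"
    and GG: "GG = bubble_graphs D B p" and WW: "WW = walsh_maps M p"
    and GGid: "GGid = id_graphs D B p" and WWid: "WWid = id_walsh_maps M p"
  shows "(\<exists>\<Phi>. bij_betw \<Phi> (GGid // id_graph_rel GGid) (WWid // id_walsh_rel WWid) \<and>
             (\<forall>g\<in>GGid. \<forall>w\<in>\<Phi> (id_graph_rel GGid `` {g}). corresponds D \<Omega> g w)) \<and>
         (automorphisms_lift B \<Omega> M \<longrightarrow>
           (\<exists>\<Psi>. bij_betw \<Psi> (GG // graph_iso_rel GG) (WW // walsh_iso_rel WW) \<and>
             (\<forall>G\<in>GG. \<forall>W\<in>\<Psi> (graph_iso_rel GG `` {G}).
                \<exists>\<theta> \<mu>. (G, \<theta>) \<in> GGid \<and> (W, \<mu>) \<in> WWid \<and> corresponds D \<Omega> (G, \<theta>) (W, \<mu>))))"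
proof -
  interpret paired_bubble D B \<Omega> os "is" M
    using assms(2-4) M by unfold_locales
  have corr: "corresponds D \<Omega> g w" if "same_code g w"
    for g :: "nat cgraph \<times> (nat \<Rightarrow> 'v)" and w :: "nat wmap \<times> (nat \<Rightarrow> 'v set hedge)"
    using same_code_corresponds that by (cases g; cases w) blast
  show ?thesis
  proof (intro conjI impI)
    show "\<exists>\<Phi>. bij_betw \<Phi> (GGid // id_graph_rel GGid) (WWid // id_walsh_rel WWid) \<and>
        (\<forall>g\<in>GGid. \<forall>w\<in>\<Phi> (id_graph_rel GGid `` {g}). corresponds D \<Omega> g w)"
      unfolding GGid WWid using bij_identified[of p] corr by blast
    assume lift: "automorphisms_lift B \<Omega> M"
    obtain \<Psi> where \<Psi>: "bij_betw \<Psi> (GG // graph_iso_rel GG) (WW // walsh_iso_rel WW)"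
      "\<forall>G\<in>GG. \<forall>W\<in>\<Psi> (graph_iso_rel GG `` {G}). same_code_some_id p G W"
      using bij_unidentified[OF lift, of p] unfolding GG WW by blast
    then show "\<exists>\<Psi>. bij_betw \<Psi> (GG // graph_iso_rel GG) (WW // walsh_iso_rel WW) \<and>
        (\<forall>G\<in>GG. \<forall>W\<in>\<Psi> (graph_iso_rel GG `` {G}).
          \<exists>\<theta> \<mu>. (G, \<theta>) \<in> GGid \<and> (W, \<mu>) \<in> WWid \<and> corresponds D \<Omega> (G, \<theta>) (W, \<mu>))"
      unfolding GGid WWid using corr by (intro exI[of _ \<Psi>]) (meson same_code_some_id_def)
  qed
qed

end
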